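(* Let $A$ be a (not necessarily unital) cyclic $A_\infty$-algebra over $\mathbb{K}$ whose inner product is odd, and let $N\ge 1$ be an integer. The map $$\sigma_K\circ\widehat{\mathcal M}_{\gamma,\nu}:\ \widehat{\mathrm P}^{\mathrm{nc}}_{\gamma,\nu}[\Sigma A]\longrightarrow\widehat{\mathrm P}_\hbar[\Sigma\mathfrak{gl}_N(A)]^{\mathfrak{gl}_N(\mathbb K)}$$ intertwines the Lie brackets, intertwines the differentials $\nabla+\gamma\delta$ and $\hbar\Delta$, and also intertwines the differentials $\{\tilde m_A,-\}$ and $\{\tilde l_{\mathfrak{gl}_N(A)},-\}$.
   Context: $\mathbb K$ is a field of characteristic zero; all vector spaces are $\mathbb Z/2$-graded and the Koszul sign rule is used. $\Sigma$ is the parity shift, $\mathbb S_k$ the symmetric group; a subscript group denotes coinvariants, a superscript invariants. $\widehat T,\widehat S$ are completed tensor and symmetric algebras (direct products of tensor powers, resp. of $\mathbb S_n$-coinvariants of tensor powers); $\widehat T_+,\widehat S_+$ are their parts of degree $\ge1$. Commutative side. Let $V$ be finite-dimensional with an odd symplectic form $\langle-,-\rangle$. The inverse form on $V^*$ is defined by $\langle-,-\rangle^{-1}\circ(D_l\otimes D_r)=\langle-,-\rangle$, $D_l(y)=\langle y,-\rangle$, $D_r(y)=\langle -,y\rangle$. It extends by the Leibniz rule to an odd Poisson bracket $\{-,-\}$ on $\widehat S V^*$. $\Delta$ is the unique operator on $\widehat SV^*$ vanishing on constants and linear terms with $\Delta(ab)=(\Delta a)b+(-1)^a a(\Delta b)+\{a,b\}$.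 $\widehat{\mathrm P}_\hbar[V]:=\mathbb K[[\hbar]]\widehat\otimes\widehat SV^*$ ($\hbar$ even) is the dg Lie algebra with $\hbar$-linear odd bracket $\{-,-\}$ and differential $\hbar\Delta$. Noncommutative side. $\widehat{\mathrm H}[V]:=\prod_{k\ge0}[(V^* )^{\widehat\otimes k}]_{\mathbb Z/k}$ (completed cyclic words), with $\nu$ the generator of the $k=0$ term and $\widehat{\mathrm H}_+[V]$ the product over $k\ge1$. It has the odd Lie bracket $$\{(a_1\cdots a_m),(b_1\cdots b_n)\}=\sum_{i,j}\pm\langle a_i,b_j\rangle^{-1}(a_{i+1}\cdots a_ma_1\cdots a_{i-1}b_{j+1}\cdots b_nb_1\cdots b_{j-1})$$ and odd cobracket $$\nabla(a_1\cdots a_n)=\sum_{i<j}\pm\langle a_i,a_j\rangle^{-1}(a_{i+1}\cdots a_{j-1})\otimes(a_{j+1}\cdots a_na_1\cdots a_{i-1}),$$ with Koszul signs; the empty word is $\nu$. Then $\widehat{\mathrm P}^{\mathrm{nc}}_{\gamma,\nu}[V]:=\mathbb K[[\gamma]]\widehat\otimes\widehat S_+(\widehat{\mathrm H}[V])$ ($\gamma$ even) is the dg Lie algebra whose odd bracket is the $\gamma$-linear Leibniz extension of the bracket of $\widehat{\mathrm H}[V]$, and whose differential is $\nabla+\gamma\delta$; here $\delta(a_1\cdots a_n)=\sum_{i<j}\pm\{a_i,a_j\}a_1\cdots\widehat{a_i}\cdots\widehat{a_j}\cdots a_n$ on a symmetric product of $a_i\in\widehat{\mathrm H}[V]$, and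 $\nabla$ is extended as a derivation. Maps. $V\otimes\mathrm M_N(\mathbb K)$ has the odd symplectic form $\langle a\otimes X,b\otimes Y\rangle=\langle a,b\rangle\mathrm{Tr}(XY)$. $\mathcal M:\widehat{\mathrm H}[V]\to\widehat{\mathrm H}[V\otimes\mathrm M_N(\mathbb K)]$ sends a length-$k$ ($k\ge1$) cyclic word, viewed as a $k$-multilinear form on $V$, to its tensor product with $t_k(X_1,\dots,X_k)=\mathrm{Tr}(X_1\cdots X_k)$, and $\nu\mapsto N\nu$. $\widehat{\mathcal M}_{\gamma,\nu}:\widehat{\mathrm P}^{\mathrm{nc}}_{\gamma,\nu}[V]\to\widehat{\mathrm P}^{\mathrm{nc}}_{\gamma,\nu}[V\otimes\mathrm M_N(\mathbb K)]$ is its continuous $\gamma$-linear multiplicative extension. $\sigma_K:\widehat{\mathrm P}^{\mathrm{nc}}_{\gamma,\nu}[V]\to\widehat{\mathrm P}_\hbar[V]$ is given by $$\sigma_K\big(\gamma^i\nu^j(a_{11}\cdots a_{1k_1})\cdots(a_{n1}\cdots a_{nk_n})\big)=\hbar^{2i+j+n-1}a_{11}\cdots a_{1k_1}\cdots a_{n1}\cdots a_{nk_n}.$$ $\mathfrak{gl}_N(\mathbb K)$ acts on $V\otimes\mathrm M_N(\mathbb K)$ by commutators in the second factor and on symmetric algebras by derivations. Algebras. An $A_\infty$-structure on $A$ is an odd continuous derivation $m$ of $\widehat T\Sigma A^*$ with $m^2=0$ and image in $\widehat T_+\Sigma A^*$; equivalently structure maps $m_k:A^{\otimes k}\to A$,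 $k\ge1$. It is cyclic with respect to a symmetric nondegenerate form $\langle-,-\rangle$ on (finite-dimensional) $A$ if each $\langle m_k(a_0,\dots,a_{k-1}),a_k\rangle$ is cyclically antisymmetric. An odd such form induces, via $\Sigma\otimes\Sigma$, an odd symplectic form on $\Sigma A$. The forms $\langle m_k(-),-\rangle$ give cyclically invariant tensors $\alpha_{k+1}$ on $\Sigma A$, and $\tilde m_A:=\sum_k\frac1{k+1}[\alpha_{k+1}]\in\widehat{\mathrm H}[\Sigma A]\subset\widehat{\mathrm P}^{\mathrm{nc}}_{\gamma,\nu}[\Sigma A]$; one has $\{\tilde m_A,\tilde m_A\}=0$. $\mathrm M_N(A)=A\otimes\mathrm M_N(\mathbb K)$ has structure maps $m_k$ tensored with the $k$-fold matrix product, and the product form with the trace pairing. $\mathfrak{gl}_N(A)$ is the commutator $L_\infty$-algebra of $\mathrm M_N(A)$: the derivation $l$ of $\widehat S\Sigma\mathfrak{gl}_N(A)^*$ induced by that of $\widehat T\Sigma\mathrm M_N(A)^*$. It is cyclic, and with structure maps $l_k$ the forms $\langle l_k(-),-\rangle$ give symmetric tensors $\beta_{k+1}$ on $\Sigma\mathfrak{gl}_N(A)$; set $\tilde l_{\mathfrak{gl}_N(A)}:=\sum_k\frac1{(k+1)!}[\beta_{k+1}]\in\widehat S\Sigma\mathfrak{gl}_N(A)^*$, which is $\mathfrak{gl}_N(\mathbb K)$-invariant. *)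

theory Defs
  imports
    "HOL-Analysis.Determinants"
    "HOL-Library.Function_Algebras"
    "HOL-Library.Groups_Big_Fun"
    "HOL-Combinatorics.Multiset_Permutations"
begin

section \<open>Koszul signs and power series\<close>

text \<open>Parities are Booleans, \<^term>\<open>True\<close> meaning odd.\<close>

definition sg :: "bool \<Rightarrow> 'k::field_char_0"
  where "sg q = (if q then - 1 else 1)"

definition word_parity :: "('a \<Rightarrow> bool) \<Rightarrow> 'a list \<Rightarrow> bool"
  where "word_parity p w = odd (length (filter p w))"

text \<open>The sign for which, in graded commuting letters, the product of \<open>w\<close> equals
  the sign times the product of \<open>map ((!) w) js\<close>; here \<open>js\<close> lists the positions
  \<open>0, \<dots>, length w - 1\<close> in their new order.\<close>

definition koszul :: "('a \<Rightarrow> bool) \<Rightarrow> 'a list \<Rightarrow> nat list \<Rightarrow> 'k::field_char_0"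
  where "koszul p w js =
    (\<Prod>(r, s) \<in> {(r, s). r < s \<and> s < length js \<and> js ! s < js ! r}.
       sg (p (w ! (js ! r)) \<and> p (w ! (js ! s))))"

definition del :: "nat \<Rightarrow> 'a list \<Rightarrow> 'a list"
  where "del i w = take i w @ drop (Suc i) w"

text \<open>The reordering of \<open>n\<close> positions that brings \<open>i\<close> and then \<open>j\<close> to the front.\<close>

definition to_front2 :: "nat \<Rightarrow> nat \<Rightarrow> nat \<Rightarrow> nat list"
  where "to_front2 n i j = [i, j] @ filter (\<lambda>k. k \<noteq> i \<and> k \<noteq> j) [0..<n]"

text \<open>A formal power series is the function sending a monomial to its coefficient; continuous
  (bi)linear operators are given by their matrix \<open>T\<close>, where \<open>T w u\<close> is the coefficient
  of \<open>u\<close> in the image of \<open>w\<close>. For all operators below, and series in finitely many letters,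
  the sums are finite.\<close>

definition single :: "'m \<Rightarrow> 'm \<Rightarrow> 'k::field_char_0"
  where "single x = (\<lambda>y. of_bool (y = x))"

definition lin_ext :: "('m \<Rightarrow> 'n \<Rightarrow> 'k::field_char_0) \<Rightarrow> ('m \<Rightarrow> 'k) \<Rightarrow> 'n \<Rightarrow> 'k"
  where "lin_ext T f = (\<lambda>u. Sum_any (\<lambda>w. f w * T w u))"

definition bilin_ext ::
    "('m \<Rightarrow> 'm \<Rightarrow> 'n \<Rightarrow> 'k::field_char_0) \<Rightarrow> ('m \<Rightarrow> 'k) \<Rightarrow> ('m \<Rightarrow> 'k) \<Rightarrow> 'n \<Rightarrow> 'k"
  where "bilin_ext T f g = (\<lambda>u. Sum_any (\<lambda>(w, v). f w * g v * T w v u))"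

section \<open>Completed coinvariants\<close>

text \<open>The coinvariants are products, over the values of a degree function, of quotients of
  finite-dimensional spaces by the span of relations \<open>x - g x\<close>. So the subspace
  divided out consists of the series all of whose homogeneous components lie in the span.\<close>

definition degreewise_span :: "('m \<Rightarrow> 'd) \<Rightarrow> ('m \<Rightarrow> 'k::field_char_0) set \<Rightarrow> ('m \<Rightarrow> 'k) set"
  where "degreewise_span deg R =
    {f. \<forall>d. (\<lambda>x. if deg x = d then f x else 0) \<in> module.span (\<lambda>c g x. c * g x) R}"

definition eq_mod :: "('m \<Rightarrow> 'k::field_char_0) set \<Rightarrow> ('m \<Rightarrow> 'k) set \<Rightarrow> (('m \<Rightarrow> 'k) \<times> ('m \<Rightarrow> 'k)) set"
  where "eq_mod F K = {(f, g). f \<in> F \<and> g \<in> F \<and> f - g \<in> K}"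

text \<open>Operators induced on quotients, \<open>r\<close> being the equivalence relation of the target.\<close>

definition descend :: "('n \<times> 'n) set \<Rightarrow> ('m \<Rightarrow> 'n) \<Rightarrow> 'm set \<Rightarrow> 'n set"
  where "descend r T X = (\<Union>f\<in>X. r `` {T f})"

definition descend2 :: "('n \<times> 'n) set \<Rightarrow> ('m \<Rightarrow> 'm \<Rightarrow> 'n) \<Rightarrow> 'm set \<Rightarrow> 'm set \<Rightarrow> 'n set"
  where "descend2 r T X Y = (\<Union>f\<in>X. \<Union>g\<in>Y. r `` {T f g})"

section \<open>Superspaces with a form, in a homogeneous basis\<close>

text \<open>\<open>sbasis\<close> is the (finite) set of labels of a homogeneous basis \<open>e\<close>, \<open>spar\<close> the parity of
  its elements and \<open>sform\<close> the Gram matrix. The letter \<open>b\<close> also denotes the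
  element \<open>x\<^sub>b\<close> of the dual basis, which has the same parity, so that the completed tensor
  algebra of the dual consists of series on words in the letters \<open>sbasis\<close>.\<close>

record ('b, 'k) superspace =
  sbasis :: "'b set"
  spar :: "'b \<Rightarrow> bool"
  sform :: "'b \<Rightarrow> 'b \<Rightarrow> 'k"

text \<open>The inverse form on the dual: its matrix \<open>h\<close> in the dual basis is determined by
  \<open>h \<circ> (D\<^sub>l \<otimes> D\<^sub>r) = sform\<close>. The sign comes from moving the odd map \<open>D\<^sub>r\<close> past \<open>e\<^sub>a\<close>.\<close>

definition inv_form :: "('b, 'k::field_char_0) superspace \<Rightarrow> 'b \<Rightarrow> 'b \<Rightarrow> 'k"
  where "inv_form V = (THE h.
    (\<forall>a\<in>sbasis V. \<forall>b\<in>sbasis V.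
       sg (spar V a) * (\<Sum>c\<in>sbasis V. \<Sum>d\<in>sbasis V. sform V a c * h c d * sform V d b) = sform V a b) \<and>
    (\<forall>c d. c \<notin> sbasis V \<or> d \<notin> sbasis V \<longrightarrow> h c d = 0))"

section \<open>The commutative side\<close>

text \<open>The monomial \<open>(e, w)\<close> stands for \<open>\<hbar>\<^sup>e w\<close>.\<close>

definition com_series :: "('b, 'k::field_char_0) superspace \<Rightarrow> (nat \<times> 'b list \<Rightarrow> 'k) set"
  where "com_series V = {f. \<forall>e w. f (e, w) \<noteq> 0 \<longrightarrow> w \<in> lists (sbasis V)}"

definition com_relations :: "('b, 'k::field_char_0) superspace \<Rightarrow> (nat \<times> 'b list \<Rightarrow> 'k) set"
  where "com_relations V =
    {single (e, w) - (\<lambda>x. koszul (spar V) w js * single (e, map ((!) w) js) x) | e w js.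
       w \<in> lists (sbasis V) \<and> js \<in> permutations_of_set {..<length w}}"

definition com_eq :: "('b, 'k::field_char_0) superspace \<Rightarrow>
    ((nat \<times> 'b list \<Rightarrow> 'k) \<times> (nat \<times> 'b list \<Rightarrow> 'k)) set"
  where "com_eq V = eq_mod (com_series V)
    (degreewise_span (\<lambda>(e, w). (e, length w)) (com_relations V))"

definition P_hbar :: "('b, 'k::field_char_0) superspace \<Rightarrow> (nat \<times> 'b list \<Rightarrow> 'k) set set"
  where "P_hbar V = com_series V // com_eq V"

definition word_bracket :: "('b, 'k::field_char_0) superspace \<Rightarrow> 'b list \<Rightarrow> 'b list \<Rightarrow> 'b list \<Rightarrow> 'k"
  where "word_bracket V a b u =
    (\<Sum>i<length a. \<Sum>j<length b.
       koszul (spar V) (a @ b) (to_front2 (length a + length b) i (length a + j))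
       * inv_form V (a ! i) (b ! j) * of_bool (u = del i a @ del j b))"

text \<open>The recursion is \<open>\<Delta>(a w) = (\<Delta> a) w + (-1)\<^sup>a a \<Delta>(w) + {a, w}\<close> for a letter \<open>a\<close>,
  for which \<open>\<Delta> a = 0\<close>.\<close>

primrec word_Delta :: "('b, 'k::field_char_0) superspace \<Rightarrow> 'b list \<Rightarrow> 'b list \<Rightarrow> 'k" where
  "word_Delta V [] = (\<lambda>u. 0)"
| "word_Delta V (a # w) = (\<lambda>u.
     sg (spar V a) * (case u of [] \<Rightarrow> 0 | b # u' \<Rightarrow> of_bool (b = a) * word_Delta V w u')
     + word_bracket V [a] w u)"

fun com_bracket_mon :: "('b, 'k::field_char_0) superspace \<Rightarrow>
    nat \<times> 'b list \<Rightarrow> nat \<times> 'b list \<Rightarrow> nat \<times> 'b list \<Rightarrow> 'k" where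
  "com_bracket_mon V (e, w) (e', v) (d, u) = of_bool (d = e + e') * word_bracket V w v u"

fun hbar_Delta_mon :: "('b, 'k::field_char_0) superspace \<Rightarrow>
    nat \<times> 'b list \<Rightarrow> nat \<times> 'b list \<Rightarrow> 'k" where
  "hbar_Delta_mon V (e, w) (d, u) = of_bool (d = Suc e) * word_Delta V w u"

definition com_bracket :: "('b, 'k::field_char_0) superspace \<Rightarrow>
    (nat \<times> 'b list \<Rightarrow> 'k) set \<Rightarrow> (nat \<times> 'b list \<Rightarrow> 'k) set \<Rightarrow> (nat \<times> 'b list \<Rightarrow> 'k) set"
  where "com_bracket V = descend2 (com_eq V) (bilin_ext (com_bracket_mon V))"

definition hbar_Delta :: "('b, 'k::field_char_0) superspace \<Rightarrow>
    (nat \<times> 'b list \<Rightarrow> 'k) set \<Rightarrow> (nat \<times> 'b list \<Rightarrow> 'k) set"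
  where "hbar_Delta V = descend (com_eq V) (lin_ext (hbar_Delta_mon V))"

section \<open>The noncommutative side\<close>

text \<open>The monomial \<open>(i, ws)\<close> stands for \<open>\<gamma>\<^sup>i\<close> times the symmetric product of the cyclic words in
  the nonempty list \<open>ws\<close>; the empty word is \<open>\<nu>\<close>. Coinvariants are taken under the
  rotations of each word and the permutations of the words.\<close>

definition nc_series :: "('b, 'k::field_char_0) superspace \<Rightarrow> (nat \<times> 'b list list \<Rightarrow> 'k) set"
  where "nc_series V = {f. \<forall>i ws. f (i, ws) \<noteq> 0 \<longrightarrow> ws \<noteq> [] \<and> ws \<in> lists (lists (sbasis V))}"

definition nc_relations :: "('b, 'k::field_char_0) superspace \<Rightarrow> (nat \<times> 'b list list \<Rightarrow> 'k) set"
  where "nc_relations V =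
    {single (i, ws)
       - (\<lambda>x. koszul (spar V) (ws ! r) (rotate1 [0..<length (ws ! r)])
            * single (i, ws[r := rotate1 (ws ! r)]) x) | i ws r.
       ws \<in> lists (lists (sbasis V)) \<and> r < length ws} \<union>
    {single (i, ws)
       - (\<lambda>x. koszul (word_parity (spar V)) ws js * single (i, map ((!) ws) js) x) | i ws js.
       ws \<in> lists (lists (sbasis V)) \<and> ws \<noteq> [] \<and> js \<in> permutations_of_set {..<length ws}}"

definition nc_eq :: "('b, 'k::field_char_0) superspace \<Rightarrow>
    ((nat \<times> 'b list list \<Rightarrow> 'k) \<times> (nat \<times> 'b list list \<Rightarrow> 'k)) set"
  where "nc_eq V = eq_mod (nc_series V)
    (degreewise_span (\<lambda>(i, ws). (i, length ws, length (concat ws))) (nc_relations V))"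

definition P_nc :: "('b, 'k::field_char_0) superspace \<Rightarrow> (nat \<times> 'b list list \<Rightarrow> 'k) set set"
  where "P_nc V = nc_series V // nc_eq V"

text \<open>Signs: in each term the letters are reordered, from the order on the left-hand side to the one on
  the right-hand side, the two contracted letters coming first.\<close>

definition cyc_bracket :: "('b, 'k::field_char_0) superspace \<Rightarrow> 'b list \<Rightarrow> 'b list \<Rightarrow> 'b list \<Rightarrow> 'k"
  where "cyc_bracket V a b u =
    (\<Sum>i<length a. \<Sum>j<length b.
       let m = length a; n = length b;
           js = [Suc i..<m] @ [0..<i] @ [Suc (m + j)..<m + n] @ [m..<m + j]
       in koszul (spar V) (a @ b) ([i, m + j] @ js)
          * inv_form V (a ! i) (b ! j) * of_bool (u = map ((!) (a @ b)) js))"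

definition cyc_cobracket :: "('b, 'k::field_char_0) superspace \<Rightarrow> 'b list \<Rightarrow> 'b list \<Rightarrow> 'b list \<Rightarrow> 'k"
  where "cyc_cobracket V a u v =
    (\<Sum>i<length a. \<Sum>j\<in>{i<..<length a}.
       let js = [Suc i..<j]; ks = [Suc j..<length a] @ [0..<i]
       in koszul (spar V) a ([i, j] @ js @ ks)
          * inv_form V (a ! i) (a ! j) * of_bool (u = map ((!) a) js \<and> v = map ((!) a) ks))"

fun nc_bracket_mon :: "('b, 'k::field_char_0) superspace \<Rightarrow>
    nat \<times> 'b list list \<Rightarrow> nat \<times> 'b list list \<Rightarrow> nat \<times> 'b list list \<Rightarrow> 'k" where
  "nc_bracket_mon V (i, ws) (j, vs) (k, us) = of_bool (k = i + j) *
    (\<Sum>r<length ws. \<Sum>s<length vs.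
       koszul (word_parity (spar V)) (ws @ vs)
         (to_front2 (length ws + length vs) r (length ws + s))
       * (case us of [] \<Rightarrow> 0 | u # us' \<Rightarrow>
            cyc_bracket V (ws ! r) (vs ! s) u * of_bool (us' = del r ws @ del s vs)))"

fun nabla_mon :: "('b, 'k::field_char_0) superspace \<Rightarrow>
    nat \<times> 'b list list \<Rightarrow> nat \<times> 'b list list \<Rightarrow> 'k" where
  "nabla_mon V (i, ws) (k, us) = of_bool (k = i) *
    (\<Sum>r<length ws. sg (word_parity (spar V) (concat (take r ws)))
       * cyc_cobracket V (ws ! r) (us ! r) (us ! Suc r)
       * of_bool (us = take r ws @ [us ! r, us ! Suc r] @ drop (Suc r) ws))"

fun gamma_delta_mon :: "('b, 'k::field_char_0) superspace \<Rightarrow>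
    nat \<times> 'b list list \<Rightarrow> nat \<times> 'b list list \<Rightarrow> 'k" where
  "gamma_delta_mon V (i, ws) (k, us) = of_bool (k = Suc i) *
    (\<Sum>r<length ws. \<Sum>s\<in>{r<..<length ws}.
       koszul (word_parity (spar V)) ws (to_front2 (length ws) r s)
       * (case us of [] \<Rightarrow> 0 | u # us' \<Rightarrow>
            cyc_bracket V (ws ! r) (ws ! s) u * of_bool (us' = del r (del s ws))))"

definition nc_bracket :: "('b, 'k::field_char_0) superspace \<Rightarrow>
    (nat \<times> 'b list list \<Rightarrow> 'k) set \<Rightarrow> (nat \<times> 'b list list \<Rightarrow> 'k) set \<Rightarrow>
    (nat \<times> 'b list list \<Rightarrow> 'k) set"
  where "nc_bracket V = descend2 (nc_eq V) (bilin_ext (nc_bracket_mon V))"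

definition nabla_gamma_delta :: "('b, 'k::field_char_0) superspace \<Rightarrow>
    (nat \<times> 'b list list \<Rightarrow> 'k) set \<Rightarrow> (nat \<times> 'b list list \<Rightarrow> 'k) set"
  where "nabla_gamma_delta V = descend (nc_eq V)
    (\<lambda>f. lin_ext (nabla_mon V) f + lin_ext (gamma_delta_mon V) f)"

section \<open>Matrices and the maps\<close>

text \<open>The label \<open>(b, i, j)\<close> stands for the basis element \<open>e\<^sub>b \<otimes> E\<^sub>i\<^sub>j\<close>.\<close>

definition matrix_unit :: "'n \<times> 'n \<Rightarrow> 'k::field_char_0 ^ 'n ^ 'n"
  where "matrix_unit = (\<lambda>(i, j). \<chi> r s. of_bool (r = i \<and> s = j))"

definition matrix_product :: "('n::finite \<times> 'n) list \<Rightarrow> 'k::field_char_0 ^ 'n ^ 'n"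
  where "matrix_product ijs = foldr (\<lambda>ij X. matrix_unit ij ** X) ijs (mat 1)"

definition matrix_space :: "('b, 'k::field_char_0, 'z) superspace_scheme \<Rightarrow>
    ('b \<times> 'n::finite \<times> 'n, 'k) superspace"
  where "matrix_space V =
    \<lparr>sbasis = sbasis V \<times> UNIV, spar = (\<lambda>x. spar V (fst x)),
     sform = (\<lambda>x y. sform V (fst x) (fst y)
       * trace (matrix_unit (snd x) ** matrix_unit (snd y) :: 'k ^ 'n ^ 'n))\<rparr>"

text \<open>For the empty word this says \<open>\<nu> \<mapsto> N \<nu>\<close>, the trace of the unit matrix being \<open>N\<close>.\<close>

definition morita_word :: "'b list \<Rightarrow> ('b \<times> 'n::finite \<times> 'n) list \<Rightarrow> 'k::field_char_0"
  where "morita_word w u = of_bool (map fst u = w)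
    * trace (matrix_product (map snd u) :: 'k ^ 'n ^ 'n)"

fun morita_mon :: "nat \<times> 'b list list \<Rightarrow>
    nat \<times> ('b \<times> 'n::finite \<times> 'n) list list \<Rightarrow> 'k::field_char_0" where
  "morita_mon (i, ws) (k, us) = of_bool (k = i \<and> length us = length ws)
    * (\<Prod>r<length ws. morita_word (ws ! r) (us ! r))"

definition morita :: "('b, 'k::field_char_0) superspace \<Rightarrow> (nat \<times> 'b list list \<Rightarrow> 'k) set \<Rightarrow>
    (nat \<times> ('b \<times> 'n::finite \<times> 'n) list list \<Rightarrow> 'k) set"
  where "morita V = descend (nc_eq (matrix_space V)) (lin_ext morita_mon)"

text \<open>The list \<open>ws\<close> contains the \<open>j\<close> factors \<open>\<nu>\<close> as well as the \<open>n\<close> nonempty words, so that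
  \<open>length ws = j + n\<close>.\<close>

fun sigma_K_mon :: "nat \<times> 'b list list \<Rightarrow> nat \<times> 'b list \<Rightarrow> 'k::field_char_0" where
  "sigma_K_mon (i, ws) = single (2 * i + length ws - 1, concat ws)"

definition sigma_K :: "('b, 'k::field_char_0) superspace \<Rightarrow>
    (nat \<times> 'b list list \<Rightarrow> 'k) set \<Rightarrow> (nat \<times> 'b list \<Rightarrow> 'k) set"
  where "sigma_K V = descend (com_eq V) (lin_ext sigma_K_mon)"

text \<open>The action of \<open>X\<close> on the dual is \<open>(X f)(a \<otimes> Y) = - f (a \<otimes> (X Y - Y X))\<close>; the following is
  the coefficient of the letter \<open>y\<close> in the image of the letter \<open>x\<close>.\<close>

definition gl_dual :: "'k::field_char_0 ^ 'n ^ 'n \<Rightarrow> 'b \<times> 'n::finite \<times> 'n \<Rightarrow> 'b \<times> 'n \<times> 'n \<Rightarrow> 'k"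
  where "gl_dual X x y = - of_bool (fst x = fst y)
    * ((X ** matrix_unit (snd y) - matrix_unit (snd y) ** X) $ fst (snd x) $ snd (snd x))"

fun gl_action_mon :: "'k::field_char_0 ^ 'n ^ 'n \<Rightarrow>
    nat \<times> ('b \<times> 'n::finite \<times> 'n) list \<Rightarrow> nat \<times> ('b \<times> 'n \<times> 'n) list \<Rightarrow> 'k" where
  "gl_action_mon X (e, w) (d, u) = of_bool (d = e) *
    (\<Sum>r<length w. gl_dual X (w ! r) (u ! r) * of_bool (u = w[r := u ! r]))"

definition P_hbar_inv :: "('b \<times> 'n::finite \<times> 'n, 'k::field_char_0) superspace \<Rightarrow>
    (nat \<times> ('b \<times> 'n \<times> 'n) list \<Rightarrow> 'k) set set"
  where "P_hbar_inv W = {Z \<in> P_hbar W.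
    \<forall>X :: 'k ^ 'n ^ 'n. descend (com_eq W) (lin_ext (gl_action_mon X)) Z = com_eq W `` {0}}"

section \<open>Cyclic A-infinity algebras\<close>

text \<open>\<open>sstruct A b w\<close> is the coefficient of \<open>e\<^sub>b\<close> in the structure map applied to the
  basis elements in \<open>w\<close>. All data (parity, form, structure maps) are those of the algebra \<open>A\<close>
  itself, not of \<open>\<Sigma>A\<close>.\<close>

record ('b, 'k) superalgebra = "('b, 'k) superspace" +
  sstruct :: "'b \<Rightarrow> 'b list \<Rightarrow> 'k"

definition coordinates :: "('k::field_char_0 \<Rightarrow> 'v::ab_group_add \<Rightarrow> 'v) \<Rightarrow> 'v set \<Rightarrow> 'v set \<Rightarrow>
    ('v list \<Rightarrow> 'v) \<Rightarrow> ('v \<Rightarrow> 'v \<Rightarrow> 'k) \<Rightarrow> ('v, 'k) superalgebra"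
  where "coordinates smul A1 B m form =
    \<lparr>sbasis = B, spar = (\<lambda>b. b \<in> A1), sform = form,
     sstruct = (\<lambda>b w. module.representation smul B (m w) b)\<rparr>"

text \<open>The form on \<open>\<Sigma>A\<close> satisfies \<open>\<langle>-,-\<rangle> \<circ> (\<Sigma> \<otimes> \<Sigma>) = \<langle>-,-\<rangle>\<close>, where
  \<open>(\<Sigma> \<otimes> \<Sigma>)(a \<otimes> b) = (-1)\<^sup>a \<Sigma>a \<otimes> \<Sigma>b\<close>.\<close>

definition suspension :: "('b, 'k::field_char_0, 'z) superspace_scheme \<Rightarrow> ('b, 'k) superspace"
  where "suspension A =
    \<lparr>sbasis = sbasis A, spar = (\<lambda>b. \<not> spar A b),
     sform = (\<lambda>a b. sg (spar A a) * sform A a b)\<rparr>"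

text \<open>The sign in \<open>\<Sigma>\<^sup>\<otimes>\<^sup>n(a\<^sub>1 \<otimes> \<dots> \<otimes> a\<^sub>n) = \<plusminus> \<Sigma>a\<^sub>1 \<otimes> \<dots> \<otimes> \<Sigma>a\<^sub>n\<close>; \<open>p\<close> is the parity in \<open>A\<close>.\<close>

definition susp_sign :: "('b \<Rightarrow> bool) \<Rightarrow> 'b list \<Rightarrow> 'k::field_char_0"
  where "susp_sign p w = (\<Prod>i<length w. sg (p (w ! i)) ^ (length w - Suc i))"

text \<open>The structure maps \<open>\<Sigma> \<circ> m\<^sub>k \<circ> (\<Sigma>\<^sup>\<otimes>\<^sup>k)\<^sup>-\<^sup>1\<close> on \<open>\<Sigma>A\<close>. A multilinear form on \<open>\<Sigma>A\<close> is identified with the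
  series of its values on words in the basis, so this is also
  the coefficient of \<open>w\<close> in \<open>m(x\<^sub>b)\<close>, for the derivation \<open>m\<close> of the completed tensor algebra.\<close>

definition susp_struct :: "('b, 'k::field_char_0) superalgebra \<Rightarrow> 'b \<Rightarrow> 'b list \<Rightarrow> 'k"
  where "susp_struct A b w =
    of_bool (w \<noteq> [] \<and> w \<in> lists (sbasis A)) * susp_sign (spar A) w * sstruct A b w"

definition derivation_word :: "('b, 'k::field_char_0) superalgebra \<Rightarrow> 'b list \<Rightarrow> 'b list \<Rightarrow> 'k"
  where "derivation_word A w u =
    (\<Sum>r<length w. sg (word_parity (spar (suspension A)) (take r w))
       * (\<Sum>v | u = take r w @ v @ drop (Suc r) w. susp_struct A (w ! r) v))"

definition ainf_derivation :: "('b, 'k::field_char_0) superalgebra \<Rightarrow> ('b list \<Rightarrow> 'k) \<Rightarrow> 'b list \<Rightarrow> 'k"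
  where "ainf_derivation A = lin_ext (derivation_word A)"

text \<open>The set \<open>B\<close> is an arbitrary homogeneous basis; the conditions do not depend on it.\<close>

locale finite_super_space = vector_space smul
  for smul :: "'k::field_char_0 \<Rightarrow> 'v::ab_group_add \<Rightarrow> 'v" +
  fixes A0 A1 B :: "'v set"
  assumes subspaces: "subspace A0" "subspace A1"
    and direct_sum: "A0 \<inter> A1 = {0}" "\<And>x. \<exists>y\<in>A0. \<exists>z\<in>A1. x = y + z"
    and basis: "finite B" "independent B" "span B = UNIV"
    and homogeneous: "B \<subseteq> A0 \<union> A1"

text \<open>The structure map \<open>m\<^sub>k\<close> is \<open>m\<close> on lists of length \<open>k \<ge> 1\<close>; the value of \<open>m\<close> on the
  empty list plays no role. The parity of \<open>m\<^sub>k\<close> is that of \<open>k\<close>, so that the suspended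
  structure maps are odd.\<close>

locale cyclic_ainf_algebra = finite_super_space smul A0 A1 B
  for smul :: "'k::field_char_0 \<Rightarrow> 'v::ab_group_add \<Rightarrow> 'v" and A0 A1 B +
  fixes m :: "'v list \<Rightarrow> 'v" and form :: "'v \<Rightarrow> 'v \<Rightarrow> 'k"
  assumes multilinear: "\<And>us vs. Vector_Spaces.linear smul smul (\<lambda>x. m (us @ x # vs))"
    and parity: "\<And>w. w \<noteq> [] \<Longrightarrow> set w \<subseteq> A0 \<union> A1 \<Longrightarrow>
      m w \<in> (if word_parity (\<lambda>x. x \<in> A1) w = even (length w) then A1 else A0)"
    and square_zero: "\<And>f. (\<forall>w. f w \<noteq> 0 \<longrightarrow> w \<in> lists B) \<Longrightarrow>
      ainf_derivation (coordinates smul A1 B m form)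
        (ainf_derivation (coordinates smul A1 B m form) f) = 0"
    and bilinear: "\<And>x. Vector_Spaces.linear smul (*) (form x)"
      "\<And>y. Vector_Spaces.linear smul (*) (\<lambda>x. form x y)"
    and symmetric: "\<And>x y. x \<in> A0 \<union> A1 \<Longrightarrow> y \<in> A0 \<union> A1 \<Longrightarrow>
      form x y = sg (x \<in> A1 \<and> y \<in> A1) * form y x"
    and nondegenerate: "\<And>x. (\<And>y. form x y = 0) \<Longrightarrow> x = 0"
    and cyclic: "\<And>w x. w \<noteq> [] \<Longrightarrow> set w \<subseteq> A0 \<union> A1 \<Longrightarrow> x \<in> A0 \<union> A1 \<Longrightarrow>
      form (m w) x = (- 1) ^ length w * sg (x \<in> A1 \<and> word_parity (\<lambda>y. y \<in> A1) w)
        * form (m (x # butlast w)) (last w)"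

definition odd_form :: "'v set \<Rightarrow> 'v set \<Rightarrow> ('v \<Rightarrow> 'v \<Rightarrow> 'k::field_char_0) \<Rightarrow> bool"
  where "odd_form A0 A1 form \<longleftrightarrow>
    (\<forall>x\<in>A0. \<forall>y\<in>A0. form x y = 0) \<and> (\<forall>x\<in>A1. \<forall>y\<in>A1. form x y = 0)"

text \<open>The tensor on \<open>\<Sigma>A\<close> obtained from \<open>\<langle>c\<^sub>k(-),-\<rangle>\<close> by composing with the inverse of
  \<open>\<Sigma>\<^bsup>\<otimes>(k+1)\<^esup>\<close>, for all \<open>k \<ge> 1\<close>
  together; \<open>c\<close> are the coefficients of maps on \<open>A\<close>.\<close>

definition form_tensor :: "('b, 'k::field_char_0) superalgebra \<Rightarrow> ('b \<Rightarrow> 'b list \<Rightarrow> 'k) \<Rightarrow> 'b list \<Rightarrow> 'k"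
  where "form_tensor A c w = of_bool (2 \<le> length w \<and> w \<in> lists (sbasis A))
    * susp_sign (spar A) w * (\<Sum>b\<in>sbasis A. c b (butlast w) * sform A b (last w))"

definition m_tilde :: "('b, 'k::field_char_0) superalgebra \<Rightarrow> (nat \<times> 'b list list \<Rightarrow> 'k) set"
  where "m_tilde A = nc_eq (suspension A) ``
    {\<lambda>(i, ws). case ws of
       [w] \<Rightarrow> of_bool (i = 0) * form_tensor A (sstruct A) w / of_nat (length w)
     | _ \<Rightarrow> 0}"

definition matrix_algebra :: "('b, 'k::field_char_0) superalgebra \<Rightarrow>
    ('b \<times> 'n::finite \<times> 'n, 'k) superalgebra"
  where "matrix_algebra A = superspace.extend (matrix_space A) \<lparr>sstruct =
    (\<lambda>x w. sstruct A (fst x) (map fst w)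
       * ((matrix_product (map snd w) :: 'k ^ 'n ^ 'n) $ fst (snd x) $ snd (snd x)))\<rparr>"

text \<open>Structure maps of the commutator L-infinity algebra. The derivation \<open>l\<close> sends \<open>x\<^sub>b\<close> to the
  class of \<open>m(x\<^sub>b)\<close> in the completed symmetric algebra. A class of \<open>k\<close>-tensors gives a symmetric
  multilinear form by summing over all \<open>k!\<close> permutations. The factor \<open>susp_sign\<close> returns
  from \<open>\<Sigma>A\<close> to \<open>A\<close>.\<close>

definition commutator_struct :: "('b, 'k::field_char_0) superalgebra \<Rightarrow> 'b \<Rightarrow> 'b list \<Rightarrow> 'k"
  where "commutator_struct A b w = susp_sign (spar A) w *
    (\<Sum>js\<in>permutations_of_set {..<length w}.
       koszul (spar (suspension A)) w js * ainf_derivation A (single [b]) (map ((!) w) js))"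

definition l_tilde :: "('b, 'k::field_char_0) superalgebra \<Rightarrow> (nat \<times> 'b list \<Rightarrow> 'k) set"
  where "l_tilde A = com_eq (suspension A) ``
    {\<lambda>(e, w). of_bool (e = 0) * form_tensor A (commutator_struct A) w / fact (length w)}"

end

theory Submission
  imports Defs
begin

text \<open>The bracket, \<open>\<Delta>\<close>, the cyclic bracket and the cobracket all contract pairs of letters
  with the inverse form, up to Koszul signs. In characteristic zero, symmetrizing words detects
  equality in the completed symmetric algebra, and a symmetrized contraction depends only on the two
  letters that are contracted. This makes the commutative operators well defined on coinvariants and
  reduces the theorem to identities between contractions of monomials.

  A product of cyclic words goes to the sum, over all ways to label its letters by matrix units, of
  the labelled word weighted by a product of traces. Contracting two letters forces their labels to be
  \<open>E\<^sub>k\<^sub>l\<close> and \<open>E\<^sub>l\<^sub>k\<close>. Summed over \<open>k, l\<close>, letters of different words give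
  \<open>Tr(E\<^sub>k\<^sub>l X) Tr(E\<^sub>l\<^sub>k Y) \<mapsto> Tr(X Y)\<close>, which is the cyclic bracket, and letters of the same word give
  \<open>Tr(E\<^sub>k\<^sub>l X E\<^sub>l\<^sub>k Y) \<mapsto> Tr(X) Tr(Y)\<close>, which is the cobracket. The power of \<open>\<hbar>\<close> counts the words, so it
  records the merging and the splitting.

  The image of \<open>m\<close>-tilde is \<open>l\<close>-tilde because the sum over the \<open>k!\<close> permutations of the inputs
  becomes multiplication by \<open>k!\<close> after symmetrization. The commutator action kills every trace of a
  product, as it changes \<open>Tr(M)\<close> by \<open>Tr(M X) - Tr(X M)\<close>.\<close>

section \<open>Koszul signs\<close>

text \<open>All spaces are quotients, and an operator on classes is the union of the classes of its
  values on all representatives. Symmetrization embeds the commutative quotient into series. On the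
  noncommutative side no such normal form is used: any set of series on which the symmetrized
  composite \<open>psi\<close> is constant goes to a single class, and \<open>psi\<close> of a
  bracket or a differential depends on the arguments only through their own \<open>psi\<close>,
  because the commutative operators respect classes. The exponent of \<open>\<hbar>\<close> is twice
  the power of \<open>\<gamma>\<close> plus the number of words minus one. A splitting adds a word;
  a joining loses a word but gains a \<open>\<gamma>\<close>; both raise the exponent by one, as
  \<open>\<hbar>\<Delta>\<close> does. The bracket joins two of a + b words, and (a - 1) + (b - 1) =
  (a + b - 1) - 1. An arc that is empty after a splitting is a factor \<open>\<nu>\<close>, and its
  trace Tr(1) = N explains \<open>\<nu> \<mapsto> N \<nu>\<close>. The oddness of the form removes
  most signs: letters that pair have opposite parities, so they commute without a sign and move
  together as one odd element.\<close>

text \<open>Signs are computed on lists of distinct positions rather than on words, whose letters may repeat.\<close>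

lemma sg_simps [simp]: "sg False = 1" "sg True = - 1" "sg (\<not> b) = - sg b"
  by (auto simp: sg_def)

lemma sg_nz [simp]: "sg b \<noteq> (0::'k::field_char_0)"
  by (simp add: sg_def)

lemma sg_mult [simp]: "sg a * sg b = sg (a \<noteq> b)" "sg a * (sg b * x) = sg (a \<noteq> b) * x"
  by (auto simp: sg_def)

lemma word_parity_simps [simp]:
  "word_parity q [] = False"
  "word_parity q (a # w) = (q a \<noteq> word_parity q w)"
  "word_parity q (v @ w) = (word_parity q v \<noteq> word_parity q w)"
  by (auto simp: word_parity_def)

lemma word_parity_map: "word_parity q (map f w) = word_parity (\<lambda>k. q (f k)) w"
  by (induction w) auto

text \<open>The Koszul sign of sorting \<open>L\<close>: a factor -1 for every decreasing pair of
  odd positions. The parities are a function of positions, so the sign also makes sense for lists of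
  positions that are only part of a word.\<close>

primrec order_sign :: "(nat \<Rightarrow> bool) \<Rightarrow> nat list \<Rightarrow> 'k::field_char_0" where
  "order_sign q [] = 1"
| "order_sign q (a # L) = (\<Prod>b\<in>set L. if b < a then sg (q a \<and> q b) else 1) * order_sign q L"

text \<open>Graded commutativity for a functional of lists of positions: exchanging neighbours costs
  their Koszul sign. Sorting signs and symmetrizations both obey it, so the same reordering lemmas
  serve both. \<open>X\<close> limits the rule to the positions that occur in the word at
  hand.\<close>

definition skew :: "nat set \<Rightarrow> (nat \<Rightarrow> bool) \<Rightarrow> (nat list \<Rightarrow> 'k::field_char_0) \<Rightarrow> bool"
  where "skew X q G \<longleftrightarrow> (\<forall>P a b Q. distinct (P @ a # b # Q) \<longrightarrow> set (P @ a # b # Q) \<subseteq> X \<longrightarrow>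
    G (P @ a # b # Q) = sg (q a \<and> q b) * G (P @ b # a # Q))"

lemma skewD:
  assumes "skew X q G" "distinct (P @ a # b # Q)" "set (P @ a # b # Q) \<subseteq> X"
  shows "G (P @ a # b # Q) = sg (q a \<and> q b) * G (P @ b # a # Q)"
  using assms unfolding skew_def by blast

lemma skew_mono: "skew X q G \<Longrightarrow> Y \<subseteq> X \<Longrightarrow> skew Y q G"
  unfolding skew_def by blast

lemma skew_bring:
  assumes "skew X q G"
  shows "distinct (P @ M @ a # Q) \<Longrightarrow> set (P @ M @ a # Q) \<subseteq> X \<Longrightarrow>
    G (P @ M @ a # Q) = sg (q a \<and> word_parity q M) * G (P @ a # M @ Q)"
proof (induction M arbitrary: P)
  case Nil
  then show ?case by (simp add: word_parity_def)
next
  case (Cons b M)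
  have 1: "G (P @ (b # M) @ a # Q) = sg (q a \<and> word_parity q M) * G (P @ b # a # M @ Q)"
    using Cons.IH[of "P @ [b]"] Cons.prems by simp
  have 2: "G (P @ b # a # M @ Q) = sg (q b \<and> q a) * G (P @ a # b # M @ Q)"
    by (rule skewD[OF assms]) (use Cons.prems in auto)
  show ?case unfolding 1 2 by (cases "q a"; cases "q b") simp_all
qed

text \<open>The exchange rule for whole words in a product: the letters of \<open>B\<close> pass the
  block \<open>A\<close> one after the other, and only the total parities remain.\<close>

lemma skew_block:
  assumes "skew X q G"
  shows "distinct (P @ A @ B @ Q) \<Longrightarrow> set (P @ A @ B @ Q) \<subseteq> X \<Longrightarrow>
    G (P @ A @ B @ Q) = sg (word_parity q A \<and> word_parity q B) * G (P @ B @ A @ Q)"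
proof (induction B arbitrary: P)
  case Nil
  then show ?case by (simp add: word_parity_def)
next
  case (Cons b B)
  have 1: "G (P @ A @ b # B @ Q) = sg (q b \<and> word_parity q A) * G (P @ b # A @ B @ Q)"
    by (rule skew_bring[OF assms]) (use Cons.prems in auto)
  have 2: "G (P @ b # A @ B @ Q) = sg (word_parity q A \<and> word_parity q B) * G (P @ b # B @ A @ Q)"
    using Cons.IH[of "P @ [b]"] Cons.prems by auto
  show ?case unfolding append_Cons append_assoc 1 2
    by (cases "q b"; cases "word_parity q A") simp_all
qed

text \<open>Only the pair \<open>a\<close>, \<open>b\<close> changes its relative order, so exactly
  one factor of the product over decreasing pairs appears or disappears.\<close>

lemma order_sign_swap:
  assumes "a \<noteq> b"
  shows "distinct (P @ a # b # Q) \<Longrightarrow>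
    order_sign q (P @ a # b # Q) = sg (q a \<and> q b) * (order_sign q (P @ b # a # Q) :: 'k::field_char_0)"
proof (induction P)
  case Nil
  then have "b \<notin> set Q" "a \<notin> set Q" by auto
  then show ?case using assms by (simp add: sg_def)
next
  case (Cons c P)
  have "set (P @ a # b # Q) = set (P @ b # a # Q)" by auto
  with Cons show ?case by simp
qed

lemma skew_order_sign: "skew UNIV q (order_sign q)"
  unfolding skew_def using order_sign_swap by fastforce

lemma order_sign_square [simp]:
  "order_sign q L * order_sign q L = (1::'k::field_char_0)"
  "order_sign q L * (order_sign q L * x) = (x::'k::field_char_0)"
proof -
  show *: "order_sign q L * order_sign q L = (1::'k)"
  proof (induction L)
    case (Cons a L)
    have "(\<Prod>b\<in>set L. if b < a then sg (q a \<and> q b) else 1)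
        * (\<Prod>b\<in>set L. if b < a then sg (q a \<and> q b) else 1) = (1::'k)"
      unfolding prod.distrib[symmetric] by (rule prod.neutral) auto
    then show ?case
      using Cons by (simp add: power2_eq_square[symmetric] power_mult_distrib)
  qed simp
  show "order_sign q L * (order_sign q L * x) = x"
    using * by (metis mult.assoc mult_1)
qed

text \<open>Compares an arbitrary reordering with the sorting sign, so that no permutation has to be
  decomposed explicitly.\<close>

lemma skew_perm:
  fixes G :: "nat list \<Rightarrow> 'k::field_char_0"
  assumes G: "skew X q G"
  shows "distinct (P @ L) \<Longrightarrow> set (P @ L) \<subseteq> X \<Longrightarrow> distinct L' \<Longrightarrow> set L' = set L \<Longrightarrow>
    order_sign q (P @ L) * G (P @ L) = order_sign q (P @ L') * G (P @ L')"
proof (induction L arbitrary: P L')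
  case Nil
  then show ?case by simp
next
  case (Cons a M)
  from Cons.prems obtain L1 L2 where L': "L' = L1 @ a # L2"
    by (metis list.set_intros(1) split_list)
  have d: "distinct (P @ L1 @ a # L2)" and s: "set (P @ L1 @ a # L2) \<subseteq> X"
    using Cons.prems L' by auto
  have "set (L1 @ L2) = set M"
    using Cons.prems L' by auto
  then have "order_sign q ((P @ [a]) @ M) * G ((P @ [a]) @ M)
      = order_sign q ((P @ [a]) @ L1 @ L2) * G ((P @ [a]) @ L1 @ L2)"
    using Cons.prems L' by (intro Cons.IH) auto
  \<comment> \<open>Bringing \<open>a\<close> to the front of \<open>L'\<close> costs
    \<open>G\<close> and the sorting sign the same factor, which squares to 1.\<close>
  moreover have "G (P @ L1 @ a # L2) = sg (q a \<and> word_parity q L1) * G (P @ a # L1 @ L2)"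
    by (rule skew_bring[OF G d s])
  moreover have "order_sign q (P @ L1 @ a # L2)
      = sg (q a \<and> word_parity q L1) * (order_sign q (P @ a # L1 @ L2) :: 'k)"
    by (rule skew_bring[OF skew_order_sign d]) simp
  ultimately show ?case by (cases "q a \<and> word_parity q L1") (simp_all add: L')
qed

lemma order_sign_sorted: "sorted_wrt (<) L \<Longrightarrow> order_sign q L = 1"
proof (induction L)
  case (Cons a L)
  then have "(\<Prod>b\<in>set L. if b < a then sg (q a \<and> q b) else 1) = (1::'a)"
    by (intro prod.neutral) (auto dest: order.strict_trans)
  with Cons show ?case by simp
qed simp

lemma order_sign_upt [simp]: "order_sign q [m..<n] = 1"
  by (rule order_sign_sorted) simp

lemma order_sign_cong: "(\<And>k. k \<in> set L \<Longrightarrow> q k = q' k) \<Longrightarrow> order_sign q L = order_sign q' L"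
  by (induction L) (auto intro!: prod.cong)

lemma order_sign_map:
  assumes "strict_mono_on (set L) f"
  shows "order_sign q (map f L) = order_sign (\<lambda>k. q (f k)) L"
  using assms
proof (induction L)
  case (Cons a L)
  have inj: "inj_on f (set (a # L))" using Cons.prems strict_mono_on_imp_inj_on by blast
  have "(\<Prod>b\<in>f ` set L. if b < f a then sg (q (f a) \<and> q b) else 1)
    = (\<Prod>b\<in>set L. if b < a then sg (q (f a) \<and> q (f b)) else (1::'a))"
    using inj by (subst prod.reindex)
      (auto intro!: prod.cong inj_on_subset[OF inj] simp: strict_mono_on_less[OF Cons.prems])
  moreover have "strict_mono_on (set L) f" using Cons.prems by (auto simp: strict_mono_on_def)
  ultimately show ?case using Cons.IH by simp
qed simp

text \<open>Both signs are products over decreasing pairs. \<open>koszul\<close> indexes the pairs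
  by their places in \<open>js\<close>; these are separated according to whether the earlier place
  is the head.\<close>

lemma koszul_order_sign:
  "distinct js \<Longrightarrow> koszul p w js = order_sign (\<lambda>k. p (w ! k)) js"
proof (induction js)
  case Nil
  then show ?case by (simp add: koszul_def)
next
  case (Cons a L)
  let ?I = "\<lambda>js. {(r, s). r < s \<and> s < length js \<and> js ! s < js ! r}"
  let ?h = "\<lambda>js (r, s). sg (p (w ! (js ! r)) \<and> p (w ! (js ! s))) :: 'a"
  have fin: "finite (?I js)" for js :: "nat list"
    by (rule finite_subset[of _ "{..<length js} \<times> {..<length js}"]) auto
  have eq: "?I (a # L) = (\<lambda>s. (0, Suc s)) ` {s. s < length L \<and> L ! s < a}
      \<union> (\<lambda>(r, s). (Suc r, Suc s)) ` ?I L" (is "_ = ?A \<union> ?B")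
  proof (intro equalityI subsetI)
    fix z assume "z \<in> ?I (a # L)"
    then obtain r s where z: "z = (r, s)" "r < s" "s < Suc (length L)" "(a # L) ! s < (a # L) ! r"
      by auto
    then obtain s' where "s = Suc s'" by (cases s) auto
    with z show "z \<in> ?A \<union> ?B"
      by (cases r) (auto simp: image_iff)
  qed auto
  have "koszul p w (a # L) = prod (?h (a # L)) ?A * prod (?h (a # L)) ?B"
    unfolding koszul_def eq using fin[of L]
    by (intro prod.union_disjoint) auto
  also have "prod (?h (a # L)) ?B = koszul p w L"
    unfolding koszul_def by (subst prod.reindex) (auto simp: inj_on_def intro!: prod.cong)
  also have "prod (?h (a # L)) ?A = (\<Prod>s\<in>{s. s < length L \<and> L ! s < a}. sg (p (w ! a) \<and> p (w ! (L ! s))))"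
    by (subst prod.reindex) (auto simp: inj_on_def intro!: prod.cong)
  also have "\<dots> = (\<Prod>s<length L. if L ! s < a then sg (p (w ! a) \<and> p (w ! (L ! s))) else 1)"
    by (rule prod.mono_neutral_cong_left) auto
  also have "\<dots> = (\<Prod>b\<in>set L. if b < a then sg (p (w ! a) \<and> p (w ! b)) else 1)"
    using Cons.prems
    by (intro prod.reindex_bij_betw[where h = "(!) L" and g = "\<lambda>b. if b < a then sg (p (w ! a) \<and> p (w ! b)) else 1"]
         bij_betw_nth) auto
  finally show ?case using Cons by simp
qed

text \<open>The identity list has sorting sign 1, so comparing it with \<open>js\<close> leaves
  exactly the sign that the definitions use. In this way \<open>koszul\<close> factors are absorbed
  into a functional.\<close>

lemma skew_koszul:
  assumes "skew {..<length w} (\<lambda>k. p (w ! k)) G" "distinct js" "set js = {..<length w}"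
  shows "G [0..<length w] = koszul p w js * G js"
  using skew_perm[OF assms(1), of "[]" "[0..<length w]" js] assms
  by (simp add: koszul_order_sign lessThan_atLeast0)

section \<open>Signed symmetrization of words\<close>

definition symmetrize :: "('a \<Rightarrow> bool) \<Rightarrow> 'a list \<Rightarrow> 'a list \<Rightarrow> 'k::field_char_0"
  where "symmetrize p w u =
    (\<Sum>js\<in>permutations_of_set {..<length w}. koszul p w js * of_bool (u = map ((!) w) js))"

text \<open>Here the values in the list are renamed, whereas \<open>order_sign_swap\<close>
  exchanges neighbouring entries. The renaming alters the relative order of \<open>i\<close> and
  \<open>Suc i\<close> and of no other pair.\<close>

lemma order_sign_transpose:
  fixes i :: nat
  defines "\<tau> \<equiv> Transposition.transpose i (Suc i)"
  shows "distinct L \<Longrightarrow> order_sign q L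
    = (if i \<in> set L \<and> Suc i \<in> set L then sg (q i \<and> q (Suc i)) else 1)
      * order_sign (\<lambda>k. q (\<tau> k)) (map \<tau> L)"
proof (induction L)
  case (Cons a L)
  have inj: "inj_on \<tau> A" for A by (simp add: \<tau>_def)
  have tt: "\<tau> (\<tau> k) = k" for k by (simp add: \<tau>_def)
  \<comment> \<open>The factor of a pair is that of the renamed pair, corrected when the pair
    consists of \<open>i\<close> and \<open>Suc i\<close>; the two corrections belong to the two
    orders in which these may stand.\<close>
  have "(\<Prod>b\<in>set L. if b < a then sg (q a \<and> q b) else 1)
    = (\<Prod>b\<in>set L. (if b = i \<and> a = Suc i then sg (q i \<and> q (Suc i)) else 1) *
         ((if b = Suc i \<and> a = i then sg (q i \<and> q (Suc i)) else 1) *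
        (if \<tau> b < \<tau> a then sg (q a \<and> q b) else (1::'a))))"
    using Cons.prems
    by (intro prod.cong) (auto simp: \<tau>_def Transposition.transpose_def sg_def)
  also have "\<dots> = (if i \<in> set L \<and> a = Suc i then sg (q i \<and> q (Suc i)) else 1)
     * ((if Suc i \<in> set L \<and> a = i then sg (q i \<and> q (Suc i)) else 1)
     * (\<Prod>b\<in>set L. if \<tau> b < \<tau> a then sg (q a \<and> q b) else 1))"
  proof -
    have "(\<Prod>b\<in>set L. if b = c \<and> P then x else 1) = (if c \<in> set L \<and> P then x else (1::'a))" for c P x
      by (cases P) (auto simp: prod.delta)
    then show ?thesis by (simp add: prod.distrib)
  qed
  also have "(\<Prod>b\<in>set L. if \<tau> b < \<tau> a then sg (q a \<and> q b) else (1::'a))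
    = (\<Prod>b\<in>\<tau> ` set L. if b < \<tau> a then sg (q (\<tau> (\<tau> a)) \<and> q (\<tau> b)) else 1)"
    by (subst prod.reindex[OF inj]) (simp only: o_def tt)
  finally show ?case using Cons by (auto simp: algebra_simps)
qed simp

text \<open>Exchanging two adjacent letters of the word is undone by exchanging the values
  \<open>i\<close> and \<open>Suc i\<close> in every permutation. This is a bijection of the
  permutations, and \<open>order_sign_transpose\<close> gives the sign.\<close>

lemma symmetrize_swap:
  "symmetrize p (P @ a # b # Q) u
    = sg (p a \<and> p b) * (symmetrize p (P @ b # a # Q) u :: 'k::field_char_0)"
proof -
  define i where "i = length P"
  define \<tau> where "\<tau> = Transposition.transpose i (Suc i)"
  define w w' where "w = P @ a # b # Q" and "w' = P @ b # a # Q"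
  let ?n = "length w"
  have len: "length w' = ?n" by (simp add: w_def w'_def)
  have nth: "w ! k = w' ! (\<tau> k)" for k
  proof (cases "k < i \<or> k = i \<or> k = Suc i")
    case True
    then show ?thesis
      by (auto simp: w_def w'_def \<tau>_def i_def nth_append)
  next
    case False
    then obtain d where "k = i + Suc (Suc d)"
      by (metis add_Suc_right less_imp_Suc_add linorder_neqE_nat not_less_eq)
    then show ?thesis
      by (simp add: w_def w'_def \<tau>_def i_def nth_append)
  qed
  have "\<tau> permutes {..<?n}" unfolding \<tau>_def by (rule permutes_swap_id) (auto simp: i_def w_def)
  then have bij: "bij_betw \<tau> {..<?n} {..<?n}" by (rule permutes_imp_bij)
  have tt: "\<tau> (\<tau> k) = k" for k by (simp add: \<tau>_def)
  have inv: "map \<tau> (map \<tau> js) = js" for js by (simp add: tt o_def)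
  have perm: "map \<tau> js \<in> permutations_of_set {..<?n}" if "js \<in> permutations_of_set {..<?n}" for js
  proof (rule permutations_of_setI)
    show "set (map \<tau> js) = {..<?n}"
      using permutations_of_setD(1)[OF that] bij by (simp add: bij_betw_def)
    show "distinct (map \<tau> js)"
      using permutations_of_setD(2)[OF that] by (simp add: distinct_map \<tau>_def)
  qed
  have "bij_betw (map \<tau>) (permutations_of_set {..<?n}) (permutations_of_set {..<?n})"
    by (rule bij_betw_byWitness[where f' = "map \<tau>"]) (use inv perm in blast)+
  then have "(symmetrize p w' u :: 'k) = (\<Sum>js\<in>permutations_of_set {..<?n}.
      koszul p w' (map \<tau> js) * of_bool (u = map ((!) w') (map \<tau> js)))"
    unfolding symmetrize_def len by (rule sum.reindex_bij_betw[symmetric])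
  also have "\<dots> = (\<Sum>js\<in>permutations_of_set {..<?n}.
      sg (p a \<and> p b) * (koszul p w js * of_bool (u = map ((!) w) js)))"
  proof (rule sum.cong[OF refl])
    fix js assume "js \<in> permutations_of_set {..<?n}"
    then have d: "distinct js" and s: "set js = {..<?n}"
      by (auto simp: permutations_of_set_def)
    have "order_sign (\<lambda>k. p (w ! k)) js
      = sg (p (w ! i) \<and> p (w ! Suc i)) * (order_sign (\<lambda>k. p (w ! \<tau> k)) (map \<tau> js) :: 'k)"
      using order_sign_transpose[OF d, of "\<lambda>k. p (w ! k)" i] s
      by (simp add: \<tau>_def) (simp add: i_def w_def)
    moreover have "w ! \<tau> k = w' ! k" for k by (simp add: nth tt)
    moreover have "distinct (map \<tau> js)" using d by (simp add: distinct_map \<tau>_def)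
    moreover have "w ! i = a" "w ! Suc i = b" by (auto simp: w_def i_def nth_append)
    moreover have "map ((!) w') (map \<tau> js) = map ((!) w) js" by (simp add: nth)
    ultimately show "(koszul p w' (map \<tau> js) * of_bool (u = map ((!) w') (map \<tau> js)) :: 'k)
      = sg (p a \<and> p b) * (koszul p w js * of_bool (u = map ((!) w) js))"
      by (simp add: koszul_order_sign d del: map_map)
  qed
  also have "\<dots> = sg (p a \<and> p b) * symmetrize p w u"
    unfolding symmetrize_def sum_distrib_left ..
  finally have "symmetrize p w u = sg (p a \<and> p b) * (symmetrize p w' u :: 'k)"
    by (cases "p a"; cases "p b") simp_all
  then show ?thesis unfolding w_def w'_def .
qed

text \<open>Through this instance the reordering lemmas for distinct positions apply to symmetrized
  words whose letters may repeat.\<close>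

lemma skew_symmetrize: "skew X (\<lambda>k. p (y k)) (\<lambda>L. symmetrize p (map y L) u)"
  unfolding skew_def map_append list.map by (intro allI impI symmetrize_swap)

section \<open>Column-finite matrices\<close>

text \<open>\<open>Sum_any\<close> returns 0 on an infinite support, so linearity and composition of
  \<open>lin_ext\<close> are secured by asking that each coefficient of the image depend on finitely
  many source monomials.\<close>

definition fin_cols :: "('m \<Rightarrow> 'n \<Rightarrow> 'k::field_char_0) \<Rightarrow> bool"
  where "fin_cols T \<longleftrightarrow> (\<forall>u. finite {w. T w u \<noteq> 0})"

lemma fin_colsD: "fin_cols T \<Longrightarrow> finite {w. T w u \<noteq> 0}"
  by (simp add: fin_cols_def)

lemma fin_colsI:
  assumes "\<And>u. finite (X u)" "\<And>w u. T w u \<noteq> 0 \<Longrightarrow> w \<in> X u"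
  shows "fin_cols T"
  unfolding fin_cols_def
proof
  fix u show "finite {w. T w u \<noteq> 0}"
    by (rule finite_subset[OF _ assms(1)[of u]]) (use assms(2) in auto)
qed

lemma lin_ext_eq:
  assumes "finite X" "\<And>w. w \<notin> X \<Longrightarrow> f w = 0 \<or> T w u = 0"
  shows "lin_ext T f u = (\<Sum>w\<in>X. f w * T w u)"
  unfolding lin_ext_def using assms by (intro Sum_any.expand_superset) auto

lemma lin_ext_cols: "fin_cols T \<Longrightarrow> lin_ext T f u = (\<Sum>w | T w u \<noteq> 0. f w * T w u)"
  by (rule lin_ext_eq) (auto simp: fin_cols_def)

lemma lin_ext_single [simp]: "lin_ext T (single w) = T w"
  by (rule ext, subst lin_ext_eq[where X = "{w}"]) (auto simp: single_def)

lemma lin_ext_scale: "fin_cols T \<Longrightarrow> lin_ext T (\<lambda>x. c * g x) u = c * lin_ext T g u"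
  by (simp add: lin_ext_cols sum_distrib_left mult.assoc)

lemma lin_ext_sum:
  "fin_cols T \<Longrightarrow> lin_ext T (\<lambda>x. \<Sum>i\<in>I. g i x) u = (\<Sum>i\<in>I. lin_ext T (g i) u)"
  by (simp add: lin_ext_cols sum_distrib_right sum.swap[of _ I])

lemma lin_ext_add: "fin_cols T \<Longrightarrow> lin_ext T (\<lambda>x. f x + g x) u = lin_ext T f u + lin_ext T g u"
  by (simp add: lin_ext_cols distrib_right sum.distrib)

lemma lin_ext_diff: "fin_cols T \<Longrightarrow> lin_ext T (\<lambda>x. f x - g x) u = lin_ext T f u - lin_ext T g u"
  by (simp add: lin_ext_cols left_diff_distrib sum_subtractf)

lemma lin_ext_zero [simp]: "lin_ext T (\<lambda>x. 0) u = 0"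
  by (simp add: lin_ext_def)

lemma lin_ext_matrix_add:
  assumes "fin_cols S" "fin_cols T"
  shows "lin_ext (\<lambda>w x. S w x + T w x) f u = lin_ext S f u + lin_ext T f u"
proof -
  let ?X = "{w. S w u \<noteq> 0} \<union> {w. T w u \<noteq> 0}"
  have fin: "finite ?X" using assms by (simp add: fin_cols_def)
  have "lin_ext (\<lambda>w x. S w x + T w x) f u = (\<Sum>w\<in>?X. f w * (S w u + T w u))"
    by (rule lin_ext_eq[OF fin]) auto
  moreover have "lin_ext S f u = (\<Sum>w\<in>?X. f w * S w u)" by (rule lin_ext_eq[OF fin]) auto
  moreover have "lin_ext T f u = (\<Sum>w\<in>?X. f w * T w u)" by (rule lin_ext_eq[OF fin]) auto
  ultimately show ?thesis by (simp add: distrib_left sum.distrib)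
qed

lemma fin_cols_add:
  assumes "fin_cols S" "fin_cols T"
  shows "fin_cols (\<lambda>w x. S w x + T w x)"
  by (rule fin_colsI[where X = "\<lambda>u. {w. S w u \<noteq> 0} \<union> {w. T w u \<noteq> 0}"])
    (use assms in \<open>auto simp: fin_cols_def\<close>)

text \<open>The sums may be exchanged because everything that reaches \<open>u\<close> in two steps
  lies in one finite set: the union, over the finitely many \<open>v\<close> that reach
  \<open>u\<close>, of the finite columns of \<open>S\<close>.\<close>

lemma
  assumes S: "fin_cols S" and T: "fin_cols T"
  shows fin_cols_lin_ext: "fin_cols (\<lambda>w. lin_ext T (S w))"
    and lin_ext_lin_ext: "lin_ext T (lin_ext S f) = lin_ext (\<lambda>w. lin_ext T (S w)) f"
proof -
  let ?X = "\<lambda>u. \<Union>v\<in>{v. T v u \<noteq> 0}. {w. S w v \<noteq> 0}"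
  have fin: "finite (?X u)" for u using S T by (auto simp: fin_cols_def)
  have supp: "lin_ext T (S w) u = 0" if "w \<notin> ?X u" for w u
    by (subst lin_ext_cols[OF T]) (use that in \<open>auto intro!: sum.neutral\<close>)
  show "fin_cols (\<lambda>w. lin_ext T (S w))"
    by (rule fin_colsI[OF fin]) (use supp in blast)
  show "lin_ext T (lin_ext S f) = lin_ext (\<lambda>w. lin_ext T (S w)) f"
  proof
    fix u
    have "lin_ext T (lin_ext S f) u = (\<Sum>v | T v u \<noteq> 0. lin_ext S f v * T v u)"
      by (rule lin_ext_cols[OF T])
    also have "\<dots> = (\<Sum>v | T v u \<noteq> 0. (\<Sum>w\<in>?X u. f w * S w v) * T v u)"
      by (intro sum.cong refl arg_cong2[where f = "(*)"] lin_ext_eq[OF fin]) auto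
    also have "\<dots> = (\<Sum>w\<in>?X u. f w * (\<Sum>v | T v u \<noteq> 0. S w v * T v u))"
      by (simp only: sum_distrib_right sum_distrib_left mult.assoc, subst sum.swap) (rule refl)
    also have "\<dots> = (\<Sum>w\<in>?X u. f w * lin_ext T (S w) u)"
      by (simp only: lin_ext_cols[OF T])
    also have "\<dots> = lin_ext (\<lambda>w. lin_ext T (S w)) f u"
      by (rule lin_ext_eq[OF fin, symmetric]) (use supp in auto)
    finally show "lin_ext T (lin_ext S f) u = lin_ext (\<lambda>w. lin_ext T (S w)) f u" .
  qed
qed

section \<open>Bilinear extensions as linear extensions on pairs\<close>

abbreviation fin_cols2 :: "('m \<Rightarrow> 'n \<Rightarrow> 'o \<Rightarrow> 'k::field_char_0) \<Rightarrow> bool"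
  where "fin_cols2 T \<equiv> fin_cols (\<lambda>(w, v). T w v)"

lemma bilin_ext_lin_ext_pair:
  "bilin_ext T f g = lin_ext (\<lambda>(w, v). T w v) (\<lambda>(w, v). f w * g v)"
  unfolding bilin_ext_def lin_ext_def case_prod_unfold ..

lemma lin_ext_bilin_ext:
  assumes "fin_cols2 T" "fin_cols S"
  shows "lin_ext S (bilin_ext T f g) = bilin_ext (\<lambda>w v. lin_ext S (T w v)) f g"
  using lin_ext_lin_ext[OF assms, of "\<lambda>(w, v). f w * g v"]
  unfolding bilin_ext_lin_ext_pair by (simp add: case_prod_unfold)

lemma fin_cols2_lin_ext:
  assumes "fin_cols2 T" "fin_cols S"
  shows "fin_cols2 (\<lambda>w v. lin_ext S (T w v))"
  using fin_cols_lin_ext[OF assms] by (simp add: case_prod_unfold)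

text \<open>The pairs that reach \<open>u\<close> lie in the product of their two finite
  projections. On this rectangle the sums may be taken in either order, which allows changing one
  argument of a bilinear operator at a time.\<close>

lemma
  assumes T: "fin_cols2 T"
  shows bilin_ext_left: "bilin_ext T f g = lin_ext (\<lambda>v. lin_ext (\<lambda>w. T w v) f) g"
    and bilin_ext_right: "bilin_ext T f g = lin_ext (\<lambda>w. lin_ext (T w) g) f"
    and fin_cols_left: "fin_cols (\<lambda>w. T w v)"
    and fin_cols_right: "fin_cols (T w)"
proof -
  let ?A = "\<lambda>u. fst ` {z. (case z of (w, v) \<Rightarrow> T w v) u \<noteq> 0}"
  let ?B = "\<lambda>u. snd ` {z. (case z of (w, v) \<Rightarrow> T w v) u \<noteq> 0}"
  have fin: "finite (?A u)" "finite (?B u)" for u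
    using fin_colsD[OF T] by auto
  have A: "T w v u = 0" if "w \<notin> ?A u" for w v u using that by (force simp: image_iff)
  have B: "T w v u = 0" if "v \<notin> ?B u" for w v u using that by (force simp: image_iff)
  show "fin_cols (\<lambda>w. T w v)" by (rule fin_colsI[OF fin(1)]) (use A in blast)
  show "fin_cols (T w)" by (rule fin_colsI[OF fin(2)]) (use B in blast)
  have eq: "bilin_ext T f g u = (\<Sum>w\<in>?A u. \<Sum>v\<in>?B u. f w * g v * T w v u)" for u
  proof -
    have "bilin_ext T f g u
      = (\<Sum>z\<in>?A u \<times> ?B u. (case z of (w, v) \<Rightarrow> f w * g v) * (case z of (w, v) \<Rightarrow> T w v) u)"
      unfolding bilin_ext_lin_ext_pair
    proof (rule lin_ext_eq)
      show "finite (?A u \<times> ?B u)" using fin by blast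
      fix z assume z: "z \<notin> ?A u \<times> ?B u"
      obtain w v where wv: "z = (w, v)" by (cases z)
      have "w \<notin> ?A u \<or> v \<notin> ?B u" using z unfolding wv mem_Times_iff by simp
      then have "T w v u = 0" using A B by blast
      then have "(case z of (w, v) \<Rightarrow> T w v) u = 0" unfolding wv by simp
      then show "(case z of (w, v) \<Rightarrow> f w * g v) = 0 \<or> (case z of (w, v) \<Rightarrow> T w v) u = 0" ..
    qed
    then show ?thesis unfolding sum.cartesian_product case_prod_unfold .
  qed
  show "bilin_ext T f g = lin_ext (\<lambda>w. lin_ext (T w) g) f"
  proof
    fix u
    have 1: "lin_ext (T w) g u = (\<Sum>v\<in>?B u. g v * T w v u)" for w
      by (rule lin_ext_eq[OF fin(2)]) (rule disjI2, erule B)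
    have "lin_ext (\<lambda>w. lin_ext (T w) g) f u = (\<Sum>w\<in>?A u. f w * (\<Sum>v\<in>?B u. g v * T w v u))"
      unfolding 1[symmetric]
      by (rule lin_ext_eq[OF fin(1)], rule disjI2, unfold 1, rule sum.neutral)
        (intro ballI, simp only: A mult_zero_right simp_thms)
    then show "bilin_ext T f g u = lin_ext (\<lambda>w. lin_ext (T w) g) f u"
      by (simp only: eq sum_distrib_left mult.assoc)
  qed
  show "bilin_ext T f g = lin_ext (\<lambda>v. lin_ext (\<lambda>w. T w v) f) g"
  proof
    fix u
    have 1: "lin_ext (\<lambda>w. T w v) f u = (\<Sum>w\<in>?A u. f w * T w v u)" for v
      by (rule lin_ext_eq[OF fin(1)]) (rule disjI2, erule A)
    have "lin_ext (\<lambda>v. lin_ext (\<lambda>w. T w v) f) g u = (\<Sum>v\<in>?B u. g v * (\<Sum>w\<in>?A u. f w * T w v u))"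
      unfolding 1[symmetric]
      by (rule lin_ext_eq[OF fin(2)], rule disjI2, unfold 1, rule sum.neutral)
        (intro ballI, simp only: B mult_zero_right simp_thms)
    also have "\<dots> = bilin_ext T f g u"
      unfolding eq by (subst sum.swap) (simp only: sum_distrib_left mult_ac)
    finally show "bilin_ext T f g u = lin_ext (\<lambda>v. lin_ext (\<lambda>w. T w v) f) g u" ..
  qed
qed

text \<open>With \<open>AB\<close> the tensor product of the matrices \<open>A\<close> and
  \<open>B\<close>, the tensor product of the images is the image of the tensor product, and the
  claim becomes the composition rule for linear extensions.\<close>

lemma bilin_ext_lin_ext:
  fixes T :: "'m \<Rightarrow> 'm \<Rightarrow> 'n \<Rightarrow> 'k::field_char_0" and A B :: "'l \<Rightarrow> 'm \<Rightarrow> 'k"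
  assumes T: "fin_cols2 T" and A: "fin_cols A" and B: "fin_cols B"
  shows "bilin_ext T (lin_ext A f) (lin_ext B g) = bilin_ext (\<lambda>w v. bilin_ext T (A w) (B v)) f g"
    and "fin_cols2 (\<lambda>w v. bilin_ext T (A w) (B v))"
proof -
  define AB where "AB = (\<lambda>(w, v) (w', v'). A w w' * B v v')"
  have AB: "fin_cols AB"
    by (rule fin_colsI[where X = "\<lambda>(w', v'). {w. A w w' \<noteq> 0} \<times> {v. B v v' \<noteq> 0}"])
      (use A B in \<open>auto simp: AB_def fin_cols_def\<close>)
  have tensor: "(\<lambda>(w', v'). lin_ext A f w' * lin_ext B g v') = lin_ext AB (\<lambda>(w, v). f w * g v)"
  proof
    fix z :: "'m \<times> 'm"
    obtain w' v' where z: "z = (w', v')" by (cases z)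
    have "lin_ext AB (\<lambda>(w, v). f w * g v) z
      = (\<Sum>x\<in>{w. A w w' \<noteq> 0} \<times> {v. B v v' \<noteq> 0}. (case x of (w, v) \<Rightarrow> f w * g v) * AB x z)"
      by (rule lin_ext_eq) (use A B in \<open>auto simp: AB_def fin_cols_def z\<close>)
    also have "\<dots> = (\<Sum>w | A w w' \<noteq> 0. \<Sum>v | B v v' \<noteq> 0. f w * g v * (A w w' * B v v'))"
      by (simp only: sum.cartesian_product) (simp only: AB_def z case_prod_unfold fst_conv snd_conv)
    also have "\<dots> = lin_ext A f w' * lin_ext B g v'"
      unfolding lin_ext_cols[OF A] lin_ext_cols[OF B] sum_product
      by (intro sum.cong refl) (simp only: mult_ac)
    finally show "(case z of (w', v') \<Rightarrow> lin_ext A f w' * lin_ext B g v') = lin_ext AB (\<lambda>(w, v). f w * g v) z"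
      by (simp add: z)
  qed
  have eq: "(\<lambda>z. lin_ext (\<lambda>(w, v). T w v) (AB z)) = (\<lambda>(w, v). bilin_ext T (A w) (B v))"
    unfolding bilin_ext_lin_ext_pair AB_def by (rule ext) (simp add: case_prod_unfold)
  have "bilin_ext T (lin_ext A f) (lin_ext B g)
      = lin_ext (\<lambda>(w, v). T w v) (lin_ext AB (\<lambda>(w, v). f w * g v))"
    unfolding tensor[symmetric] by (rule bilin_ext_lin_ext_pair)
  also have "\<dots> = lin_ext (\<lambda>z. lin_ext (\<lambda>(w, v). T w v) (AB z)) (\<lambda>(w, v). f w * g v)"
    by (rule lin_ext_lin_ext[OF AB T])
  also have "\<dots> = bilin_ext (\<lambda>w v. bilin_ext T (A w) (B v)) f g"
    unfolding eq by (rule bilin_ext_lin_ext_pair[symmetric])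
  finally show "bilin_ext T (lin_ext A f) (lin_ext B g) = bilin_ext (\<lambda>w v. bilin_ext T (A w) (B v)) f g" .
  show "fin_cols2 (\<lambda>w v. bilin_ext T (A w) (B v))"
    using fin_cols_lin_ext[OF AB T] unfolding eq .
qed

section \<open>Operators on completed coinvariants\<close>

text \<open>The scalar multiplication written out under \<open>module.span\<close> in
  \<open>degreewise_span\<close>; with a name, the vector space lemmas on spans become
  available.\<close>

definition fscale :: "'k::field_char_0 \<Rightarrow> ('m \<Rightarrow> 'k) \<Rightarrow> 'm \<Rightarrow> 'k"
  where "fscale = (\<lambda>c g x. c * g x)"

lemma vector_space_fscale: "vector_space fscale"
  by unfold_locales (simp_all add: fscale_def fun_eq_iff distrib_left distrib_right mult.assoc)

lemma sum_fun_apply: "(\<Sum>i\<in>I. F i) x = (\<Sum>i\<in>I. F i x :: 'k::comm_monoid_add)"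
  by (induction I rule: infinite_finite_induct) auto

text \<open>A series with infinitely many components in the span may itself fail to lie in it. Yet
  the coefficient of \<open>u\<close> sees only the finitely many degrees that occur in its column,
  and in each of them the component is a combination of relations.\<close>

lemma lin_ext_degreewise_span:
  fixes T :: "'m \<Rightarrow> 'n \<Rightarrow> 'k::field_char_0"
  assumes T: "fin_cols T" and R: "\<And>r. r \<in> R \<Longrightarrow> lin_ext T r = (\<lambda>_. 0)"
    and f: "f \<in> degreewise_span deg R"
  shows "lin_ext T f = (\<lambda>_. 0)"
proof
  interpret series: vector_space "fscale :: 'k \<Rightarrow> ('m \<Rightarrow> 'k) \<Rightarrow> 'm \<Rightarrow> 'k"
    by (rule vector_space_fscale)
  fix u
  define fd where "fd d = (\<lambda>x. if deg x = d then f x else 0)" for d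
  have span_zero: "lin_ext T g = (\<lambda>_. 0)" if "g \<in> series.span R" for g
    using that
  proof (induction rule: series.span_induct_alt)
    case base
    then show ?case by (auto simp: fun_eq_iff zero_fun_def)
  next
    case (step c x y)
    then show ?case using R[of x]
      by (simp add: fun_eq_iff plus_fun_def fscale_def lin_ext_add[OF T] lin_ext_scale[OF T])
  qed
  have "fd d \<in> series.span R" for d
    using f unfolding degreewise_span_def fd_def fscale_def by blast
  then have zero: "lin_ext T (fd d) u = 0" for d
    by (simp add: span_zero)
  let ?X = "{w. T w u \<noteq> 0}"
  have fin: "finite ?X" by (rule fin_colsD[OF T])
  have "lin_ext T f u = (\<Sum>w\<in>?X. f w * T w u)" by (rule lin_ext_cols[OF T])
  also have "\<dots> = (\<Sum>w\<in>?X. \<Sum>d\<in>deg ` ?X. fd d w * T w u)"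
    using fin by (intro sum.cong refl) (simp add: fd_def if_distrib[where f = "\<lambda>x. x * _"] cong: if_cong)
  also have "\<dots> = (\<Sum>d\<in>deg ` ?X. lin_ext T (fd d) u)"
    by (subst sum.swap) (simp add: lin_ext_cols[OF T])
  also have "\<dots> = 0" using zero by simp
  finally show "lin_ext T f u = 0" .
qed

lemma zero_degreewise_span: "(0 :: 'm \<Rightarrow> 'k::field_char_0) \<in> degreewise_span deg R"
proof -
  interpret series: vector_space "fscale :: 'k \<Rightarrow> ('m \<Rightarrow> 'k) \<Rightarrow> 'm \<Rightarrow> 'k"
    by (rule vector_space_fscale)
  have "(\<lambda>x. if deg x = d then (0 :: 'm \<Rightarrow> 'k) x else 0) = 0" for d
    by (auto simp: fun_eq_iff)
  then show ?thesis
    using series.span_zero[of R] unfolding degreewise_span_def fscale_def by simp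
qed

lemma eq_mod_refl: "f \<in> F \<Longrightarrow> (f, f) \<in> eq_mod F (degreewise_span deg R)"
  by (simp add: eq_mod_def zero_degreewise_span)

lemma lin_ext_eq_mod:
  assumes "fin_cols T" "\<And>r. r \<in> R \<Longrightarrow> lin_ext T r = (\<lambda>_. 0)"
    and "(f, g) \<in> eq_mod F (degreewise_span deg R)"
  shows "lin_ext T f = lin_ext T g"
proof -
  have "lin_ext T (\<lambda>x. f x - g x) = (\<lambda>_. 0)"
    by (rule lin_ext_degreewise_span[where R = R and deg = deg, OF assms(1,2)])
      (use assms(3) in \<open>auto simp: eq_mod_def fun_diff_def\<close>)
  then show ?thesis
    by (simp add: lin_ext_diff[OF assms(1)] fun_eq_iff)
qed

lemma lin_ext_relation:
  assumes "fin_cols T" "\<And>u. T y u = c * T z u"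
  shows "lin_ext T (single y - (\<lambda>x. c * single z x)) = (\<lambda>_. 0)"
  unfolding fun_diff_def
  by (rule ext) (simp add: lin_ext_diff[OF assms(1)] lin_ext_scale[OF assms(1)] assms(2))

section \<open>Symmetrization detects equality in the completed symmetric algebra\<close>

fun com_sym :: "('a \<Rightarrow> bool) \<Rightarrow> nat \<times> 'a list \<Rightarrow> nat \<times> 'a list \<Rightarrow> 'k::field_char_0" where
  "com_sym p (e, w) (d, u) = of_bool (d = e) * symmetrize p w u"

lemma symmetrize_nz:
  assumes "symmetrize p w u \<noteq> (0 :: 'k::field_char_0)"
  shows "mset w = mset u"
proof -
  obtain js where "js \<in> permutations_of_set {..<length w}"
      "koszul p w js * of_bool (u = map ((!) w) js) \<noteq> (0 :: 'k)"
    by (rule sum.not_neutral_contains_not_neutral[OF assms[unfolded symmetrize_def]])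
  then have js: "js \<in> permutations_of_set {..<length w}" "u = map ((!) w) js"
    by (simp_all only: mult_eq_0_iff of_bool_eq_0_iff de_Morgan_disj not_not)
  have "distinct js" "set js = set [0..<length w]"
    using js(1) by (simp_all add: permutations_of_set_def lessThan_atLeast0)
  then have "mset js = mset [0..<length w]"
    using iffD1[OF set_eq_iff_mset_eq_distinct] distinct_upt by blast
  then have "mset u = mset (map ((!) w) [0..<length w])"
    unfolding js by (simp only: mset_map)
  then show ?thesis by (simp add: map_nth)
qed

lemma finite_mset_eq: "finite {w. mset w = mset u}"
  by (rule finite_subset[OF _ finite_lists_length_eq[OF finite_set[of u], of "length u"]])
    (auto dest: mset_eq_setD mset_eq_length)

lemma fin_cols_symmetrize: "fin_cols (symmetrize p)"
  by (rule fin_colsI[OF finite_mset_eq]) (use symmetrize_nz in blast)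

lemma fin_cols_com_sym: "fin_cols (com_sym p)"
  by (rule fin_colsI[where X = "\<lambda>(d, u). {d} \<times> {w. mset w = mset u}"])
    (auto simp: finite_mset_eq dest: symmetrize_nz)

lemma lin_ext_com_sym:
  "lin_ext (com_sym p) f (d, u) = lin_ext (symmetrize p) (\<lambda>w. f (d, w)) u"
proof -
  have "lin_ext (com_sym p) f (d, u)
    = (\<Sum>z\<in>{d} \<times> {w. mset w = mset u}. f z * com_sym p z (d, u))"
    by (rule lin_ext_eq) (auto simp: finite_mset_eq dest: symmetrize_nz)
  also have "\<dots> = (\<Sum>w | mset w = mset u. f (d, w) * symmetrize p w u)"
  proof -
    have "{d} \<times> {w. mset w = mset u} = Pair d ` {w. mset w = mset u}" by auto
    then show ?thesis by (simp add: sum.reindex inj_on_def)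
  qed
  also have "\<dots> = lin_ext (symmetrize p) (\<lambda>w. f (d, w)) u"
    by (rule lin_ext_eq[symmetric]) (auto simp: finite_mset_eq dest: symmetrize_nz)
  finally show ?thesis .
qed

lemma symmetrize_perm:
  assumes "js \<in> permutations_of_set {..<length w}"
  shows "symmetrize p w u = koszul p w js * symmetrize p (map ((!) w) js) u"
  using skew_koszul[of w p "\<lambda>L. symmetrize p (map ((!) w) L) u" js] assms
  by (simp add: skew_symmetrize permutations_of_set_def map_nth)

lemma com_sym_kills_relations:
  fixes V :: "('a, 'k::field_char_0) superspace"
  shows "r \<in> com_relations V \<Longrightarrow> lin_ext (com_sym (spar V)) r = (\<lambda>_. 0)"
proof -
  assume "r \<in> com_relations V"
  then obtain e w js where r: "r = single (e, w)
      - (\<lambda>x. koszul (spar V) w js * single (e, map ((!) w) js) x)"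
    and js: "js \<in> permutations_of_set {..<length w}"
    unfolding com_relations_def by auto
  show "lin_ext (com_sym (spar V)) r = (\<lambda>_. 0)"
    unfolding r
  proof (rule lin_ext_relation[OF fin_cols_com_sym])
    fix u show "(com_sym (spar V) (e, w) u :: 'k)
      = koszul (spar V) w js * com_sym (spar V) (e, map ((!) w) js) u"
      by (cases u) (simp add: symmetrize_perm[OF js, of "spar V"])
  qed
qed

text \<open>The averaging argument. In degree n a series is the average over all permutations of the
  relations between its words and their signed rearrangements, plus its symmetrization divided by
  n!. The latter vanishes by assumption; the former is a finite combination because the basis is
  finite.\<close>

lemma com_sym_zero_imp:
  fixes V :: "('a, 'k::field_char_0) superspace"
  assumes fin: "finite (sbasis V)" and f: "f \<in> com_series V"
    and zero: "lin_ext (com_sym (spar V)) f = (\<lambda>_. 0)"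
  shows "f \<in> degreewise_span (\<lambda>(e, w). (e, length w)) (com_relations V)"
proof -
  interpret series: vector_space "fscale :: 'k \<Rightarrow> (nat \<times> 'a list \<Rightarrow> 'k) \<Rightarrow> nat \<times> 'a list \<Rightarrow> 'k"
    by (rule vector_space_fscale)
  have "(\<lambda>x. if (case x of (e, w) \<Rightarrow> (e, length w)) = (e, n) then f x else 0)
      \<in> series.span (com_relations V)" for e n
  proof -
    define M where "M = {w. set w \<subseteq> sbasis V \<and> length w = n}"
    have finM: "finite M" unfolding M_def by (rule finite_lists_length_eq[OF fin])
    define S where "S = permutations_of_set {..<n}"
    have cardS: "card S = fact n" by (simp add: S_def)
    define rel where "rel w js = (single (e, w)
      - (\<lambda>x. koszul (spar V) w js * single (e, map ((!) w) js) x) :: nat \<times> 'a list \<Rightarrow> 'k)" for w js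
    define g where "g = (\<Sum>w\<in>M. \<Sum>js\<in>S. fscale (f (e, w) / fact n) (rel w js))"
    have "rel w js \<in> com_relations V" if "w \<in> M" "js \<in> S" for w js
      unfolding com_relations_def rel_def using that
      by (intro CollectI exI[of _ e] exI[of _ w] exI[of _ js]) (auto simp: M_def S_def)
    then have "g \<in> series.span (com_relations V)"
      unfolding g_def by (intro series.span_sum series.span_scale series.span_base)
    moreover have "g = (\<lambda>x. if (case x of (e, w) \<Rightarrow> (e, length w)) = (e, n) then f x else 0)"
    proof
      fix x :: "nat \<times> 'a list"
      obtain d u where x: "x = (d, u)" by (cases x)
      have "g x = (\<Sum>w\<in>M. f (e, w) / fact n *
          (\<Sum>js\<in>S. single (e, w) x - koszul (spar V) w js * single (e, map ((!) w) js) x))"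
        by (simp add: g_def fscale_def sum_fun_apply rel_def sum_distrib_left)
      also have "\<dots> = (\<Sum>w\<in>M. f (e, w) * single (e, w) x)
        - (\<Sum>w\<in>M. f (e, w) * (of_bool (d = e) * symmetrize (spar V) w u)) / fact n"
      proof -
        have "(\<Sum>js\<in>S. single (e, w) x - koszul (spar V) w js * single (e, map ((!) w) js) x)
          = fact n * single (e, w) x - of_bool (d = e) * symmetrize (spar V) w u" if "w \<in> M" for w
          using that cardS by (auto simp: sum_subtractf symmetrize_def S_def M_def x single_def sum_distrib_left
              intro!: sum.cong)
        then have "(\<Sum>w\<in>M. f (e, w) / fact n *
          (\<Sum>js\<in>S. single (e, w) x - koszul (spar V) w js * single (e, map ((!) w) js) x))
          = (\<Sum>w\<in>M. f (e, w) / fact n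
              * (fact n * single (e, w) x - of_bool (d = e) * symmetrize (spar V) w u))"
          by (intro sum.cong refl arg_cong2[where f = "(*)"])
        also have "\<dots> = (\<Sum>w\<in>M. f (e, w) * single (e, w) x
            - f (e, w) * (of_bool (d = e) * symmetrize (spar V) w u) / fact n)"
          by (intro sum.cong refl) (simp add: field_simps)
        finally show ?thesis
          by (simp only: sum_subtractf sum_divide_distrib)
      qed
      \<comment> \<open>For words of degree \<open>n\<close> this is a coefficient of the
        symmetrization of \<open>f\<close>, zero by assumption. In other degrees it is zero because
        symmetrization only rearranges letters.\<close>
      also have "(\<Sum>w\<in>M. f (e, w) * (of_bool (d = e) * symmetrize (spar V) w u)) = 0"
      proof (cases "d = e \<and> length u = n")
        case True
        have "lin_ext (com_sym (spar V)) f (e, u) = (\<Sum>w\<in>M. f (e, w) * symmetrize (spar V) w u)"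
          unfolding lin_ext_com_sym
        proof (rule lin_ext_eq[OF finM])
          fix w assume "w \<notin> M"
          show "f (e, w) = 0 \<or> symmetrize (spar V) w u = 0"
          proof (rule ccontr)
            assume "\<not> ?thesis"
            then have "f (e, w) \<noteq> 0" "mset w = mset u" using symmetrize_nz by blast+
            then have "w \<in> M"
              using f True by (auto simp: com_series_def M_def dest: mset_eq_length)
            with \<open>w \<notin> M\<close> show False by simp
          qed
        qed
        then show ?thesis using True zero by simp
      next
        case False
        have "d \<noteq> e \<or> symmetrize (spar V) w u = (0 :: 'k)" if "w \<in> M" for w
        proof (rule ccontr)
          assume "\<not> ?thesis"
          then have "d = e" "length w = length u"
            using symmetrize_nz[of "spar V" w u] mset_eq_length by blast+
          with False that show False by (auto simp: M_def)
        qed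
        then show ?thesis by (intro sum.neutral) auto
      qed
      also have "(\<Sum>w\<in>M. f (e, w) * single (e, w) x) = (if d = e \<and> u \<in> M then f (e, u) else 0)"
      proof -
        have "f (e, w) * single (e, w) x = (if u = w then if d = e then f (e, u) else 0 else 0)" for w
          by (simp add: x single_def)
        then show ?thesis using finM by simp
      qed
      also have "(if d = e \<and> u \<in> M then f (e, u) else 0) = (if d = e \<and> length u = n then f (e, u) else 0)"
        using f by (auto simp: M_def com_series_def)
      finally show "g x = (if (case x of (e, w) \<Rightarrow> (e, length w)) = (e, n) then f x else 0)"
        by (auto simp: x)
    qed
    ultimately show ?thesis by simp
  qed
  then show ?thesis unfolding degreewise_span_def fscale_def by fast
qed

text \<open>From here on, equality of commutative classes is handled as equality of
  functions.\<close>

lemma com_eq_iff: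
  assumes "finite (sbasis V)"
  shows "(f, g) \<in> com_eq V \<longleftrightarrow> f \<in> com_series V \<and> g \<in> com_series V
    \<and> lin_ext (com_sym (spar V)) f = lin_ext (com_sym (spar V)) g"
proof
  assume *: "(f, g) \<in> com_eq V"
  then show "f \<in> com_series V \<and> g \<in> com_series V
    \<and> lin_ext (com_sym (spar V)) f = lin_ext (com_sym (spar V)) g"
    unfolding com_eq_def
    by (auto simp: eq_mod_def intro!: lin_ext_eq_mod[OF fin_cols_com_sym com_sym_kills_relations])
next
  assume *: "f \<in> com_series V \<and> g \<in> com_series V
    \<and> lin_ext (com_sym (spar V)) f = lin_ext (com_sym (spar V)) g"
  then have "lin_ext (com_sym (spar V)) (\<lambda>x. f x - g x) = (\<lambda>_. 0)"
    by (auto simp: lin_ext_diff[OF fin_cols_com_sym])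
  moreover have "(\<lambda>x. f x - g x) \<in> com_series V"
    using * unfolding com_series_def mem_Collect_eq
    by (metis (no_types, lifting) diff_zero)
  ultimately have "f - g \<in> degreewise_span (\<lambda>(e, w). (e, length w)) (com_relations V)"
    unfolding fun_diff_def by (intro com_sym_zero_imp[OF assms])
  with * show "(f, g) \<in> com_eq V" by (simp add: com_eq_def eq_mod_def)
qed

section \<open>Koszul signs of reorderings inside a word\<close>

text \<open>Reordering a stretch \<open>N\<close> inside a longer list: with \<open>P\<close> and
  \<open>S\<close> held fixed, the functional of the orders of \<open>N\<close> is again skew, for
  the parities of the letters in \<open>N\<close>.\<close>

lemma skew_koszul_infix:
  fixes G :: "nat list \<Rightarrow> 'k::field_char_0"
  assumes G: "skew X (\<lambda>k. p (y k)) G" and d: "distinct (P @ N @ S)" and s: "set (P @ N @ S) \<subseteq> X"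
    and js: "distinct js" "set js = {..<length N}"
  shows "G (P @ N @ S) = koszul p (map y N) js * G (P @ map ((!) N) js @ S)"
proof -
  have "skew {..<length (map y N)} (\<lambda>k. p (map y N ! k)) (\<lambda>R. G (P @ map ((!) N) R @ S))"
    unfolding skew_def
  proof (intro allI impI)
    fix A a b B assume dR: "distinct (A @ a # b # B)"
      and sR: "set (A @ a # b # B) \<subseteq> {..<length (map y N)}"
    have inj: "inj_on ((!) N) (set (A @ a # b # B))"
      using d sR by (intro inj_on_nth) auto
    have dist: "distinct (map ((!) N) (A @ a # b # B))"
      unfolding distinct_map using dR inj by blast
    have sub: "set (map ((!) N) (A @ a # b # B)) \<subseteq> set N"
      using sR by (auto simp: subset_iff)
    define M where "M = map ((!) N) (A @ a # b # B)"
    have PMS: "distinct (P @ M @ S)" "set (P @ M @ S) \<subseteq> X"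
      using d s dist sub unfolding M_def[symmetric] by auto
    have "G ((P @ map ((!) N) A) @ N ! a # N ! b # (map ((!) N) B @ S))
      = sg (p (y (N ! a)) \<and> p (y (N ! b))) * G ((P @ map ((!) N) A) @ N ! b # N ! a # (map ((!) N) B @ S))"
      by (rule skewD[OF G]) (use PMS in \<open>simp_all add: M_def\<close>)
    then show "G (P @ map ((!) N) (A @ a # b # B) @ S)
      = sg (p (map y N ! a) \<and> p (map y N ! b)) * G (P @ map ((!) N) (A @ b # a # B) @ S)"
      using sR by simp
  qed
  from skew_koszul[OF this js(1)] js(2) show ?thesis by (simp add: map_nth)
qed

lemma set_concat_nth:
  assumes "distinct (concat poss)" "r < length poss" "s < length poss" "r \<noteq> s"
  shows "set (poss ! r) \<inter> set (poss ! s) = {}"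
  using assms
proof (induction poss arbitrary: r s)
  case (Cons c poss)
  have "set c \<inter> set (poss ! t) = {}" if "t < length poss" for t
    using Cons.prems(1) nth_mem[OF that] by fastforce
  with Cons show ?case by (cases r; cases s) auto
qed simp

lemma distinct_concat_nth:
  assumes d: "distinct (concat poss)"
  shows "distinct R \<Longrightarrow> set R \<subseteq> {..<length poss} \<Longrightarrow> distinct (concat (map ((!) poss) R))"
proof (induction R)
  case (Cons a R)
  have "distinct (poss ! a)"
    using d Cons.prems by (simp add: distinct_concat_iff)
  moreover have "set (poss ! a) \<inter> set (poss ! b) = {}" if "b \<in> set R" for b
    using set_concat_nth[OF d] Cons.prems that by auto
  ultimately show ?case using Cons by fastforce
qed simp

text \<open>Words are permuted as blocks. By \<open>skew_block\<close>, neighbouring words commute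
  with the sign of their total parities, so the functional of the orders of the words is skew for
  \<open>word_parity\<close>.\<close>

lemma skew_koszul_words:
  fixes G :: "nat list \<Rightarrow> 'k::field_char_0"
  assumes G: "skew X (\<lambda>k. p (y k)) G" and d: "distinct (concat poss)" and s: "set (concat poss) \<subseteq> X"
    and js: "distinct js" "set js = {..<length poss}"
  shows "G (concat poss)
    = koszul (word_parity p) (map (map y) poss) js * G (concat (map ((!) poss) js))"
proof -
  let ?ws = "map (map y) poss"
  have "skew {..<length ?ws} (\<lambda>k. word_parity p (?ws ! k)) (\<lambda>R. G (concat (map ((!) poss) R)))"
    unfolding skew_def
  proof (intro allI impI)
    fix A a b B assume dR: "distinct (A @ a # b # B)"
      and sR: "set (A @ a # b # B) \<subseteq> {..<length ?ws}"
    have dist: "distinct (concat (map ((!) poss) (A @ a # b # B)))"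
      by (rule distinct_concat_nth[OF d dR]) (use sR in simp)
    have sub: "set (concat (map ((!) poss) (A @ a # b # B))) \<subseteq> X"
    proof
      fix k assume "k \<in> set (concat (map ((!) poss) (A @ a # b # B)))"
      then obtain r where r: "r \<in> set (A @ a # b # B)" "k \<in> set (poss ! r)" by auto
      then have "poss ! r \<in> set poss" using sR by (intro nth_mem) auto
      then show "k \<in> X" using s r(2) by auto
    qed
    show "G (concat (map ((!) poss) (A @ a # b # B)))
      = sg (word_parity p (?ws ! a) \<and> word_parity p (?ws ! b)) * G (concat (map ((!) poss) (A @ b # a # B)))"
      using skew_block[OF G, of "concat (map ((!) poss) A)" "poss ! a" "poss ! b" "concat (map ((!) poss) B)"]
        dist sub sR by (simp add: word_parity_map)
  qed
  from skew_koszul[OF this js(1)] js(2) show ?thesis by (simp add: map_nth)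
qed

lemma to_front2_perm:
  assumes "i < n" "j < n" "i \<noteq> j"
  shows "distinct (to_front2 n i j)" "set (to_front2 n i j) = {..<n}"
  using assms by (auto simp: to_front2_def)

lemma map_nth_upt: "j \<le> length w \<Longrightarrow> map ((!) w) [i..<j] = drop i (take j w)"
  by (rule nth_equalityI) auto

lemma filter_upt_neq:
  assumes "i < j" "j < n"
  shows "filter (\<lambda>k. k \<noteq> i \<and> k \<noteq> j) [0..<n] = [0..<i] @ [Suc i..<j] @ [Suc j..<n]"
proof -
  have "[0..<n] = [0..<i] @ i # [Suc i..<j] @ j # [Suc j..<n]"
    using assms upt_conv_Cons[of i n] upt_conv_Cons[of j n] upt_add_eq_append[of 0 i "n - i"]
      upt_add_eq_append[of "Suc i" j "n - j"] by simp
  moreover have "filter (\<lambda>k. k \<noteq> i \<and> k \<noteq> j) [a..<b] = [a..<b]"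
    if "b \<le> i \<or> i < a" "b \<le> j \<or> j < a" for a b
    using that by (auto simp: filter_id_conv)
  ultimately show ?thesis using assms by simp
qed

lemma map_to_front2:
  assumes "i < j" "j < length w"
  shows "map ((!) w) (to_front2 (length w) i j) = w ! i # w ! j # del i (del j w)"
  using assms
  by (simp add: to_front2_def filter_upt_neq map_nth_upt del_def min_def drop_take)

text \<open>The sign for bringing two positions to the front is the quotient of two sorting signs.
  The second one is the sign in \<open>contraction\<close>, the first is common to all
  pairs.\<close>

lemma koszul_to_front2:
  assumes "distinct N" "i < j" "j < length N"
  shows "koszul p (map y N) (to_front2 (length N) i j)
    = order_sign (\<lambda>k. p (y k)) N
      * (order_sign (\<lambda>k. p (y k)) (N ! i # N ! j # del i (del j N)) :: 'k::field_char_0)"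
proof -
  have "(order_sign (\<lambda>k. p (y k)) N :: 'k)
    = koszul p (map y N) (to_front2 (length N) i j)
      * order_sign (\<lambda>k. p (y k)) (N ! i # N ! j # del i (del j N))"
    using skew_koszul_infix[OF skew_order_sign, where p = p and y = y and P = "[]" and N = N
        and S = "[]" and js = "to_front2 (length N) i j"]
      to_front2_perm[of i "length N" j] assms
    by (simp add: map_to_front2 del: order_sign.simps)
  then show ?thesis by (simp add: mult.assoc del: order_sign.simps)
qed

lemma
  assumes "i < length w"
  shows set_insert_del: "set w = insert (w ! i) (set (del i w))"
    and set_del: "distinct w \<Longrightarrow> set (del i w) = set w - {w ! i}"
    and distinct_del: "distinct w \<Longrightarrow> distinct (del i w)"
proof -
  have w: "w = take i w @ w ! i # drop (Suc i) w" by (rule id_take_nth_drop[OF assms])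
  show *: "set w = insert (w ! i) (set (del i w))"
    unfolding del_def by (subst w) simp
  assume "distinct w"
  then have d: "distinct (take i w @ w ! i # drop (Suc i) w)" using w by simp
  then show "distinct (del i w)" by (simp add: del_def)
  have "w ! i \<notin> set (del i w)" using d by (simp add: del_def)
  then show "set (del i w) = set w - {w ! i}" unfolding * by simp
qed

lemma sum_set_nth: "distinct L \<Longrightarrow> (\<Sum>I\<in>set L. g I) = (\<Sum>i<length L. g (L ! i))"
  by (rule sum.reindex_bij_betw[symmetric, OF bij_betw_nth]) auto

lemma nth_del: "i < j \<Longrightarrow> i < length w \<Longrightarrow> del j w ! i = w ! i"
  by (simp add: del_def nth_append)

lemma length_del: "i < length w \<Longrightarrow> length (del i w) = length w - 1"
  by (simp add: del_def)

lemma del_append: "i < length v \<Longrightarrow> del i (v @ w) = del i v @ w"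
  "del (length v + j) (v @ w) = v @ del j w"
  by (simp_all add: del_def)

lemma map_del: "map f (del i w) = del i (map f w)"
  by (simp add: del_def take_map drop_map)

section \<open>Contractions\<close>

text \<open>Contracts the letters at \<open>I\<close> and \<open>J\<close> among those at the positions \<open>X\<close>; the order chosen for the
  remaining letters is immaterial after symmetrization.\<close>

definition contraction :: "('b, 'k::field_char_0) superspace \<Rightarrow> (nat \<Rightarrow> 'b) \<Rightarrow> nat set \<Rightarrow>
    nat \<Rightarrow> nat \<Rightarrow> 'b list \<Rightarrow> 'k"
  where "contraction V y X I J u =
    (let R = sorted_list_of_set (X - {I, J})
     in order_sign (\<lambda>k. spar V (y k)) (I # J # R) * inv_form V (y I) (y J)
        * symmetrize (spar V) (map y R) u)"

text \<open>Another order of the remaining letters changes the sorting sign and the symmetrized word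
  by the same factor.\<close>

lemma contraction_eq:
  fixes V :: "('b, 'k::field_char_0) superspace"
  assumes "finite X" "distinct L" "set L = X - {I, J}"
  shows "contraction V y X I J u
    = order_sign (\<lambda>k. spar V (y k)) (I # J # L) * inv_form V (y I) (y J)
        * symmetrize (spar V) (map y L) u"
proof -
  define R where "R = sorted_list_of_set (X - {I, J})"
  have R: "distinct R" "set R = set L" using assms by (simp_all add: R_def)
  have "order_sign (\<lambda>k. spar V (y k)) L * symmetrize (spar V) (map y L) u
    = order_sign (\<lambda>k. spar V (y k)) R * (symmetrize (spar V) (map y R) u :: 'k)"
    using skew_perm[OF skew_symmetrize, of "[]" L UNIV R "spar V" y u] assms R by simp
  then show ?thesis
    unfolding contraction_def R_def[symmetric] Let_def order_sign.simps list.set R(2)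
    by (simp add: mult_ac)
qed

lemma lin_ext_of_bool: "fin_cols T \<Longrightarrow> lin_ext T (\<lambda>u. c * of_bool (u = w)) u' = c * T w u'"
  using lin_ext_scale[of T c "single w" u'] lin_ext_single[of T w] by (simp add: single_def)

text \<open>All dependence on the order within \<open>L\<close> and \<open>M\<close> sits in the
  sign in front; the double sum refers to the two sets only. This makes the bracket compatible with
  permutations of letters.\<close>

lemma symmetrize_word_bracket:
  assumes d: "distinct (L @ M)"
  shows "lin_ext (symmetrize (spar V)) (word_bracket V (map y L) (map y M)) u
    = order_sign (\<lambda>k. spar V (y k)) (L @ M)
      * (\<Sum>I\<in>set L. \<Sum>J\<in>set M. contraction V y (set (L @ M)) I J u)" (is "_ = ?s * _")
proof -
  have trm: "koszul (spar V) (map y L @ map y M) (to_front2 (length L + length M) i (length L + j))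
      * inv_form V (y (L ! i)) (y (M ! j)) * symmetrize (spar V) (map y (del i L @ del j M)) u
    = ?s * contraction V y (set (L @ M)) (L ! i) (M ! j) u"
    if i: "i < length L" and j: "j < length M" for i j
  proof -
    have LM: "(L @ M) ! i = L ! i" "(L @ M) ! (length L + j) = M ! j"
      "del i (del (length L + j) (L @ M)) = del i L @ del j M"
      using i by (simp_all add: nth_append del_append)
    have k: "koszul (spar V) (map y L @ map y M) (to_front2 (length L + length M) i (length L + j))
      = ?s * order_sign (\<lambda>k. spar V (y k)) (L ! i # M ! j # (del i L @ del j M))"
      using koszul_to_front2[OF d, of i "length L + j" "spar V" y] i j LM
      by (simp del: order_sign.simps)
    have s: "set (del i L @ del j M) = set (L @ M) - {L ! i, M ! j}"
    proof -
      have "L ! i \<notin> set M" "M ! j \<notin> set L"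
        using d nth_mem[OF i] nth_mem[OF j] by (auto simp only: distinct_append disjoint_iff)
      then show ?thesis using d i j by (auto simp: set_del)
    qed
    have "distinct (del i L @ del j M)"
      using d i j by (auto simp: set_del distinct_del)
    from contraction_eq[OF _ this s, of V y u] show ?thesis
      unfolding k by (simp add: mult.assoc del: order_sign.simps)
  qed
  have "lin_ext (symmetrize (spar V)) (word_bracket V (map y L) (map y M)) u
    = (\<Sum>i<length L. \<Sum>j<length M. ?s * contraction V y (set (L @ M)) (L ! i) (M ! j) u)"
    unfolding word_bracket_def lin_ext_sum[OF fin_cols_symmetrize]
      lin_ext_of_bool[OF fin_cols_symmetrize] length_map
    by (intro sum.cong refl, subst trm[symmetric]) (simp_all add: map_del)
  also have "\<dots> = (\<Sum>I\<in>set L. \<Sum>J\<in>set M. ?s * contraction V y (set (L @ M)) I J u)"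
    using d by (simp add: sum_set_nth)
  finally show ?thesis by (simp add: sum_distrib_left)
qed

lemma order_sign_Cons_0:
  "order_sign q (0 # map Suc L) = order_sign (\<lambda>k. q (Suc k)) L"
  by (simp add: order_sign_map strict_mono_onI)

text \<open>Both contracted letters have to pass the new first letter. For a pair of opposite
  parities the sign is that of \<open>a\<close>, which is the factor in the recursion of
  \<open>word_Delta\<close>.\<close>

lemma koszul_to_front2_Cons:
  assumes ij: "i < j" "j < length w"
  shows "koszul p (a # w) (to_front2 (Suc (length w)) (Suc i) (Suc j))
    = sg (p a \<and> p (w ! i) \<noteq> p (w ! j)) * (koszul p w (to_front2 (length w) i j) :: 'k::field_char_0)"
proof -
  define R where "R = filter (\<lambda>k. k \<noteq> i \<and> k \<noteq> j) [0..<length w]"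
  let ?q = "\<lambda>k. p ((a # w) ! k)"
  have eq: "to_front2 (Suc (length w)) (Suc i) (Suc j) = [Suc i, Suc j] @ 0 # map Suc R"
    unfolding to_front2_def R_def upt_conv_Cons[OF zero_less_Suc] map_Suc_upt[symmetric]
    by (simp add: filter_map o_def)
  have eq': "to_front2 (length w) i j = i # j # R"
    by (simp add: to_front2_def R_def)
  have d: "distinct ([] @ [Suc i, Suc j] @ 0 # map Suc R)"
    using ij by (auto simp: R_def distinct_map)
  have "koszul p (a # w) (to_front2 (Suc (length w)) (Suc i) (Suc j))
    = (order_sign ?q ([Suc i, Suc j] @ 0 # map Suc R) :: 'k)"
    using d unfolding eq by (intro koszul_order_sign) simp
  also have "\<dots> = sg (?q 0 \<and> word_parity ?q [Suc i, Suc j]) * order_sign ?q (0 # [Suc i, Suc j] @ map Suc R)"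
    using skew_bring[OF skew_order_sign d] unfolding append_Nil by blast
  also have "0 # [Suc i, Suc j] @ map Suc R = 0 # map Suc (to_front2 (length w) i j)"
    by (simp add: eq')
  also have "order_sign ?q \<dots> = (koszul p w (to_front2 (length w) i j) :: 'k)"
    unfolding order_sign_Cons_0 using ij to_front2_perm[of i "length w" j]
    by (subst koszul_order_sign) auto
  finally show ?thesis by simp
qed

lemma sum_Suc_shift:
  "(\<Sum>i<Suc n. \<Sum>j\<in>{i<..<Suc n}. g i j)
    = (\<Sum>j<n. g 0 (Suc j)) + (\<Sum>i<n. \<Sum>j\<in>{i<..<n}. g (Suc i) (Suc j) :: 'k::comm_monoid_add)"
proof -
  have 1: "(\<Sum>j\<in>{i<..<Suc n}. f j) = (\<Sum>j\<in>{i..<n}. f (Suc j))" for i and f :: "nat \<Rightarrow> 'k"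
    by (rule sum.reindex_bij_witness[where i = Suc and j = "\<lambda>j. j - 1"]) auto
  have "{Suc i..<n} = {i<..<n}" for i by auto
  then show ?thesis
    unfolding sum.lessThan_Suc_shift 1 by (simp add: lessThan_atLeast0)
qed

text \<open>What the argument uses of an odd symplectic form, stated for the inverse matrix. The
  symmetry is plain, because the suspension sign and the opposite parities of paired letters turn
  the antisymmetry of the form into it.\<close>

locale odd_pairing =
  fixes V :: "('b, 'k::field_char_0) superspace"
  assumes finite_basis: "finite (sbasis V)"
    and support: "inv_form V a b \<noteq> 0 \<Longrightarrow> a \<in> sbasis V \<and> b \<in> sbasis V"
    and form_odd: "inv_form V a b \<noteq> 0 \<Longrightarrow> spar V a \<noteq> spar V b"
    and symmetric: "inv_form V a b = inv_form V b a"
begin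

text \<open>Letters that pair have opposite parities, so exchanging them at the front costs no
  sign.\<close>

lemma contraction_commute: "contraction V y X I J u = contraction V y X J I u"
proof (cases "inv_form V (y I) (y J) = 0")
  case True
  then have "inv_form V (y J) (y I) = 0" using symmetric by metis
  with True show ?thesis by (simp add: contraction_def)
next
  case False
  then have "spar V (y I) \<noteq> spar V (y J)" by (rule form_odd)
  moreover define R where "R = sorted_list_of_set (X - {I, J})"
  moreover have "{I, J} = {J, I}" by auto
  moreover have "(order_sign (\<lambda>k. spar V (y k)) (I # J # R) :: 'k)
      = sg (spar V (y I) \<and> spar V (y J)) * order_sign (\<lambda>k. spar V (y k)) (J # I # R)"
  proof -
    have "set R \<subseteq> X - {I, J}"
      unfolding R_def by (cases "finite (X - {I, J})") auto
    then have "distinct ([] @ I # J # R)"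
      using calculation(1) by (auto simp: R_def)
    then show ?thesis using order_sign_swap[of I J "[]" R "\<lambda>k. spar V (y k)"] by auto
  qed
  ultimately show ?thesis
    unfolding contraction_def Let_def
    by (auto simp: symmetric[of "y J" "y I"] simp del: order_sign.simps)
qed

text \<open>Unrolled, the recursion brackets every letter with the letters after it, so each pair is
  contracted once. The factor \<open>sg (spar V a)\<close> collected on the way is the sign for
  moving an odd pair past \<open>a\<close>; this is where the oddness of the form enters.\<close>

lemma word_Delta_eq:
  "word_Delta V w u = (\<Sum>i<length w. \<Sum>j\<in>{i<..<length w}.
     koszul (spar V) w (to_front2 (length w) i j) * inv_form V (w ! i) (w ! j)
       * of_bool (u = del i (del j w)))"
proof (induction w arbitrary: u)
  case Nil
  then show ?case by simp
next
  case (Cons a w)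
  let ?t = "\<lambda>w i j u. koszul (spar V) w (to_front2 (length w) i j) * inv_form V (w ! i) (w ! j)
       * of_bool (u = del i (del j w))"
  have 1: "word_bracket V [a] w u = (\<Sum>j<length w. ?t (a # w) 0 (Suc j) u)"
    by (simp add: word_bracket_def del_def)
  have 2: "?t (a # w) (Suc i) (Suc j) u
      = sg (spar V a) * (case u of [] \<Rightarrow> 0 | b # u' \<Rightarrow> of_bool (b = a) * ?t w i j u')"
    if "i < j" "j < length w" for i j
  proof (cases "inv_form V (w ! i) (w ! j) = 0")
    case False
    then have "spar V (w ! i) \<noteq> spar V (w ! j)" by (rule form_odd)
    then show ?thesis
      using koszul_to_front2_Cons[OF that, of "spar V" a]
      by (auto simp: del_def split: list.splits)
  qed (simp split: list.splits)
  have "word_Delta V (a # w) u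
    = sg (spar V a) * (case u of [] \<Rightarrow> 0 | b # u' \<Rightarrow> of_bool (b = a)
        * (\<Sum>i<length w. \<Sum>j\<in>{i<..<length w}. ?t w i j u'))
      + (\<Sum>j<length w. ?t (a # w) 0 (Suc j) u)"
    unfolding word_Delta.simps 1 by (cases u) (simp_all only: Cons.IH list.case)
  also have "sg (spar V a) * (case u of [] \<Rightarrow> 0 | b # u' \<Rightarrow> of_bool (b = a)
        * (\<Sum>i<length w. \<Sum>j\<in>{i<..<length w}. ?t w i j u'))
    = (\<Sum>i<length w. \<Sum>j\<in>{i<..<length w}.
        sg (spar V a) * (case u of [] \<Rightarrow> 0 | b # u' \<Rightarrow> of_bool (b = a) * ?t w i j u'))"
    by (cases u) (simp_all only: list.case sum_distrib_left mult_zero_right sum.neutral_const)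
  also have "\<dots> = (\<Sum>i<length w. \<Sum>j\<in>{i<..<length w}. ?t (a # w) (Suc i) (Suc j) u)"
    by (intro sum.cong refl 2[symmetric]) auto
  finally show ?case
    unfolding list.size(4) add_Suc_right add_0_right
    by (subst sum_Suc_shift) (simp add: add.commute)
qed

lemma symmetrize_word_Delta:
  assumes d: "distinct L"
  shows "lin_ext (symmetrize (spar V)) (word_Delta V (map y L)) u
    = order_sign (\<lambda>k. spar V (y k)) L
      * (\<Sum>i<length L. \<Sum>j\<in>{i<..<length L}. contraction V y (set L) (L ! i) (L ! j) u)" (is "_ = ?s * _")
proof -
  have trm: "koszul (spar V) (map y L) (to_front2 (length L) i j)
      * inv_form V (y (L ! i)) (y (L ! j)) * symmetrize (spar V) (map y (del i (del j L))) u
    = ?s * contraction V y (set L) (L ! i) (L ! j) u"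
    if ij: "i < j" "j < length L" for i j
  proof -
    have i: "i < length (del j L)" "del j L ! i = L ! i"
      using ij by (simp_all add: length_del nth_del)
    have s: "set (del i (del j L)) = set L - {L ! i, L ! j}"
      using d ij i by (auto simp: set_del distinct_del)
    have "distinct (del i (del j L))"
      using d ij i by (simp add: distinct_del)
    from contraction_eq[OF _ this s, of V y u] show ?thesis
      unfolding koszul_to_front2[OF d ij] by (simp add: mult.assoc del: order_sign.simps)
  qed
  have "word_Delta V (map y L) = (\<lambda>u. \<Sum>i<length L. \<Sum>j\<in>{i<..<length L}.
     koszul (spar V) (map y L) (to_front2 (length L) i j) * inv_form V (map y L ! i) (map y L ! j)
       * of_bool (u = map y (del i (del j L))))"
    unfolding word_Delta_eq fun_eq_iff by (simp add: map_del)
  then have "lin_ext (symmetrize (spar V)) (word_Delta V (map y L)) u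
    = (\<Sum>i<length L. \<Sum>j\<in>{i<..<length L}. ?s * contraction V y (set L) (L ! i) (L ! j) u)"
    by (simp only: lin_ext_sum[OF fin_cols_symmetrize] lin_ext_of_bool[OF fin_cols_symmetrize])
      (intro sum.cong refl, subst trm[symmetric], simp_all)
  then show ?thesis by (simp add: sum_distrib_left)
qed

end

text \<open>Pairs with \<open>i < j\<close> refer to the order of the list, half the sum over all
  ordered pairs refers to its set only. This removes the order of the letters from the contractions
  in \<open>\<Delta>\<close>.\<close>

lemma sum_pairs_symmetric:
  fixes c :: "nat \<Rightarrow> nat \<Rightarrow> 'k::field_char_0"
  assumes "\<And>I J. c I J = c J I"
  shows "distinct L \<Longrightarrow> (\<Sum>i<length L. \<Sum>j\<in>{i<..<length L}. c (L ! i) (L ! j))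
    = (\<Sum>I\<in>set L. \<Sum>J\<in>set L - {I}. c I J) / 2"
proof (induction L)
  case (Cons a L)
  have "(\<Sum>J\<in>insert a (set L) - {I}. c I J) = c a I + (\<Sum>J\<in>set L - {I}. c I J)" if "I \<in> set L" for I
  proof -
    have "insert a (set L) - {I} = insert a (set L - {I})" "a \<notin> set L - {I}"
      using Cons.prems that by auto
    then show ?thesis by (simp add: assms[of I a])
  qed
  then have "(\<Sum>I\<in>set (a # L). \<Sum>J\<in>set (a # L) - {I}. c I J)
    = 2 * (\<Sum>J\<in>set L. c a J) + (\<Sum>I\<in>set L. \<Sum>J\<in>set L - {I}. c I J)"
    using Cons.prems by (simp add: sum.distrib)
  moreover have "(\<Sum>i<length (a # L). \<Sum>j\<in>{i<..<length (a # L)}. c ((a # L) ! i) ((a # L) ! j))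
    = (\<Sum>J\<in>set L. c a J) + (\<Sum>i<length L. \<Sum>j\<in>{i<..<length L}. c (L ! i) (L ! j))"
    using Cons.prems unfolding list.size(4) add_Suc_right add_0_right
    by (subst sum_Suc_shift) (simp add: sum_set_nth)
  ultimately show ?case using Cons by (simp add: add_divide_distrib)
qed simp

section \<open>The operators of the commutative side\<close>

lemma lin_ext_nz: "lin_ext T f u \<noteq> 0 \<Longrightarrow> \<exists>w. f w \<noteq> 0 \<and> T w u \<noteq> 0"
  unfolding lin_ext_def by (auto elim!: Sum_any.not_neutral_obtains_not_neutral)

lemma bilin_ext_nz: "bilin_ext T f g u \<noteq> 0 \<Longrightarrow> \<exists>w v. f w \<noteq> 0 \<and> g v \<noteq> 0 \<and> T w v u \<noteq> 0"
  unfolding bilin_ext_lin_ext_pair by (drule lin_ext_nz) fastforce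

context odd_pairing
begin

text \<open>A contraction removes two letters, and letters that pair lie in the finite basis. Hence
  a given result has finitely many sources, even if the type of letters is infinite.\<close>

lemma word_bracket_nz:
  assumes "word_bracket V a b u \<noteq> 0"
  shows "set a \<union> set b \<subseteq> set u \<union> sbasis V" "length a + length b = length u + 2"
    "set u \<subseteq> set a \<union> set b"
proof -
  obtain i where i: "i < length a" and nz: "(\<Sum>j<length b.
       koszul (spar V) (a @ b) (to_front2 (length a + length b) i (length a + j))
       * inv_form V (a ! i) (b ! j) * of_bool (u = del i a @ del j b)) \<noteq> 0"
    using assms unfolding word_bracket_def by (rule sum.not_neutral_contains_not_neutral) (rule that, simp_all only: lessThan_iff)
  from nz obtain j where j: "j < length b" and
    *: "koszul (spar V) (a @ b) (to_front2 (length a + length b) i (length a + j))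
       * inv_form V (a ! i) (b ! j) * of_bool (u = del i a @ del j b) \<noteq> 0"
    by (rule sum.not_neutral_contains_not_neutral) (rule that, simp_all only: lessThan_iff greaterThanLessThan_iff)
  then have u: "u = del i a @ del j b" and "inv_form V (a ! i) (b ! j) \<noteq> 0" by auto
  then have "a ! i \<in> sbasis V" "b ! j \<in> sbasis V" using support by auto
  then show "set a \<union> set b \<subseteq> set u \<union> sbasis V"
    unfolding u using set_insert_del[OF i] set_insert_del[OF j] by auto
  show "length a + length b = length u + 2"
    using i j by (simp add: u length_del)
  show "set u \<subseteq> set a \<union> set b"
    unfolding u using set_insert_del[OF i] set_insert_del[OF j] by auto
qed

lemma word_Delta_nz:
  assumes "word_Delta V w u \<noteq> 0"
  shows "set w \<subseteq> set u \<union> sbasis V" "length w = length u + 2" "set u \<subseteq> set w"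
proof -
  obtain i where i: "i < length w" and nz: "(\<Sum>j\<in>{i<..<length w}.
     koszul (spar V) w (to_front2 (length w) i j) * inv_form V (w ! i) (w ! j)
       * of_bool (u = del i (del j w))) \<noteq> 0"
    using assms unfolding word_Delta_eq by (rule sum.not_neutral_contains_not_neutral) (rule that, simp_all only: lessThan_iff)
  from nz obtain j where j: "i < j" "j < length w" and
    *: "koszul (spar V) w (to_front2 (length w) i j) * inv_form V (w ! i) (w ! j)
       * of_bool (u = del i (del j w)) \<noteq> 0"
    by (rule sum.not_neutral_contains_not_neutral) (rule that, simp_all only: lessThan_iff greaterThanLessThan_iff)
  then have u: "u = del i (del j w)" and "inv_form V (w ! i) (w ! j) \<noteq> 0" by auto
  then have s: "w ! i \<in> sbasis V" "w ! j \<in> sbasis V" using support by auto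
  have i': "i < length (del j w)" "del j w ! i = w ! i"
    using j by (simp_all add: length_del nth_del)
  then have w: "set w = insert (w ! j) (insert (w ! i) (set u))"
    using set_insert_del[OF j(2)] set_insert_del[OF i'(1)] by (simp add: u)
  then show "set w \<subseteq> set u \<union> sbasis V" "set u \<subseteq> set w" using s by auto
  show "length w = length u + 2"
    using i' j by (simp add: u length_del)
qed

lemma fin_cols_hbar_Delta: "fin_cols (hbar_Delta_mon V)"
proof (rule fin_colsI[where X = "\<lambda>(d, u). {..d} \<times> {w. set w \<subseteq> set u \<union> sbasis V \<and> length w = length u + 2}"])
  fix x :: "nat \<times> 'b list"
  show "finite (case x of (d, u) \<Rightarrow> {..d} \<times> {w. set w \<subseteq> set u \<union> sbasis V \<and> length w = length u + 2})"
    using finite_basis by (cases x) (auto intro!: finite_cartesian_product finite_lists_length_eq)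
  fix z assume "hbar_Delta_mon V z x \<noteq> 0"
  then show "z \<in> (case x of (d, u) \<Rightarrow> {..d} \<times> {w. set w \<subseteq> set u \<union> sbasis V \<and> length w = length u + 2})"
    by (cases x; cases z) (auto dest: word_Delta_nz split: if_splits)
qed

lemma fin_cols_com_bracket: "fin_cols2 (com_bracket_mon V)"
proof (rule fin_colsI[where X = "\<lambda>(d, u). ({..d} \<times> {w. set w \<subseteq> set u \<union> sbasis V \<and> length w \<le> length u + 2})
    \<times> ({..d} \<times> {w. set w \<subseteq> set u \<union> sbasis V \<and> length w \<le> length u + 2})"])
  fix x :: "nat \<times> 'b list"
  show "finite (case x of (d, u) \<Rightarrow> ({..d} \<times> {w. set w \<subseteq> set u \<union> sbasis V \<and> length w \<le> length u + 2})
    \<times> ({..d} \<times> {w. set w \<subseteq> set u \<union> sbasis V \<and> length w \<le> length u + 2}))"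
    using finite_basis by (cases x) (auto intro!: finite_cartesian_product finite_lists_length_le)
  fix z assume *: "(case z of (w, v) \<Rightarrow> com_bracket_mon V w v) x \<noteq> 0"
  obtain d u where x: "x = (d, u)" by (cases x)
  obtain e w e' v where z: "z = ((e, w), (e', v))" by (metis surj_pair)
  have "d = e + e'" and nz: "word_bracket V w v u \<noteq> 0" using * by (auto simp: x z split: if_splits)
  then show "z \<in> (case x of (d, u) \<Rightarrow> ({..d} \<times> {w. set w \<subseteq> set u \<union> sbasis V \<and> length w \<le> length u + 2})
    \<times> ({..d} \<times> {w. set w \<subseteq> set u \<union> sbasis V \<and> length w \<le> length u + 2}))"
    using word_bracket_nz(1,2)[OF nz] by (simp add: x z)
qed

lemma sym_hbar_Delta:
  "lin_ext (com_sym (spar V)) (hbar_Delta_mon V (e, w)) (d, u)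
    = of_bool (d = Suc e) * lin_ext (symmetrize (spar V)) (word_Delta V w) u"
  unfolding lin_ext_com_sym hbar_Delta_mon.simps lin_ext_scale[OF fin_cols_symmetrize] ..

lemma sym_com_bracket:
  "lin_ext (com_sym (spar V)) (com_bracket_mon V (e, w) (e', v)) (d, u)
    = of_bool (d = e + e') * lin_ext (symmetrize (spar V)) (word_bracket V w v) u"
  unfolding lin_ext_com_sym com_bracket_mon.simps lin_ext_scale[OF fin_cols_symmetrize] ..

text \<open>By \<open>sum_pairs_symmetric\<close> both sides are a sorting sign times the same sum
  over a set of positions; the quotient of the two signs is \<open>koszul\<close>.\<close>

lemma symmetrize_Delta_perm:
  assumes js: "js \<in> permutations_of_set {..<length w}"
  shows "lin_ext (symmetrize (spar V)) (word_Delta V w) u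
    = koszul (spar V) w js * lin_ext (symmetrize (spar V)) (word_Delta V (map ((!) w) js)) u"
proof -
  have d: "distinct js" and s: "set js = set [0..<length w]"
    using js by (simp_all add: permutations_of_set_def lessThan_atLeast0)
  have "lin_ext (symmetrize (spar V)) (word_Delta V w) u
    = (\<Sum>I\<in>set js. \<Sum>J\<in>set js - {I}. contraction V ((!) w) (set js) I J u) / 2"
    using symmetrize_word_Delta[of "[0..<length w]" "(!) w" u]
      sum_pairs_symmetric[of "\<lambda>I J. contraction V ((!) w) (set js) I J u" "[0..<length w]", OF contraction_commute]
    unfolding s map_nth by simp
  moreover have "lin_ext (symmetrize (spar V)) (word_Delta V (map ((!) w) js)) u
    = koszul (spar V) w js * ((\<Sum>I\<in>set js. \<Sum>J\<in>set js - {I}. contraction V ((!) w) (set js) I J u) / 2)"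
    using symmetrize_word_Delta[OF d, of "(!) w" u]
      sum_pairs_symmetric[of "\<lambda>I J. contraction V ((!) w) (set js) I J u" js, OF contraction_commute d]
    unfolding koszul_order_sign[OF d] by simp
  ultimately show ?thesis unfolding koszul_order_sign[OF d] by (simp only: order_sign_square)
qed

text \<open>The claims permute the first and the second argument. The letters of both arguments are
  numbered consecutively, and only the sorting sign in front of the double sum of contractions
  changes.\<close>

lemma symmetrize_bracket_perm:
  assumes js: "js \<in> permutations_of_set {..<length w}"
  shows "lin_ext (symmetrize (spar V)) (word_bracket V w v) u
    = koszul (spar V) w js * lin_ext (symmetrize (spar V)) (word_bracket V (map ((!) w) js) v) u"
    and "lin_ext (symmetrize (spar V)) (word_bracket V v w) u
    = koszul (spar V) w js * lin_ext (symmetrize (spar V)) (word_bracket V v (map ((!) w) js)) u"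
proof -
  have d: "distinct js" and s: "set js = set [0..<length w]"
    using js by (simp_all add: permutations_of_set_def lessThan_atLeast0)
  have nth_js: "map ((!) [0..<length w]) js = js"
    using s by (auto intro!: map_idI)
  let ?n = "length w" and ?k = "length v"
  have up: "map ((!) (a @ b)) [0..<length a] = a"
    "map ((!) (a @ b)) [length a..<length a + length b] = b" for a b :: "'b list"
    by (auto intro: nth_equalityI simp: nth_append)
  {
    let ?y = "(!) (w @ v)" and ?L = "[0..<?n]" and ?M = "[?n..<?n + ?k]"
    have sj: "set (js @ ?M) = set (?L @ ?M)" "distinct (js @ ?M)" "distinct (?L @ ?M)"
      using s d by auto
    have m: "map ?y js = map ((!) w) js" using s by (auto simp: nth_append)
    have "lin_ext (symmetrize (spar V)) (word_bracket V (map ((!) w) js) v) u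
      = order_sign (\<lambda>k. spar V (?y k)) (js @ ?M)
        * (\<Sum>I\<in>set ?L. \<Sum>J\<in>set ?M. contraction V ?y (set (?L @ ?M)) I J u)"
      using symmetrize_word_bracket[OF sj(2), of V ?y u] unfolding sj(1) s up m .
    moreover have "lin_ext (symmetrize (spar V)) (word_bracket V w v) u
      = order_sign (\<lambda>k. spar V (?y k)) (?L @ ?M)
        * (\<Sum>I\<in>set ?L. \<Sum>J\<in>set ?M. contraction V ?y (set (?L @ ?M)) I J u)"
      using symmetrize_word_bracket[OF sj(3), of V ?y u] unfolding up .
    moreover have "(order_sign (\<lambda>k. spar V (?y k)) ([] @ ?L @ ?M) :: 'k)
      = koszul (spar V) (map ?y ?L) js * order_sign (\<lambda>k. spar V (?y k)) ([] @ map ((!) ?L) js @ ?M)"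
      using d s by (intro skew_koszul_infix[OF skew_order_sign]) (auto simp: lessThan_atLeast0)
    ultimately show "lin_ext (symmetrize (spar V)) (word_bracket V w v) u
    = koszul (spar V) w js * lin_ext (symmetrize (spar V)) (word_bracket V (map ((!) w) js) v) u"
      by (simp only: nth_js up append_Nil mult.assoc)
  next
    let ?y = "(!) (v @ w)" and ?L = "[0..<?k]" and ?M = "[?k..<?k + ?n]"
    \<comment> \<open>The permuted word comes second here, so its positions start at
      \<open>?k\<close>.\<close>
    define js' where "js' = map ((!) ?M) js"
    have js': "js' = map ((+) ?k) js" using s by (auto simp: js'_def)
    have "set js' = (+) ?k ` {0..<?n}" using s by (simp add: js')
    then have s': "set js' = set ?M" by (simp add: image_add_atLeastLessThan add.commute)
    have d': "distinct js'" using d by (simp add: js' distinct_map)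
    have sj: "set (?L @ js') = set (?L @ ?M)" "distinct (?L @ js')" "distinct (?L @ ?M)"
      using s' d' by auto
    have m: "map ?y js' = map ((!) w) js" using s by (auto simp: js' nth_append)
    have "lin_ext (symmetrize (spar V)) (word_bracket V v (map ((!) w) js)) u
      = order_sign (\<lambda>k. spar V (?y k)) (?L @ js')
        * (\<Sum>I\<in>set ?L. \<Sum>J\<in>set ?M. contraction V ?y (set (?L @ ?M)) I J u)"
      using symmetrize_word_bracket[OF sj(2), of V ?y u] unfolding sj(1) s' up m .
    moreover have "lin_ext (symmetrize (spar V)) (word_bracket V v w) u
      = order_sign (\<lambda>k. spar V (?y k)) (?L @ ?M)
        * (\<Sum>I\<in>set ?L. \<Sum>J\<in>set ?M. contraction V ?y (set (?L @ ?M)) I J u)"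
      using symmetrize_word_bracket[OF sj(3), of V ?y u] unfolding up .
    moreover have "(order_sign (\<lambda>k. spar V (?y k)) (?L @ ?M @ []) :: 'k)
      = koszul (spar V) (map ?y ?M) js * order_sign (\<lambda>k. spar V (?y k)) (?L @ js' @ [])"
      unfolding js'_def using d s
      by (intro skew_koszul_infix[OF skew_order_sign]) (auto simp: lessThan_atLeast0)
    ultimately show "lin_ext (symmetrize (spar V)) (word_bracket V v w) u
    = koszul (spar V) w js * lin_ext (symmetrize (spar V)) (word_bracket V v (map ((!) w) js)) u"
      by (simp only: up append_Nil2 mult.assoc)
  }
qed

lemma com_relations_cases:
  assumes "r \<in> com_relations V"
  obtains e w js where "r = single (e, w) - (\<lambda>x. koszul (spar V) w js * single (e, map ((!) w) js) x)"
    "js \<in> permutations_of_set {..<length w}"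
  using assms unfolding com_relations_def by auto

lemma hbar_Delta_cong:
  assumes "(f, g) \<in> com_eq V"
  shows "lin_ext (com_sym (spar V)) (lin_ext (hbar_Delta_mon V) f)
    = lin_ext (com_sym (spar V)) (lin_ext (hbar_Delta_mon V) g)"
  unfolding lin_ext_lin_ext[OF fin_cols_hbar_Delta fin_cols_com_sym]
proof (rule lin_ext_eq_mod[OF fin_cols_lin_ext[OF fin_cols_hbar_Delta fin_cols_com_sym]])
  show "(f, g) \<in> eq_mod (com_series V) (degreewise_span (\<lambda>(e, w). (e, length w)) (com_relations V))"
    using assms by (simp add: com_eq_def)
  fix r assume "r \<in> com_relations V"
  then show "lin_ext (\<lambda>w. lin_ext (com_sym (spar V)) (hbar_Delta_mon V w)) r = (\<lambda>_. 0)"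
  proof (cases rule: com_relations_cases)
    case (1 e w js)
    show ?thesis unfolding 1(1)
    proof (rule lin_ext_relation[OF fin_cols_lin_ext[OF fin_cols_hbar_Delta fin_cols_com_sym]])
      fix x show "lin_ext (com_sym (spar V)) (hbar_Delta_mon V (e, w)) x
        = koszul (spar V) w js * lin_ext (com_sym (spar V)) (hbar_Delta_mon V (e, map ((!) w) js)) x"
        using symmetrize_Delta_perm[OF 1(2), of "snd x"]
        by (cases x) (simp only: sym_hbar_Delta mult.left_commute snd_conv)
    qed
  qed
qed

text \<open>It suffices that each argument may be replaced while the other is held at a monomial;
  the two iterated forms of the bilinear extension then exchange \<open>f\<close> and
  \<open>g\<close> in turn.\<close>

lemma com_bracket_cong:
  assumes fg: "(f, f') \<in> com_eq V" "(g, g') \<in> com_eq V"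
  shows "lin_ext (com_sym (spar V)) (bilin_ext (com_bracket_mon V) f g)
    = lin_ext (com_sym (spar V)) (bilin_ext (com_bracket_mon V) f' g')"
proof -
  define T where "T = (\<lambda>w v. lin_ext (com_sym (spar V)) (com_bracket_mon V w v))"
  have T: "fin_cols2 T"
    unfolding T_def by (rule fin_cols2_lin_ext[OF fin_cols_com_bracket fin_cols_com_sym])
  have eq: "(f, f') \<in> eq_mod (com_series V) (degreewise_span (\<lambda>(e, w). (e, length w)) (com_relations V))"
     "(g, g') \<in> eq_mod (com_series V) (degreewise_span (\<lambda>(e, w). (e, length w)) (com_relations V))"
    using fg by (simp_all add: com_eq_def)
  have left: "lin_ext (\<lambda>w. T w v) f = lin_ext (\<lambda>w. T w v) f'" for v
  proof (rule lin_ext_eq_mod[OF fin_cols_left[OF T] _ eq(1)])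
    fix r assume "r \<in> com_relations V"
    then show "lin_ext (\<lambda>w. T w v) r = (\<lambda>_. 0)"
    proof (cases rule: com_relations_cases)
      case (1 e w js)
      show ?thesis unfolding 1(1)
      proof (rule lin_ext_relation[OF fin_cols_left[OF T]])
        fix x show "T (e, w) v x = koszul (spar V) w js * T (e, map ((!) w) js) v x"
          using symmetrize_bracket_perm(1)[OF 1(2), of "snd v" "snd x"]
          by (cases x; cases v) (simp only: T_def sym_com_bracket mult.left_commute snd_conv)
      qed
    qed
  qed
  have right: "lin_ext (T v) g = lin_ext (T v) g'" for v
  proof (rule lin_ext_eq_mod[OF fin_cols_right[OF T] _ eq(2)])
    fix r assume "r \<in> com_relations V"
    then show "lin_ext (T v) r = (\<lambda>_. 0)"
    proof (cases rule: com_relations_cases)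
      case (1 e w js)
      show ?thesis unfolding 1(1)
      proof (rule lin_ext_relation[OF fin_cols_right[OF T]])
        fix x show "T v (e, w) x = koszul (spar V) w js * T v (e, map ((!) w) js) x"
          using symmetrize_bracket_perm(2)[OF 1(2), of "snd v" "snd x"]
          by (cases x; cases v) (simp only: T_def sym_com_bracket mult.left_commute snd_conv)
      qed
    qed
  qed
  have "bilin_ext T f g = bilin_ext T f' g" unfolding bilin_ext_left[OF T] left ..
  also have "\<dots> = bilin_ext T f' g'" unfolding bilin_ext_right[OF T] right ..
  finally show ?thesis
    unfolding lin_ext_bilin_ext[OF fin_cols_com_bracket fin_cols_com_sym] T_def .
qed

lemma hbar_Delta_series: "f \<in> com_series V \<Longrightarrow> lin_ext (hbar_Delta_mon V) f \<in> com_series V"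
  unfolding com_series_def
proof (intro CollectI allI impI)
  fix d u assume f: "f \<in> {f. \<forall>e w. f (e, w) \<noteq> 0 \<longrightarrow> w \<in> lists (sbasis V)}"
    and "lin_ext (hbar_Delta_mon V) f (d, u) \<noteq> 0"
  then obtain e w where "f (e, w) \<noteq> 0" "word_Delta V w u \<noteq> 0"
    by (auto dest!: lin_ext_nz split: if_splits)
  then show "u \<in> lists (sbasis V)" using f word_Delta_nz(3) by (auto simp: lists_eq_set subset_iff)
qed

lemma com_bracket_series:
  assumes "f \<in> com_series V" "g \<in> com_series V"
  shows "bilin_ext (com_bracket_mon V) f g \<in> com_series V"
  unfolding com_series_def
proof (intro CollectI allI impI)
  fix d u assume "bilin_ext (com_bracket_mon V) f g (d, u) \<noteq> 0"
  then obtain e w e' v where nz: "f (e, w) \<noteq> 0" "g (e', v) \<noteq> 0" "word_bracket V w v u \<noteq> 0"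
    by (auto dest!: bilin_ext_nz split: if_splits)
  then have "w \<in> lists (sbasis V)" "v \<in> lists (sbasis V)"
    using assms by (auto simp: com_series_def)
  then show "u \<in> lists (sbasis V)"
    using word_bracket_nz(3)[OF nz(3)] by (auto simp: lists_eq_set)
qed

lemma com_class_eq:
  assumes "f \<in> com_series V" "g \<in> com_series V"
    and "lin_ext (com_sym (spar V)) f = lin_ext (com_sym (spar V)) g"
  shows "com_eq V `` {f} = com_eq V `` {g}"
  using assms by (auto simp: com_eq_iff[OF finite_basis])

lemma com_class_mem:
  "f \<in> com_series V \<Longrightarrow> f \<in> com_eq V `` {f}"
  by (simp add: com_eq_iff[OF finite_basis])

text \<open>\<open>descend\<close> is the union, over all representatives, of the classes of their
  images. These classes agree, so the union collapses to the class of one image.\<close>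

lemma hbar_Delta_class:
  assumes f: "f \<in> com_series V"
  shows "hbar_Delta V (com_eq V `` {f}) = com_eq V `` {lin_ext (hbar_Delta_mon V) f}"
proof -
  have "com_eq V `` {lin_ext (hbar_Delta_mon V) g} = com_eq V `` {lin_ext (hbar_Delta_mon V) f}"
    if "g \<in> com_eq V `` {f}" for g
  proof (rule com_class_eq)
    have "(f, g) \<in> com_eq V" using that by simp
    then show "lin_ext (com_sym (spar V)) (lin_ext (hbar_Delta_mon V) g)
        = lin_ext (com_sym (spar V)) (lin_ext (hbar_Delta_mon V) f)"
      and "lin_ext (hbar_Delta_mon V) g \<in> com_series V" "lin_ext (hbar_Delta_mon V) f \<in> com_series V"
      using hbar_Delta_cong f by (auto simp: com_eq_iff[OF finite_basis] hbar_Delta_series)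
  qed
  then show ?thesis
    using com_class_mem[OF f] unfolding hbar_Delta_def descend_def by blast
qed

lemma com_bracket_class:
  assumes f: "f \<in> com_series V" and g: "g \<in> com_series V"
  shows "com_bracket V (com_eq V `` {f}) (com_eq V `` {g})
    = com_eq V `` {bilin_ext (com_bracket_mon V) f g}"
proof -
  have "com_eq V `` {bilin_ext (com_bracket_mon V) f' g'} = com_eq V `` {bilin_ext (com_bracket_mon V) f g}"
    if "f' \<in> com_eq V `` {f}" "g' \<in> com_eq V `` {g}" for f' g'
  proof (rule com_class_eq)
    have "(f, f') \<in> com_eq V" "(g, g') \<in> com_eq V" using that by simp_all
    then show "lin_ext (com_sym (spar V)) (bilin_ext (com_bracket_mon V) f' g')
        = lin_ext (com_sym (spar V)) (bilin_ext (com_bracket_mon V) f g)"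
      and "bilin_ext (com_bracket_mon V) f' g' \<in> com_series V" "bilin_ext (com_bracket_mon V) f g \<in> com_series V"
      using com_bracket_cong[of f f' g g'] f g
      by (auto simp: com_eq_iff[OF finite_basis] com_bracket_series)
  qed
  then show ?thesis
    using com_class_mem[OF f] com_class_mem[OF g] unfolding com_bracket_def descend2_def by blast
qed

end

section \<open>Traces of products of matrix units\<close>

lemma matrix_product_simps [simp]:
  "matrix_product [] = mat 1"
  "matrix_product (a # l) = matrix_unit a ** matrix_product l"
  by (simp_all add: matrix_product_def)

lemma matrix_product_append:
  "matrix_product (l @ l') = matrix_product l ** (matrix_product l' :: 'k::field_char_0 ^ 'n::finite ^ 'n)"
  by (induction l) (simp_all add: matrix_mul_assoc)

lemma trace_matrix_product_swap:
  "trace (matrix_product (l @ l') :: 'k::field_char_0 ^ 'n::finite ^ 'n) = trace (matrix_product (l' @ l))"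
  unfolding matrix_product_append by (rule trace_mul_sym)

lemma matrix_unit_mult: "(matrix_unit (k, l) ** A) $ r $ s = of_bool (r = k) * (A $ l $ s)"
  by (simp add: matrix_unit_def matrix_matrix_mult_def of_bool_def if_distrib[where f = "\<lambda>x. x * _"]
      cong: if_cong conj_cong)

lemma trace_matrix_unit: "trace (matrix_unit (k, l) ** A) = A $ l $ k"
  by (simp add: trace_def matrix_unit_mult)

text \<open>Tr(E_kl A) = A_lk and Tr(E_lk B) = B_kl: summing over the dual bases E_kl and E_lk of
  the trace form fuses two traces into one.\<close>

lemma sum_trace_join:
  "(\<Sum>k\<in>UNIV. \<Sum>l\<in>UNIV. trace (matrix_unit (k, l) ** A) * trace (matrix_unit (l, k) ** B))
    = trace (A ** (B :: 'k::field_char_0 ^ 'n::finite ^ 'n))"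
  unfolding trace_matrix_unit by (subst sum.swap) (simp add: trace_def matrix_matrix_mult_def)

text \<open>The entry picked out is A_ll B_kk: inserted into a single trace, the same dual bases cut
  it in two.\<close>

lemma sum_trace_split:
  "(\<Sum>k\<in>UNIV. \<Sum>l\<in>UNIV. trace (matrix_unit (k, l) ** (A ** (matrix_unit (l, k) ** B))))
    = trace A * trace (B :: 'k::field_char_0 ^ 'n::finite ^ 'n)"
proof -
  have "(A ** (matrix_unit (l, k) ** B)) $ l $ k = A $ l $ l * (B $ k $ k)" for k l
    unfolding matrix_matrix_mult_def[of A]
    by (simp add: matrix_unit_mult of_bool_def if_distrib[where f = "\<lambda>x. x * _"]
        if_distrib[where f = "\<lambda>x. _ * x"] cong: if_cong)
  then show ?thesis
    unfolding trace_matrix_unit by (simp add: trace_def sum_product) (rule sum.swap)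
qed

section \<open>Labelled words\<close>

text \<open>Functions that are \<open>undefined\<close> off \<open>X\<close>, so that a finite
  \<open>X\<close> has finitely many labellings and each is counted once.\<close>

abbreviation labels :: "nat set \<Rightarrow> (nat \<Rightarrow> 'n \<times> 'n) set"
  where "labels X \<equiv> PiE X (\<lambda>_. UNIV)"

definition labelled :: "(nat \<Rightarrow> 'b) \<Rightarrow> (nat \<Rightarrow> 'n \<times> 'n) \<Rightarrow> nat \<Rightarrow> 'b \<times> 'n \<times> 'n"
  where "labelled x p k = (x k, p k)"

lemma labelled_simps [simp]: "fst (labelled x p k) = x k" "snd (labelled x p k) = p k"
  by (simp_all add: labelled_def)

text \<open>The coefficient of the labelling \<open>p\<close> in the image of a product of cyclic
  words under the matrix map. Each entry of \<open>poss\<close> lists the positions of one word; an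
  empty entry contributes Tr(1) = N.\<close>

definition trace_weight :: "(nat \<Rightarrow> 'n::finite \<times> 'n) \<Rightarrow> nat list list \<Rightarrow> 'k::field_char_0"
  where "trace_weight p poss = (\<Prod>c\<leftarrow>poss. trace (matrix_product (map p c) :: 'k ^ 'n ^ 'n))"

lemma trace_weight_simps [simp]:
  "trace_weight p [] = 1"
  "trace_weight p (c # poss) = trace (matrix_product (map p c) :: 'k::field_char_0 ^ 'n::finite ^ 'n) * trace_weight p poss"
  "trace_weight p (poss @ poss') = trace_weight p poss * trace_weight p poss'"
  by (simp_all add: trace_weight_def)

lemma trace_weight_cong:
  "(\<And>k. k \<in> set (concat poss) \<Longrightarrow> p k = p' k) \<Longrightarrow> trace_weight p poss = trace_weight p' poss"
  by (induction poss) (auto cong: map_cong)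

lemma sum_labels_insert:
  assumes "I \<notin> X"
  shows "(\<Sum>p\<in>labels (insert I X). F p) = (\<Sum>a\<in>UNIV. \<Sum>p\<in>labels X. F (p(I := a)) :: 'k::comm_monoid_add)"
proof -
  have "(\<Sum>p\<in>labels (insert I X). F p) = (\<Sum>z\<in>UNIV \<times> labels X. F (case z of (a, p) \<Rightarrow> p(I := a)))"
    unfolding PiE_insert_eq by (subst sum.reindex[OF inj_combinator[OF assms]]) simp
  then show ?thesis by (simp add: sum.cartesian_product case_prod_unfold)
qed

lemma finite_labels: "finite X \<Longrightarrow> finite (labels X :: (nat \<Rightarrow> 'n::finite \<times> 'n) set)"
  by (simp add: finite_PiE)

text \<open>Labelled words over given words amount to a choice of one label at every position;
  distinctness of the positions makes this choice a function.\<close>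

lemma labels_bij:
  fixes x :: "nat \<Rightarrow> 'b"
  assumes d: "distinct (concat poss)"
  shows "bij_betw (\<lambda>p :: nat \<Rightarrow> 'n \<times> 'n. map (map (labelled x p)) poss) (labels (set (concat poss)))
    {us. map (map fst) us = map (map x) poss}"
proof (rule bij_betw_imageI)
  let ?f = "\<lambda>p :: nat \<Rightarrow> 'n \<times> 'n. map (map (labelled x p)) poss" and ?X = "set (concat poss)"
  show "inj_on ?f (labels ?X)"
  proof (rule inj_onI)
    fix p p' :: "nat \<Rightarrow> 'n \<times> 'n" assume p: "p \<in> labels ?X" "p' \<in> labels ?X" and "?f p = ?f p'"
    then have "map (labelled x p) (concat poss) = map (labelled x p') (concat poss)"
      by (metis map_concat)
    then have "p k = p' k" if "k \<in> ?X" for k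
      using that unfolding map_eq_conv by (metis labelled_simps(2))
    then show "p = p'" using p by (intro PiE_ext)
  qed
  show "?f ` labels ?X = {us. map (map fst) us = map (map x) poss}"
  proof (intro equalityI subsetI)
    fix us assume "us \<in> ?f ` labels ?X"
    then show "us \<in> {us. map (map fst) us = map (map x) poss}" by (auto simp: o_def)
  next
    fix us :: "('b \<times> 'n \<times> 'n) list list"
    assume "us \<in> {us. map (map fst) us = map (map x) poss}"
    then have us: "map (map fst) us = map (map x) poss" by simp
    define K U where "K = concat poss" and "U = concat us"
    have fstU: "map fst U = map x K"
      using arg_cong[OF us, of concat] by (simp add: K_def U_def map_concat)
    then have len: "length K = length U" by (metis length_map)
    \<comment> \<open>The label at a position is looked up in the list \<open>U\<close> of labelled
      letters; the restriction makes \<open>p\<close> extensional.\<close>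
    define p where "p = restrict (\<lambda>k. snd (the (map_of (zip K U) k))) (set K)"
    have "map (labelled x p) K = U"
    proof (rule nth_equalityI)
      fix k assume "k < length (map (labelled x p) K)"
      then have k: "k < length U" using len by simp
      have "map_of (zip K U) (K ! k) = Some (U ! k)"
        using map_of_zip_nth[OF len d[folded K_def] k] .
      then have "p (K ! k) = snd (U ! k)" using k len by (simp add: p_def)
      moreover have "x (K ! k) = fst (U ! k)" using fstU k len by (metis nth_map)
      ultimately show "map (labelled x p) K ! k = U ! k"
        using k len by (simp add: labelled_def)
    qed (simp add: len)
    then have "concat (?f p) = concat us" by (simp add: K_def U_def map_concat)
    moreover have "map length us = map length poss"
      using arg_cong[OF us, of "map length"] by (simp add: o_def)
    then have "length (?f p) = length us" "\<And>k. k < length us \<Longrightarrow> length (?f p ! k) = length (us ! k)"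
      by (metis length_map) (metis (no_types, lifting) length_map nth_map \<open>map length us = map length poss\<close>)
    ultimately have "?f p = us"
      by (intro concat_injective) (auto simp: set_zip)
    moreover have "p \<in> labels ?X" by (simp add: p_def K_def)
    ultimately show "us \<in> ?f ` labels ?X" by blast
  qed
qed

lemma morita_mon_eq:
  "morita_mon (i, ws) (k, us) = of_bool (k = i \<and> map (map fst) us = ws)
    * (\<Prod>c\<leftarrow>us. trace (matrix_product (map snd c) :: 'k::field_char_0 ^ 'n::finite ^ 'n))"
proof (cases "map (map fst) us = ws")
  case True
  then have "length us = length ws" by auto
  moreover have "morita_word (ws ! r) (us ! r) = trace (matrix_product (map snd (us ! r)) :: 'k ^ 'n ^ 'n)"
    if "r < length us" for r
    using that True by (auto simp: morita_word_def)
  ultimately show ?thesis using True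
    by (simp add: prod.list_conv_set_nth lessThan_atLeast0)
next
  case False
  have "(\<Prod>r<length ws. morita_word (ws ! r) (us ! r)) = (0 :: 'k)" if len: "length us = length ws"
  proof -
    obtain r where "r < length ws" "map (map fst) us ! r \<noteq> ws ! r"
      using False len by (metis length_map nth_equalityI)
    then have "r < length ws \<and> morita_word (ws ! r) (us ! r) = (0 :: 'k)"
      using len by (simp add: morita_word_def)
    then show ?thesis by (intro prod_zero) auto
  qed
  then show ?thesis using False by auto
qed

text \<open>Sums over labelled words become sums over labellings of positions, from which the labels
  at chosen positions can be split off.\<close>

lemma morita_mon_sum:
  fixes T :: "nat \<times> ('b \<times> 'n::finite \<times> 'n) list list \<Rightarrow> 'm \<Rightarrow> 'k::field_char_0"
  assumes T: "fin_cols T" and d: "distinct (concat poss)"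
  shows "lin_ext T (morita_mon (i, map (map x) poss)) u
    = (\<Sum>p\<in>labels (set (concat poss)). trace_weight p poss * T (i, map (map (labelled x p)) poss) u)"
proof -
  let ?f = "\<lambda>p. map (map (labelled x p)) poss"
    and ?X = "labels (set (concat poss)) :: (nat \<Rightarrow> 'n \<times> 'n) set"
  let ?Y = "{us. map (map fst) us = map (map x) poss} :: ('b \<times> 'n \<times> 'n) list list set"
  have bij: "bij_betw ?f ?X ?Y" by (rule labels_bij[OF d])
  have "finite ?X" by (rule finite_labels) simp
  then have fin: "finite ?Y"
    using bij_betw_finite[OF bij] by simp
  have "lin_ext T (morita_mon (i, map (map x) poss)) u
    = (\<Sum>z\<in>Pair i ` ?Y. morita_mon (i, map (map x) poss) z * T z u)"
    using fin by (intro lin_ext_eq) (auto simp: morita_mon_eq simp del: morita_mon.simps)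
  also have "\<dots> = (\<Sum>us\<in>?Y. morita_mon (i, map (map x) poss) (i, us) * T (i, us) u)"
    by (subst sum.reindex) (auto simp: inj_on_def)
  also have "\<dots> = (\<Sum>p\<in>?X. morita_mon (i, map (map x) poss) (i, ?f p) * T (i, ?f p) u)"
    by (rule sum.reindex_bij_betw[OF bij, symmetric])
  also have "\<dots> = (\<Sum>p\<in>?X. trace_weight p poss * T (i, ?f p) u)"
    by (intro sum.cong refl) (simp add: morita_mon_eq trace_weight_def o_def del: morita_mon.simps)
  finally show ?thesis .
qed

lemma fin_cols_morita: "fin_cols morita_mon"
  by (rule fin_colsI[where X = "\<lambda>(k, us). {(k, map (map fst) us)}"])
    (auto simp: morita_mon_eq simp del: morita_mon.simps split: if_splits)

text \<open>The exponent \<open>2 * i + length ws - 1\<close> bounds \<open>i\<close> and the number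
  of words. Factors \<open>\<nu>\<close> are counted as well, so only finitely many monomials reach
  a given one although \<open>\<nu>\<close> leaves no letters behind.\<close>

lemma fin_cols_sigma: "fin_cols sigma_K_mon"
proof (rule fin_colsI[where X = "\<lambda>(d, u). {..d} \<times> {ws. set ws \<subseteq> {w. set w \<subseteq> set u \<and> length w \<le> length u}
    \<and> length ws \<le> Suc d}"])
  fix x :: "nat \<times> 'a list"
  show "finite (case x of (d, u) \<Rightarrow> {..d} \<times> {ws. set ws \<subseteq> {w. set w \<subseteq> set u \<and> length w \<le> length u}
    \<and> length ws \<le> Suc d})"
    by (cases x) (auto intro!: finite_cartesian_product finite_lists_length_le)
  fix z assume *: "sigma_K_mon z x \<noteq> (0 :: 'b)"
  obtain d u where x: "x = (d, u)" by (cases x)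
  obtain i ws where z: "z = (i, ws)" by (cases z)
  have "2 * i + length ws - 1 = d" and u: "concat ws = u"
    using * by (auto simp: x z single_def split: if_splits)
  then have "i \<le> d" "length ws \<le> Suc d" by auto
  moreover have "length w \<le> length u" if "w \<in> set ws" for w
    unfolding u[symmetric] length_concat using that by (intro member_le_sum_list) auto
  ultimately show "z \<in> (case x of (d, u) \<Rightarrow> {..d} \<times> {ws. set ws \<subseteq> {w. set w \<subseteq> set u \<and> length w \<le> length u}
    \<and> length ws \<le> Suc d})"
    using u by (auto simp: x z)
qed

section \<open>Compatibility with the cyclic and symmetric relations\<close>

primrec blocks :: "nat \<Rightarrow> 'a list list \<Rightarrow> nat list list" where
  "blocks k [] = []"
| "blocks k (w # ws) = [k..<k + length w] # blocks (k + length w) ws"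

lemma concat_blocks: "concat (blocks k ws) = [k..<k + length (concat ws)]"
proof (induction ws arbitrary: k)
  case (Cons w ws)
  then show ?case
    using upt_add_eq_append[of k "k + length w" "length (concat ws)"] by (simp add: add.assoc)
qed simp

lemma map_blocks:
  "(\<And>k. k < length (concat ws) \<Longrightarrow> x (j + k) = concat ws ! k) \<Longrightarrow> map (map x) (blocks j ws) = ws"
proof (induction ws arbitrary: j)
  case (Cons w ws)
  have "map x [j..<j + length w] = w"
    using Cons.prems by (intro nth_equalityI) (auto simp: nth_append)
  moreover have "map (map x) (blocks (j + length w) ws) = ws"
  proof (rule Cons.IH)
    fix k assume "k < length (concat ws)"
    then show "x (j + length w + k) = concat ws ! k"
      using Cons.prems[of "length w + k"] by (simp add: nth_append add.assoc)
  qed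
  ultimately show ?case by simp
qed simp

text \<open>Numbering all letters consecutively gives distinct positions whose concatenation has
  sorting sign 1. Noncommutative monomials are treated in this form, with \<open>x\<close> giving
  the letter at a position.\<close>

lemma ex_blocks:
  obtains x poss where "ws = map (map x) poss" "concat poss = [0..<length (concat ws)]"
proof
  show "ws = map (map ((!) (concat ws))) (blocks 0 ws)"
    by (rule map_blocks[symmetric]) simp
  show "concat (blocks 0 ws) = [0..<length (concat ws)]"
    by (simp add: concat_blocks)
qed

lemma skew_rotate:
  fixes G :: "nat list \<Rightarrow> 'k::field_char_0"
  assumes G: "skew UNIV (\<lambda>k. p (x k)) G" and d: "distinct (concat poss)" and r: "r < length poss"
  shows "G (concat poss) = koszul p (map x (poss ! r)) (rotate1 [0..<length (poss ! r)])
    * G (concat (poss[r := rotate1 (poss ! r)]))"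
proof -
  let ?P = "concat (take r poss)" and ?S = "concat (drop (Suc r) poss)"
  have eq: "concat poss = ?P @ poss ! r @ ?S"
    by (subst id_take_nth_drop[OF r]) simp
  have eq': "concat (poss[r := c]) = ?P @ c @ ?S" for c
    by (simp add: upd_conv_take_nth_drop[OF r])
  have rot: "map ((!) (poss ! r)) (rotate1 [0..<length (poss ! r)]) = rotate1 (poss ! r)"
    by (simp add: rotate1_map map_nth flip: rotate1_map)
  show ?thesis
    unfolding eq' eq rot[symmetric] using d[unfolded eq]
    by (intro skew_koszul_infix[where p = p and y = x, OF G]) (auto simp: lessThan_atLeast0)
qed

lemma skew_permute_words:
  fixes G :: "nat list \<Rightarrow> 'k::field_char_0"
  assumes G: "skew UNIV (\<lambda>k. p (x k)) G" and d: "distinct (concat poss)"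
    and js: "js \<in> permutations_of_set {..<length poss}"
  shows "G (concat poss) = koszul (word_parity p) (map (map x) poss) js * G (concat (map ((!) poss) js))"
  using js by (intro skew_koszul_words[where p = p and y = x, OF G d]) (auto simp: permutations_of_set_def)

lemma map_list_update_rotate:
  "(map (map x) poss)[r := rotate1 (map x (poss ! r))]
    = map (map x) (poss[r := rotate1 (poss ! r)])"
  by (simp add: map_update rotate1_map)

lemma map_nth_perm:
  "js \<in> permutations_of_set {..<length poss} \<Longrightarrow>
    map ((!) (map f poss)) js = map f (map ((!) poss) js)"
  by (auto simp: permutations_of_set_def)

lemma lin_ext_nc_eq:
  assumes T: "fin_cols T"
    and rot: "\<And>i ws r u. r < length ws \<Longrightarrow> T (i, ws) u
      = koszul (spar V) (ws ! r) (rotate1 [0..<length (ws ! r)]) * T (i, ws[r := rotate1 (ws ! r)]) u"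
    and perm: "\<And>i ws js u. js \<in> permutations_of_set {..<length ws} \<Longrightarrow> T (i, ws) u
      = koszul (word_parity (spar V)) ws js * T (i, map ((!) ws) js) u"
    and fg: "(f, g) \<in> nc_eq V"
  shows "lin_ext T f = lin_ext T g"
proof (rule lin_ext_eq_mod[OF T _ fg[unfolded nc_eq_def]])
  fix r assume "r \<in> nc_relations V"
  then show "lin_ext T r = (\<lambda>_. 0)"
    unfolding nc_relations_def Un_iff mem_Collect_eq
    by (elim disjE exE conjE) (hypsubst, rule lin_ext_relation[OF T], rule rot perm, assumption)+
qed

lemma sym_sigma_K:
  "lin_ext (com_sym p) (sigma_K_mon (i, ws)) (d, u)
    = of_bool (d = 2 * i + length ws - 1) * symmetrize p (concat ws) u"
  by simp

text \<open>In the concatenated word both kinds of relations are reorderings of letters, which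
  symmetrization absorbs; the number of words, hence the power of \<open>\<hbar>\<close>, is
  unchanged.\<close>

lemma sigma_K_cong:
  fixes U :: "('b, 'k::field_char_0) superspace"
  assumes "(f, g) \<in> nc_eq U"
  shows "lin_ext (com_sym (spar U)) (lin_ext sigma_K_mon f)
    = lin_ext (com_sym (spar U)) (lin_ext sigma_K_mon g)"
  unfolding lin_ext_lin_ext[OF fin_cols_sigma fin_cols_com_sym]
proof (rule lin_ext_nc_eq[OF fin_cols_lin_ext[OF fin_cols_sigma fin_cols_com_sym] _ _ assms])
  fix i ws and u :: "nat \<times> 'b list"
  obtain d v where u: "u = (d, v)" by (cases u)
  obtain x :: "nat \<Rightarrow> 'b" and poss where ws: "ws = map (map x) poss"
      and "concat poss = [0..<length (concat ws)]"
    by (rule ex_blocks)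
  then have d: "distinct (concat poss)" by simp
  have G: "skew UNIV (\<lambda>k. spar U (x k)) (\<lambda>L. symmetrize (spar U) (map x L) v :: 'k)"
    by (rule skew_symmetrize)
  { fix r assume r: "r < length ws"
    then show "(lin_ext (com_sym (spar U)) (sigma_K_mon (i, ws)) u :: 'k)
      = koszul (spar U) (ws ! r) (rotate1 [0..<length (ws ! r)])
        * lin_ext (com_sym (spar U)) (sigma_K_mon (i, ws[r := rotate1 (ws ! r)])) u"
      using skew_rotate[where p = "spar U" and x = x and r = r, OF G d]
      unfolding u sym_sigma_K unfolding ws
      by (simp add: map_list_update_rotate map_concat) }
  { fix js assume js: "js \<in> permutations_of_set {..<length ws}"
    then have "length js = length ws" by (metis card_lessThan length_finite_permutations_of_set)
    then show "(lin_ext (com_sym (spar U)) (sigma_K_mon (i, ws)) u :: 'k)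
      = koszul (word_parity (spar U)) ws js
        * lin_ext (com_sym (spar U)) (sigma_K_mon (i, map ((!) ws) js)) u"
      using skew_permute_words[where p = "spar U" and x = x and js = js, OF G d] js
      unfolding u sym_sigma_K unfolding ws
      by (simp add: map_nth_perm map_concat) }
qed

section \<open>Contracting letters of cyclic words\<close>

lemma trace_weight_del:
  "r < length poss \<Longrightarrow> trace_weight p poss
    = trace (matrix_product (map p (poss ! r)) :: 'k::field_char_0 ^ 'n::finite ^ 'n) * trace_weight p (del r poss)"
  by (subst id_take_nth_drop) (simp_all add: del_def mult_ac)

lemma trace_weight_mset: "mset poss = mset poss' \<Longrightarrow> trace_weight p poss = trace_weight p poss'"
  unfolding trace_weight_def prod_mset_prod_list[symmetric] mset_map by simp

lemma trace_weight_rotate: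
  fixes p :: "nat \<Rightarrow> 'n::finite \<times> 'n"
  assumes "r < length poss"
  shows "trace_weight p (poss[r := rotate1 (poss ! r)]) = (trace_weight p poss :: 'k::field_char_0)"
proof -
  have "trace (matrix_product (map p (rotate1 c)) :: 'k ^ 'n ^ 'n) = trace (matrix_product (map p c))" for c
  proof (cases c)
    case (Cons a l)
    show ?thesis unfolding Cons rotate1.simps map_append by (subst trace_matrix_product_swap) simp
  qed simp
  then show ?thesis
    by (subst (3) id_take_nth_drop[OF assms]) (simp add: upd_conv_take_nth_drop[OF assms])
qed

text \<open>The trace is cyclic, so the word may be rotated until the relabelled letter stands in
  front.\<close>

lemma trace_insert:
  fixes p :: "nat \<Rightarrow> 'n::finite \<times> 'n"
  assumes d: "distinct c" and a: "a < length c" and p': "p' (c ! a) = ij"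
    "\<And>k. k \<in> set c \<Longrightarrow> k \<noteq> c ! a \<Longrightarrow> p' k = p k"
  shows "trace (matrix_product (map p' c) :: 'k::field_char_0 ^ 'n ^ 'n)
    = trace (matrix_unit ij ** matrix_product (map p (drop (Suc a) c @ take a c)))"
proof -
  have c: "c = take a c @ c ! a # drop (Suc a) c" by (rule id_take_nth_drop[OF a])
  then have d': "distinct (take a c @ c ! a # drop (Suc a) c)" using d by simp
  have "map p' (take a c) = map p (take a c)" "map p' (drop (Suc a) c) = map p (drop (Suc a) c)"
    using d' by (auto intro!: p' dest: in_set_takeD in_set_dropD)
  then have "map p' c = map p (take a c) @ ij # map p (drop (Suc a) c)"
    by (subst c) (simp add: p')
  then show ?thesis
    using trace_matrix_product_swap[of "map p (take a c)" "ij # map p (drop (Suc a) c)"]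
    by simp
qed

text \<open>The cyclic word left after contracting letter \<open>i\<close> of \<open>v\<close> with
  letter \<open>j\<close> of \<open>w\<close>: each word is cut open at its contracted letter.
  \<open>join_order\<close> lists the corresponding positions in \<open>v @ w\<close>, the
  contracted ones first.\<close>

definition joined :: "'a list \<Rightarrow> 'a list \<Rightarrow> nat \<Rightarrow> nat \<Rightarrow> 'a list"
  where "joined v w i j = drop (Suc i) v @ take i v @ drop (Suc j) w @ take j w"

definition join_order :: "nat \<Rightarrow> nat \<Rightarrow> nat \<Rightarrow> nat \<Rightarrow> nat list"
  where "join_order m n i j
    = [i, m + j] @ [Suc i..<m] @ [0..<i] @ [Suc (m + j)..<m + n] @ [m..<m + j]"

text \<open>Contracting two letters of a cyclic word cuts the circle into two arcs. The outer one
  runs through the end of the list back to its start, as in the cobracket.\<close>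

definition inner_arc :: "'a list \<Rightarrow> nat \<Rightarrow> nat \<Rightarrow> 'a list"
  where "inner_arc w i j = drop (Suc i) (take j w)"

definition outer_arc :: "'a list \<Rightarrow> nat \<Rightarrow> nat \<Rightarrow> 'a list"
  where "outer_arc w i j = drop (Suc j) w @ take i w"

definition split_order :: "nat \<Rightarrow> nat \<Rightarrow> nat \<Rightarrow> nat list"
  where "split_order n i j = [i, j] @ [Suc i..<j] @ [Suc j..<n] @ [0..<i]"

lemma map_joined: "map f (joined v w i j) = joined (map f v) (map f w) i j"
  by (simp add: joined_def take_map drop_map)

lemma map_inner_arc: "map f (inner_arc w i j) = inner_arc (map f w) i j"
  by (simp add: inner_arc_def take_map drop_map)

lemma map_outer_arc: "map f (outer_arc w i j) = outer_arc (map f w) i j"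
  by (simp add: outer_arc_def take_map drop_map)

lemma join_order_perm:
  assumes "i < m" "j < n"
  shows "distinct (join_order m n i j)" "set (join_order m n i j) = {..<m + n}"
  using assms by (auto simp: join_order_def)

lemma split_order_perm:
  assumes "i < j" "j < n"
  shows "distinct (split_order n i j)" "set (split_order n i j) = {..<n}"
  using assms by (auto simp: split_order_def)

lemma map_join_order:
  assumes "i < length v" "j < length w"
  shows "map ((!) (v @ w)) (join_order (length v) (length w) i j) = v ! i # w ! j # joined v w i j"
  using assms by (simp add: join_order_def joined_def nth_append map_nth_upt)

lemma map_split_order:
  assumes "i < j" "j < length w"
  shows "map ((!) w) (split_order (length w) i j) = w ! i # w ! j # inner_arc w i j @ outer_arc w i j"
  using assms by (simp add: split_order_def inner_arc_def outer_arc_def map_nth_upt)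

lemma cyc_bracket_eq:
  "cyc_bracket V v w u = (\<Sum>i<length v. \<Sum>j<length w.
      koszul (spar V) (v @ w) (join_order (length v) (length w) i j) * inv_form V (v ! i) (w ! j)
       * of_bool (u = joined v w i j))"
  unfolding cyc_bracket_def Let_def
  by (intro sum.cong refl)
    (simp add: join_order_def joined_def nth_append map_nth_upt)

lemma cyc_cobracket_eq:
  "cyc_cobracket V w u u' = (\<Sum>i<length w. \<Sum>j\<in>{i<..<length w}.
      koszul (spar V) w (split_order (length w) i j) * inv_form V (w ! i) (w ! j)
       * of_bool (u = inner_arc w i j \<and> u' = outer_arc w i j))"
  unfolding cyc_cobracket_def Let_def
  by (intro sum.cong refl) (simp add: split_order_def inner_arc_def outer_arc_def map_nth_upt)

lemma sign_cancel:
  assumes "1 = a * (b * c)" "c * c = (1 :: 'k::field_char_0)"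
  shows "a * b = c"
proof -
  have "a * b = a * b * (c * c)" by (simp add: assms(2))
  also have "\<dots> = a * (b * c) * c" by (simp only: mult_ac)
  finally show ?thesis by (simp add: assms(1)[symmetric])
qed

text \<open>The first sign brings the two words to the front, the second reorders their letters. As
  the initial order has sorting sign 1, their product is the sorting sign of the final
  order.\<close>

lemma join_sign:
  assumes d: "distinct (concat poss)" and one: "order_sign (\<lambda>k. p (x k)) (concat poss) = (1 :: 'k::field_char_0)"
    and rs: "r < s" "s < length poss" and ij: "i < length (poss ! r)" "j < length (poss ! s)"
  shows "koszul (word_parity p) (map (map x) poss) (to_front2 (length poss) r s)
      * koszul p (map x (poss ! r) @ map x (poss ! s)) (join_order (length (poss ! r)) (length (poss ! s)) i j)
    = (order_sign (\<lambda>k. p (x k)) (poss ! r ! i # poss ! s ! j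
        # concat (joined (poss ! r) (poss ! s) i j # del r (del s poss))) :: 'k)"
    (is "?k1 * ?k2 = ?o")
proof -
  let ?q = "\<lambda>k. p (x k)" and ?N = "poss ! r @ poss ! s" and ?S = "concat (del r (del s poss))"
  have tf: "map ((!) poss) (to_front2 (length poss) r s) = poss ! r # poss ! s # del r (del s poss)"
    by (rule map_to_front2[OF rs])
  have perm: "distinct (to_front2 (length poss) r s)" "set (to_front2 (length poss) r s) = {..<length poss}"
    using to_front2_perm[of r "length poss" s] rs by auto
  have 1: "(order_sign ?q (concat poss) :: 'k) = ?k1 * order_sign ?q (?N @ ?S)"
    using skew_koszul_words[where p = p and y = x, OF skew_order_sign d _ perm] tf by simp
  have d': "distinct (concat (map ((!) poss) (to_front2 (length poss) r s)))"
    by (rule distinct_concat_nth[OF d]) (use perm in auto)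
  have "(order_sign ?q ([] @ ?N @ ?S) :: 'k)
    = koszul p (map x ?N) (join_order (length (poss ! r)) (length (poss ! s)) i j)
      * order_sign ?q ([] @ map ((!) ?N) (join_order (length (poss ! r)) (length (poss ! s)) i j) @ ?S)"
    using d' join_order_perm[OF ij] unfolding tf
    by (intro skew_koszul_infix[where p = p and y = x, OF skew_order_sign]) auto
  then have 2: "(order_sign ?q (?N @ ?S) :: 'k) = ?k2 * ?o"
    by (simp only: map_join_order[OF ij] append_Nil map_append append_Cons concat.simps)
  show ?thesis using 1 unfolding one 2 by (rule sign_cancel) (rule order_sign_square)
qed

text \<open>The derivation sign for passing the preceding words is the sign for moving the
  contracted pair past them: the pair has odd total parity, so only the parity of the preceding
  letters enters.\<close>

lemma split_sign:
  assumes d: "distinct (concat poss)" and one: "order_sign (\<lambda>k. p (x k)) (concat poss) = (1 :: 'k::field_char_0)"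
    and r: "r < length poss" and ij: "i < j" "j < length (poss ! r)"
    and odd: "p (x (poss ! r ! i)) \<noteq> p (x (poss ! r ! j))"
  shows "sg (word_parity p (concat (take r (map (map x) poss))))
      * koszul p (map x (poss ! r)) (split_order (length (poss ! r)) i j)
    = (order_sign (\<lambda>k. p (x k)) (poss ! r ! i # poss ! r ! j
        # concat (take r poss @ [inner_arc (poss ! r) i j, outer_arc (poss ! r) i j] @ drop (Suc r) poss)) :: 'k)"
    (is "?k1 * ?k2 = ?o")
proof -
  let ?q = "\<lambda>k. p (x k)" and ?N = "poss ! r" and ?P = "concat (take r poss)" and ?S = "concat (drop (Suc r) poss)"
  have eq: "concat poss = ?P @ ?N @ ?S"
    by (subst id_take_nth_drop[OF r]) simp
  have "(order_sign ?q (?P @ ?N @ ?S) :: 'k) = ?k2 * order_sign ?q (?P @ map ((!) ?N) (split_order (length ?N) i j) @ ?S)"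
    using d[unfolded eq] split_order_perm[OF ij]
    by (intro skew_koszul_infix[where p = p and y = x, OF skew_order_sign]) auto
  then have 1: "1 = ?k2 * (order_sign ?q ([] @ ?P @ [?N ! i, ?N ! j] @ inner_arc ?N i j @ outer_arc ?N i j @ ?S) :: 'k)"
    using one unfolding eq[symmetric] map_split_order[OF ij] by simp
  \<comment> \<open>The contracted letters and the arcs make up the word. This yields the
    distinctness under which the pair can be moved as a block.\<close>
  have N: "mset ?N = mset ([?N ! i, ?N ! j] @ inner_arc ?N i j @ outer_arc ?N i j)"
  proof -
    have "mset (split_order (length ?N) i j) = mset [0..<length ?N]"
      using split_order_perm[OF ij]
      by (intro iffD1[OF set_eq_iff_mset_eq_distinct]) (simp_all add: lessThan_atLeast0)
    then have "mset (map ((!) ?N) (split_order (length ?N) i j)) = mset (map ((!) ?N) [0..<length ?N])"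
      by (simp only: mset_map)
    then show ?thesis unfolding map_split_order[OF ij] map_nth by simp
  qed
  have "mset (?P @ [?N ! i, ?N ! j] @ inner_arc ?N i j @ outer_arc ?N i j @ ?S) = mset (?P @ ?N @ ?S)"
    using N by simp
  then have "distinct ([] @ ?P @ [?N ! i, ?N ! j] @ inner_arc ?N i j @ outer_arc ?N i j @ ?S)"
    using d[unfolded eq] by (metis append_Nil mset_eq_imp_distinct_iff)
  from skew_block[OF skew_order_sign this, of ?q]
  have "order_sign ?q ([] @ ?P @ [?N ! i, ?N ! j] @ inner_arc ?N i j @ outer_arc ?N i j @ ?S)
     = sg (word_parity ?q ?P) * (order_sign ?q ([?N ! i, ?N ! j] @ ?P @ inner_arc ?N i j @ outer_arc ?N i j @ ?S) :: 'k)"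
    using odd by simp
  moreover have "word_parity p (concat (take r (map (map x) poss))) = word_parity ?q ?P"
    by (simp add: take_map word_parity_map flip: map_concat)
  ultimately have "1 = ?k2 * (?k1 * ?o)" using 1 by simp
  then have "?k2 * ?k1 = ?o" by (rule sign_cancel) (rule order_sign_square)
  then show ?thesis by (simp only: mult.commute)
qed

text \<open>The relabelled positions lie in different words, so two of the traces contain one free
  matrix unit each and \<open>sum_trace_join\<close> applies; the other traces factor out.\<close>

lemma trace_join:
  fixes p :: "nat \<Rightarrow> 'n::finite \<times> 'n"
  assumes d: "distinct (concat poss)"
    and rs: "r < s" "s < length poss" and ij: "i < length (poss ! r)" "j < length (poss ! s)"
  shows "(\<Sum>k\<in>UNIV. \<Sum>l\<in>UNIV.
      trace_weight (p(poss ! r ! i := (k, l), poss ! s ! j := (l, k))) poss)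
    = (trace_weight p (joined (poss ! r) (poss ! s) i j # del r (del s poss)) :: 'k::field_char_0)"
proof -
  let ?a = "poss ! r" and ?b = "poss ! s" and ?R = "del r (del s poss)"
  have "map ((!) poss) (to_front2 (length poss) r s) = ?a # ?b # ?R"
    by (rule map_to_front2[OF rs])
  moreover have "distinct (concat (map ((!) poss) (to_front2 (length poss) r s)))"
    by (rule distinct_concat_nth[OF d]) (use to_front2_perm[of r "length poss" s] rs in auto)
  ultimately have dd: "distinct (?a @ ?b @ concat ?R)" by simp
  have mem: "?a ! i \<in> set ?a" "?b ! j \<in> set ?b" using ij by simp_all
  have "set ?a \<inter> set ?b = {}" using dd by auto
  with mem have ne: "?a ! i \<noteq> ?b ! j" "?a ! i \<notin> set ?b" by (metis disjoint_iff)+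
  have "trace_weight (p(?a ! i := (k, l), ?b ! j := (l, k))) poss
    = trace (matrix_unit (k, l) ** matrix_product (map p (drop (Suc i) ?a @ take i ?a)))
      * trace (matrix_unit (l, k) ** matrix_product (map p (drop (Suc j) ?b @ take j ?b)))
      * (trace_weight p ?R :: 'k)" (is "trace_weight ?p' _ = _") for k l
  proof -
    have "trace_weight ?p' poss = trace (matrix_product (map ?p' ?b) :: 'k ^ 'n ^ 'n)
        * trace_weight ?p' (del s poss)"
      by (rule trace_weight_del[OF rs(2)])
    also have "trace_weight ?p' (del s poss)
        = trace (matrix_product (map ?p' ?a) :: 'k ^ 'n ^ 'n) * trace_weight ?p' ?R"
      using rs by (subst trace_weight_del[of r]) (simp_all add: length_del nth_del)
    also have "trace_weight ?p' ?R = (trace_weight p ?R :: 'k)"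
      using dd mem by (intro trace_weight_cong) auto
    also have "trace (matrix_product (map ?p' ?a) :: 'k ^ 'n ^ 'n)
        = trace (matrix_unit (k, l) ** matrix_product (map p (drop (Suc i) ?a @ take i ?a)))"
      using dd mem ne ij by (intro trace_insert) auto
    also have "trace (matrix_product (map ?p' ?b) :: 'k ^ 'n ^ 'n)
        = trace (matrix_unit (l, k) ** matrix_product (map p (drop (Suc j) ?b @ take j ?b)))"
      using dd mem ne ij by (intro trace_insert) auto
    finally show ?thesis by (simp only: mult_ac)
  qed
  then have "(\<Sum>k\<in>UNIV. \<Sum>l\<in>UNIV. trace_weight (p(?a ! i := (k, l), ?b ! j := (l, k))) poss)
    = (\<Sum>k\<in>UNIV. \<Sum>l\<in>UNIV.
        trace (matrix_unit (k, l) ** matrix_product (map p (drop (Suc i) ?a @ take i ?a)))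
      * trace (matrix_unit (l, k) ** matrix_product (map p (drop (Suc j) ?b @ take j ?b))))
      * (trace_weight p ?R :: 'k)"
    by (simp only: sum_distrib_right)
  also have "\<dots> = trace_weight p (joined ?a ?b i j # ?R)"
    unfolding sum_trace_join matrix_product_append[symmetric] by (simp add: joined_def)
  finally show ?thesis .
qed

text \<open>Both relabelled positions lie in one word. Read from the first of them, its trace is
  Tr(E_kl X E_lk Y) with X and Y the products along the arcs, and \<open>sum_trace_split\<close>
  separates these.\<close>

lemma trace_split:
  fixes p :: "nat \<Rightarrow> 'n::finite \<times> 'n"
  assumes d: "distinct (concat poss)" and r: "r < length poss" and ij: "i < j" "j < length (poss ! r)"
  shows "(\<Sum>k\<in>UNIV. \<Sum>l\<in>UNIV.
      trace_weight (p(poss ! r ! i := (k, l), poss ! r ! j := (l, k))) poss)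
    = (trace_weight p (take r poss @ [inner_arc (poss ! r) i j, outer_arc (poss ! r) i j] @ drop (Suc r) poss)
        :: 'k::field_char_0)"
proof -
  let ?c = "poss ! r" and ?R = "del r poss"
  have eq: "concat poss = concat (take r poss) @ ?c @ concat (drop (Suc r) poss)"
    by (subst id_take_nth_drop[OF r]) simp
  have dc: "distinct ?c" and dd: "set ?c \<inter> set (concat ?R) = {}"
    using d[unfolded eq] by (auto simp: del_def)
  have mem: "?c ! i \<in> set ?c" "?c ! j \<in> set ?c" "?c ! i \<noteq> ?c ! j"
    using ij dc by (simp_all add: nth_eq_iff_index_eq)
  have i: "i < length ?c" using ij by simp
  have "trace_weight (p(?c ! i := (k, l), ?c ! j := (l, k))) poss
    = trace (matrix_unit (k, l) ** (matrix_product (map p (inner_arc ?c i j))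
        ** (matrix_unit (l, k) ** matrix_product (map p (outer_arc ?c i j)))))
      * (trace_weight p ?R :: 'k)" (is "trace_weight ?p' _ = _") for k l
  proof -
    have "trace_weight ?p' poss = trace (matrix_product (map ?p' ?c) :: 'k ^ 'n ^ 'n) * trace_weight ?p' ?R"
      by (rule trace_weight_del[OF r])
    also have "trace_weight ?p' ?R = (trace_weight p ?R :: 'k)"
      using dd mem by (intro trace_weight_cong) auto
    also have "trace (matrix_product (map ?p' ?c) :: 'k ^ 'n ^ 'n)
        = trace (matrix_unit (k, l) ** matrix_product (map (p(?c ! j := (l, k))) (drop (Suc i) ?c @ take i ?c)))"
      using mem by (intro trace_insert[OF dc i]) auto
    also have "map (p(?c ! j := (l, k))) (drop (Suc i) ?c @ take i ?c)
      = map p (inner_arc ?c i j) @ (l, k) # map p (outer_arc ?c i j)"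
    proof -
      have "drop (Suc i) ?c = drop (Suc i) (take j ?c @ ?c ! j # drop (Suc j) ?c)"
        using id_take_nth_drop[OF ij(2)] by simp
      also have "\<dots> = inner_arc ?c i j @ ?c ! j # drop (Suc j) ?c"
        using ij by (simp add: inner_arc_def)
      finally have c: "drop (Suc i) ?c @ take i ?c = inner_arc ?c i j @ ?c ! j # outer_arc ?c i j"
        by (simp add: outer_arc_def)
      have "mset (drop (Suc i) ?c @ take i ?c) = mset (del i ?c)"
        by (simp add: del_def)
      then have "distinct (drop (Suc i) ?c @ take i ?c)"
        using distinct_del[OF i dc] by (metis mset_eq_imp_distinct_iff)
      then have "?c ! j \<notin> set (inner_arc ?c i j)" "?c ! j \<notin> set (outer_arc ?c i j)"
        unfolding c by auto
      then show ?thesis unfolding c by (auto intro!: map_cong)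
    qed
    finally show ?thesis by (simp only: matrix_product_append matrix_product_simps)
  qed
  then have "(\<Sum>k\<in>UNIV. \<Sum>l\<in>UNIV. trace_weight (p(?c ! i := (k, l), ?c ! j := (l, k))) poss)
    = (\<Sum>k\<in>UNIV. \<Sum>l\<in>UNIV. trace (matrix_unit (k, l) ** (matrix_product (map p (inner_arc ?c i j))
        ** (matrix_unit (l, k) ** matrix_product (map p (outer_arc ?c i j))))))
      * (trace_weight p ?R :: 'k)"
    by (simp only: sum_distrib_right)
  also have "\<dots> = trace_weight p (take r poss @ [inner_arc ?c i j, outer_arc ?c i j] @ drop (Suc r) poss)"
    unfolding sum_trace_split by (simp add: del_def mult_ac)
  finally show ?thesis .
qed

section \<open>Sums over pairs of positions\<close>

lemma sum_pairs_Cons: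
  fixes c :: "'a \<Rightarrow> 'a \<Rightarrow> 'k::comm_monoid_add"
  shows "(\<Sum>i<length (a # L). \<Sum>j\<in>{i<..<length (a # L)}. c ((a # L) ! i) ((a # L) ! j))
    = (\<Sum>j<length L. c a (L ! j)) + (\<Sum>i<length L. \<Sum>j\<in>{i<..<length L}. c (L ! i) (L ! j))"
  unfolding list.size(4) add_Suc_right add_0_right by (subst sum_Suc_shift) simp

lemma sum_nth_append:
  "(\<Sum>j<length (L @ M). g ((L @ M) ! j)) = (\<Sum>j<length L. g (L ! j)) + (\<Sum>j<length M. g (M ! j) :: 'k::comm_monoid_add)"
  by (induction L) (simp_all add: sum.lessThan_Suc_shift add.assoc del: sum.lessThan_Suc)

lemma sum_nth_concat:
  "(\<Sum>j<length (concat P). g (concat P ! j)) = (\<Sum>r<length P. \<Sum>j<length (P ! r). g (P ! r ! j) :: 'k::comm_monoid_add)"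
proof (induction P)
  case (Cons C P)
  then show ?case
    by (simp only: concat.simps sum_nth_append) (simp add: sum.lessThan_Suc_shift del: sum.lessThan_Suc)
qed simp

lemma sum_pairs_append:
  fixes c :: "'a \<Rightarrow> 'a \<Rightarrow> 'k::comm_monoid_add"
  shows "(\<Sum>i<length (L @ M). \<Sum>j\<in>{i<..<length (L @ M)}. c ((L @ M) ! i) ((L @ M) ! j))
    = (\<Sum>i<length L. \<Sum>j\<in>{i<..<length L}. c (L ! i) (L ! j))
      + (\<Sum>i<length L. \<Sum>j<length M. c (L ! i) (M ! j))
      + (\<Sum>i<length M. \<Sum>j\<in>{i<..<length M}. c (M ! i) (M ! j))"
proof (induction L)
  case (Cons a L)
  have "(\<Sum>i<length (a # L). \<Sum>j<length M. c ((a # L) ! i) (M ! j))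
    = (\<Sum>j<length M. c a (M ! j)) + (\<Sum>i<length L. \<Sum>j<length M. c (L ! i) (M ! j))"
    by (simp add: sum.lessThan_Suc_shift del: sum.lessThan_Suc)
  then show ?case
    unfolding append_Cons sum_pairs_Cons sum_nth_append Cons.IH by (simp add: add_ac)
qed simp

text \<open>Two letters of a product lie in one word or in two. The two sums will correspond to
  \<open>\<nabla>\<close> and to \<open>\<gamma>\<delta>\<close>.\<close>

lemma sum_pairs_concat:
  fixes c :: "'a \<Rightarrow> 'a \<Rightarrow> 'k::comm_monoid_add"
  shows "(\<Sum>i<length (concat P). \<Sum>j\<in>{i<..<length (concat P)}. c (concat P ! i) (concat P ! j))
    = (\<Sum>r<length P. \<Sum>i<length (P ! r). \<Sum>j\<in>{i<..<length (P ! r)}. c (P ! r ! i) (P ! r ! j))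
      + (\<Sum>r<length P. \<Sum>s\<in>{r<..<length P}. \<Sum>i<length (P ! r). \<Sum>j<length (P ! s). c (P ! r ! i) (P ! s ! j))"
proof (induction P)
  case (Cons C P)
  have "(\<Sum>i<length C. \<Sum>j<length (concat P). c (C ! i) (concat P ! j))
    = (\<Sum>s<length P. \<Sum>i<length C. \<Sum>j<length (P ! s). c (C ! i) (P ! s ! j))"
    unfolding sum_nth_concat by (rule sum.swap)
  then show ?case
    unfolding concat.simps sum_pairs_append Cons.IH
      sum_pairs_Cons[where c = "\<lambda>C D. \<Sum>i<length C. \<Sum>j<length D. c (C ! i) (D ! j)"]
    by (simp add: sum.lessThan_Suc_shift add_ac del: sum.lessThan_Suc)
qed simp

text \<open>Labellings of disjoint sets are independent. This merges the labels of the two factors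
  when their images are bracketed.\<close>

lemma sum_labels_Un:
  fixes F :: "(nat \<Rightarrow> 'n::finite \<times> 'n) \<Rightarrow> 'k::comm_monoid_add"
  assumes "finite X"
  shows "X \<inter> Y = {} \<Longrightarrow> (\<Sum>p\<in>labels (X \<union> Y). F p)
    = (\<Sum>p1\<in>labels X. \<Sum>p2\<in>labels Y. F (\<lambda>k. if k \<in> X then p1 k else p2 k))"
  using assms
proof (induction X arbitrary: F rule: finite_induct)
  case empty
  then show ?case by simp
next
  case (insert a X)
  have "(\<Sum>p\<in>labels (insert a (X \<union> Y)). F p) = (\<Sum>c\<in>UNIV. \<Sum>p\<in>labels (X \<union> Y). F (p(a := c)))"
    by (rule sum_labels_insert) (use insert in auto)
  also have "\<dots> = (\<Sum>c\<in>UNIV. \<Sum>p1\<in>labels X. \<Sum>p2\<in>labels Y. F ((\<lambda>k. if k \<in> X then p1 k else p2 k)(a := c)))"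
    using insert.prems by (intro sum.cong refl insert.IH) auto
  also have "\<dots> = (\<Sum>c\<in>UNIV. \<Sum>p1\<in>labels X. \<Sum>p2\<in>labels Y.
      F (\<lambda>k. if k \<in> insert a X then (p1(a := c)) k else p2 k))"
    by (intro sum.cong refl arg_cong[where f = F]) auto
  also have "\<dots> = (\<Sum>p1\<in>labels (insert a X). \<Sum>p2\<in>labels Y. F (\<lambda>k. if k \<in> insert a X then p1 k else p2 k))"
    by (rule sum_labels_insert[symmetric]) (use insert in auto)
  finally show ?case by simp
qed

section \<open>The noncommutative operators as finite sums of monomials\<close>

definition join_coeff :: "('b, 'k::field_char_0) superspace \<Rightarrow> 'b list list \<Rightarrow> nat \<Rightarrow> nat \<Rightarrow> nat \<Rightarrow> nat \<Rightarrow> 'k"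
  where "join_coeff V zs r s i j =
    koszul (word_parity (spar V)) zs (to_front2 (length zs) r s)
      * koszul (spar V) (zs ! r @ zs ! s) (join_order (length (zs ! r)) (length (zs ! s)) i j)
      * inv_form V (zs ! r ! i) (zs ! s ! j)"

definition split_coeff :: "('b, 'k::field_char_0) superspace \<Rightarrow> 'b list list \<Rightarrow> nat \<Rightarrow> nat \<Rightarrow> nat \<Rightarrow> 'k"
  where "split_coeff V zs r i j =
    sg (word_parity (spar V) (concat (take r zs)))
      * koszul (spar V) (zs ! r) (split_order (length (zs ! r)) i j)
      * inv_form V (zs ! r ! i) (zs ! r ! j)"

text \<open>The definition tests the shape of the target list; as a finite sum of
  \<open>single\<close> monomials the bracket can be fed into a linear extension.\<close>

lemma nc_bracket_mon_eq:
  fixes V :: "('b, 'k::field_char_0) superspace"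
  shows "nc_bracket_mon V (k, ws) (l, vs) = (\<lambda>x. \<Sum>r<length ws. \<Sum>s<length vs.
    \<Sum>i<length (ws ! r). \<Sum>j<length (vs ! s). join_coeff V (ws @ vs) r (length ws + s) i j
      * single (k + l, joined (ws ! r) (vs ! s) i j # del r ws @ del s vs) x)"
proof
  fix x :: "nat \<times> 'b list list"
  obtain m us where x: "x = (m, us)" by (cases x)
  show "nc_bracket_mon V (k, ws) (l, vs) x = (\<Sum>r<length ws. \<Sum>s<length vs.
    \<Sum>i<length (ws ! r). \<Sum>j<length (vs ! s). join_coeff V (ws @ vs) r (length ws + s) i j
      * single (k + l, joined (ws ! r) (vs ! s) i j # del r ws @ del s vs) x)"
    unfolding x nc_bracket_mon.simps sum_distrib_left
    by (intro sum.cong refl; cases us)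
      (simp_all add: cyc_bracket_eq join_coeff_def single_def nth_append sum_distrib_left sum_distrib_right
        mult_ac del: sum_mult_of_bool_eq sum_of_bool_mult_eq)
qed

lemma gamma_delta_mon_eq:
  fixes V :: "('b, 'k::field_char_0) superspace"
  shows "gamma_delta_mon V (k, ws) = (\<lambda>x. \<Sum>r<length ws. \<Sum>s\<in>{r<..<length ws}.
    \<Sum>i<length (ws ! r). \<Sum>j<length (ws ! s). join_coeff V ws r s i j
      * single (Suc k, joined (ws ! r) (ws ! s) i j # del r (del s ws)) x)"
proof
  fix x :: "nat \<times> 'b list list"
  obtain m us where x: "x = (m, us)" by (cases x)
  show "gamma_delta_mon V (k, ws) x = (\<Sum>r<length ws. \<Sum>s\<in>{r<..<length ws}.
    \<Sum>i<length (ws ! r). \<Sum>j<length (ws ! s). join_coeff V ws r s i j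
      * single (Suc k, joined (ws ! r) (ws ! s) i j # del r (del s ws)) x)"
    unfolding x gamma_delta_mon.simps sum_distrib_left
    by (intro sum.cong refl; cases us)
      (simp_all add: cyc_bracket_eq join_coeff_def single_def sum_distrib_left sum_distrib_right
        mult_ac del: sum_mult_of_bool_eq sum_of_bool_mult_eq)
qed

lemma nabla_mon_eq:
  fixes V :: "('b, 'k::field_char_0) superspace"
  shows "nabla_mon V (k, ws) = (\<lambda>x. \<Sum>r<length ws.
    \<Sum>i<length (ws ! r). \<Sum>j\<in>{i<..<length (ws ! r)}. split_coeff V ws r i j
      * single (k, take r ws @ [inner_arc (ws ! r) i j, outer_arc (ws ! r) i j] @ drop (Suc r) ws) x)"
proof
  fix x :: "nat \<times> 'b list list"
  obtain m us where x: "x = (m, us)" by (cases x)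
  \<comment> \<open>The definition reads the two new words off \<open>us\<close>, at the places
    \<open>r\<close> and \<open>Suc r\<close>; together with the prescribed shape of
    \<open>us\<close> this determines the whole list.\<close>
  have eq: "us ! r = a \<and> us ! Suc r = b \<and> us = take r ws @ [us ! r, us ! Suc r] @ drop (Suc r) ws
      \<longleftrightarrow> us = take r ws @ [a, b] @ drop (Suc r) ws" if "r < length ws" for r a b
    using that by (auto simp: nth_append)
  have "of_bool (us ! r = a \<and> us ! Suc r = b) * of_bool (us = take r ws @ [us ! r, us ! Suc r] @ drop (Suc r) ws)
      = (of_bool (us = take r ws @ [a, b] @ drop (Suc r) ws) :: 'k)" if "r < length ws" for r a b
    by (subst eq[OF that, symmetric]) (simp only: of_bool_conj mult.assoc)
  note bool = this
  have trm: "of_bool (m = k) * (sg (word_parity (spar V) (concat (take r ws)))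
      * cyc_cobracket V (ws ! r) (us ! r) (us ! Suc r)
      * of_bool (us = take r ws @ [us ! r, us ! Suc r] @ drop (Suc r) ws))
    = (\<Sum>i<length (ws ! r). \<Sum>j\<in>{i<..<length (ws ! r)}. split_coeff V ws r i j
      * single (k, take r ws @ [inner_arc (ws ! r) i j, outer_arc (ws ! r) i j] @ drop (Suc r) ws) x)"
    if r: "r < length ws" for r
  proof -
    have "cyc_cobracket V (ws ! r) (us ! r) (us ! Suc r)
        * of_bool (us = take r ws @ [us ! r, us ! Suc r] @ drop (Suc r) ws)
      = (\<Sum>i<length (ws ! r). \<Sum>j\<in>{i<..<length (ws ! r)}.
          koszul (spar V) (ws ! r) (split_order (length (ws ! r)) i j) * inv_form V (ws ! r ! i) (ws ! r ! j)
          * of_bool (us = take r ws @ [inner_arc (ws ! r) i j, outer_arc (ws ! r) i j] @ drop (Suc r) ws))"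
      unfolding cyc_cobracket_eq sum_distrib_right by (simp only: mult.assoc bool[OF r])
    then have "of_bool (m = k) * (sg (word_parity (spar V) (concat (take r ws)))
      * cyc_cobracket V (ws ! r) (us ! r) (us ! Suc r)
      * of_bool (us = take r ws @ [us ! r, us ! Suc r] @ drop (Suc r) ws))
      = (\<Sum>i<length (ws ! r). \<Sum>j\<in>{i<..<length (ws ! r)}.
         of_bool (m = k) * (sg (word_parity (spar V) (concat (take r ws)))
          * (koszul (spar V) (ws ! r) (split_order (length (ws ! r)) i j) * inv_form V (ws ! r ! i) (ws ! r ! j)
          * of_bool (us = take r ws @ [inner_arc (ws ! r) i j, outer_arc (ws ! r) i j] @ drop (Suc r) ws))))"
      by (simp only: sum_distrib_left mult.assoc)
    also have "\<dots> = (\<Sum>i<length (ws ! r). \<Sum>j\<in>{i<..<length (ws ! r)}. split_coeff V ws r i j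
      * single (k, take r ws @ [inner_arc (ws ! r) i j, outer_arc (ws ! r) i j] @ drop (Suc r) ws) x)"
      by (intro sum.cong refl) (simp add: split_coeff_def single_def x)
    finally show ?thesis .
  qed
  show "nabla_mon V (k, ws) x = (\<Sum>r<length ws.
    \<Sum>i<length (ws ! r). \<Sum>j\<in>{i<..<length (ws ! r)}. split_coeff V ws r i j
      * single (k, take r ws @ [inner_arc (ws ! r) i j, outer_arc (ws ! r) i j] @ drop (Suc r) ws) x)"
    unfolding x nabla_mon.simps sum_distrib_left
    by (rule sum.cong[OF refl], subst trm) (simp_all add: x)
qed

section \<open>The composite with the matrix map\<close>

text \<open>E_ij and E_ji are dual for the trace form, so the label \<open>(i, j)\<close> pairs with
  \<open>(j, i)\<close> only; matrices are even and add no sign.\<close>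

locale matrix_pairing = odd_pairing V
  for V :: "('b, 'k::field_char_0) superspace" +
  fixes W :: "('b \<times> 'n::finite \<times> 'n, 'k) superspace"
  assumes W_def: "W = matrix_space V"
    and W_form: "inv_form W (a, i, j) (b, k, l) = inv_form V a b * of_bool (i = l \<and> j = k)"
begin

lemma spar_W [simp]: "spar W y = spar V (fst y)"
  by (simp add: W_def matrix_space_def)

lemma sbasis_W [simp]: "sbasis W = sbasis V \<times> UNIV"
  by (simp add: W_def matrix_space_def)

sublocale W: odd_pairing W
proof
  show "finite (sbasis W)" using finite_basis by simp
  fix a b :: "'b \<times> 'n \<times> 'n"
  obtain a' i j b' k l where ab: "a = (a', i, j)" "b = (b', k, l)" by (metis surj_pair)
  show "inv_form W a b = inv_form W b a"
    by (auto simp: ab W_form symmetric[of a' b'])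
  assume "inv_form W a b \<noteq> 0"
  then have "inv_form V a' b' \<noteq> 0" by (simp add: ab W_form)
  then show "a \<in> sbasis W \<and> b \<in> sbasis W" "spar W a \<noteq> spar W b"
    using support form_odd by (auto simp: ab)
qed

definition phi :: "nat \<times> 'b list list \<Rightarrow> nat \<times> ('b \<times> 'n \<times> 'n) list \<Rightarrow> 'k"
  where "phi z = lin_ext sigma_K_mon (morita_mon z)"

text \<open>The composite followed by symmetrization. By \<open>com_eq_iff\<close> its value on a
  series determines the class of the image.\<close>

definition psi :: "nat \<times> 'b list list \<Rightarrow> nat \<times> ('b \<times> 'n \<times> 'n) list \<Rightarrow> 'k"
  where "psi z = lin_ext (com_sym (spar W)) (phi z)"

text \<open>The symmetrized image of a product of cyclic words, without its power of \<open>\<hbar>\<close>. Each word is given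
  by the list of the positions of its letters.\<close>

definition theta :: "(nat \<Rightarrow> 'b) \<Rightarrow> nat list list \<Rightarrow> ('b \<times> 'n \<times> 'n) list \<Rightarrow> 'k"
  where "theta x poss u = (\<Sum>p\<in>labels (set (concat poss)).
    trace_weight p poss * symmetrize (spar W) (map (labelled x p) (concat poss)) u)"

lemma fin_cols_phi: "fin_cols phi"
  using fin_cols_lin_ext[OF fin_cols_morita fin_cols_sigma] unfolding phi_def .

lemma fin_cols_psi: "fin_cols psi"
  using fin_cols_lin_ext[OF fin_cols_phi fin_cols_com_sym] unfolding psi_def .

lemma lin_ext_phi:
  fixes T :: "nat \<times> ('b \<times> 'n \<times> 'n) list \<Rightarrow> 'm \<Rightarrow> 'k"
  assumes T: "fin_cols T" and d: "distinct (concat poss)"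
  shows "lin_ext T (phi (i, map (map x) poss)) u = (\<Sum>p\<in>labels (set (concat poss)).
    trace_weight p poss * T (2 * i + length poss - 1, map (labelled x p) (concat poss)) u)"
  unfolding phi_def lin_ext_lin_ext[OF fin_cols_sigma T]
  by (subst morita_mon_sum[OF fin_cols_lin_ext[OF fin_cols_sigma T] d]) (simp add: map_concat)

lemma psi_eq:
  assumes "distinct (concat poss)"
  shows "psi (i, map (map x) poss) (d, u) = of_bool (d = 2 * i + length poss - 1) * theta x poss u"
  unfolding psi_def theta_def lin_ext_phi[OF fin_cols_com_sym assms] com_sym.simps
  by (simp only: sum_distrib_left mult.left_commute)

lemma skew_labelled:
  "skew UNIV (\<lambda>k. spar V (x k)) (\<lambda>L. symmetrize (spar W) (map (labelled x p) L) u :: 'k)"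
  using skew_symmetrize[where p = "spar W" and y = "labelled x p" and u = u and X = UNIV] by simp

text \<open>Rotating a word preserves its trace and permuting the words preserves the product of the
  traces, while the letters acquire precisely the Koszul sign of the relation.\<close>

lemma psi_cong:
  assumes fg: "(f, g) \<in> nc_eq V"
  shows "lin_ext psi f = lin_ext psi g"
proof (rule lin_ext_nc_eq[OF fin_cols_psi _ _ fg])
  fix i ws and u :: "nat \<times> ('b \<times> 'n \<times> 'n) list"
  obtain d v where u: "u = (d, v)" by (cases u)
  obtain x :: "nat \<Rightarrow> 'b" and poss where ws: "ws = map (map x) poss"
      and c: "concat poss = [0..<length (concat ws)]"
    by (rule ex_blocks)
  then have d: "distinct (concat poss)" by simp
  have theta: "theta x poss v = c * theta x poss' v"
    if s: "set (concat poss') = set (concat poss)"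
      and t: "\<And>p :: nat \<Rightarrow> 'n \<times> 'n. trace_weight p poss' = (trace_weight p poss :: 'k)"
      and c: "\<And>p :: nat \<Rightarrow> 'n \<times> 'n. (symmetrize (spar W) (map (labelled x p) (concat poss)) v :: 'k)
        = c * symmetrize (spar W) (map (labelled x p) (concat poss')) v" for poss' c
    unfolding theta_def s t c by (simp only: sum_distrib_left mult.left_commute)
  { fix r assume "r < length ws"
    then have r: "r < length poss" by (simp add: ws)
    let ?poss = "poss[r := rotate1 (poss ! r)]"
    have mset: "mset (concat ?poss) = mset (concat poss)"
    proof -
      have "mset (rotate1 c) = mset c" for c :: "nat list" by (cases c) auto
      then show ?thesis
        by (subst (3) id_take_nth_drop[OF r]) (simp add: upd_conv_take_nth_drop[OF r])
    qed
    have d': "distinct (concat ?poss)" using d mset by (metis mset_eq_imp_distinct_iff)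
    have "theta x poss v = koszul (spar V) (map x (poss ! r)) (rotate1 [0..<length (poss ! r)]) * theta x ?poss v"
      using skew_rotate[where p = "spar V" and x = x, OF skew_labelled d r]
      by (intro theta trace_weight_rotate[OF r] mset_eq_setD[OF mset])
    then show "psi (i, ws) u = koszul (spar V) (ws ! r) (rotate1 [0..<length (ws ! r)])
        * psi (i, ws[r := rotate1 (ws ! r)]) u"
      unfolding u ws using r d d' by (simp add: map_list_update_rotate psi_eq) }
  { fix js assume "js \<in> permutations_of_set {..<length ws}"
    then have js: "js \<in> permutations_of_set {..<length poss}" by (simp add: ws)
    then have len: "length js = length poss"
      by (metis card_lessThan length_finite_permutations_of_set)
    let ?poss = "map ((!) poss) js"
    have "mset js = mset [0..<length poss]"
      using js by (intro iffD1[OF set_eq_iff_mset_eq_distinct])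
        (simp_all add: permutations_of_set_def lessThan_atLeast0)
    then have "mset ?poss = mset (map ((!) poss) [0..<length poss])"
      by (simp only: mset_map)
    then have mset: "mset ?poss = mset poss" by (simp add: map_nth)
    then have s: "set (concat ?poss) = set (concat poss)"
      using mset_eq_setD[OF mset] by simp
    have d': "distinct (concat ?poss)"
      using distinct_concat_nth[OF d] js by (simp add: permutations_of_set_def)
    have "theta x poss v = koszul (word_parity (spar V)) (map (map x) poss) js * theta x ?poss v"
      using skew_permute_words[where p = "spar V" and x = x, OF skew_labelled d js]
      by (intro theta s trace_weight_mset[OF mset])
    then show "psi (i, ws) u = koszul (word_parity (spar V)) ws js * psi (i, map ((!) ws) js) u"
      unfolding u ws map_nth_perm[OF js] psi_eq[OF d] psi_eq[OF d'] by (simp add: len) }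
qed

text \<open>The inverse form of \<open>W\<close> forces labels \<open>(k, l)\<close> at
  \<open>I\<close> and \<open>(l, k)\<close> at \<open>J\<close>, and all other labels stay free.
  The sum over \<open>k\<close> and \<open>l\<close> acts on the trace weight alone, and
  \<open>tr\<close> turns this weight into that of \<open>poss'\<close>. Joining and splitting are
  the two instances.\<close>

lemma theta_contraction:
  assumes d: "distinct (concat poss)" "distinct (concat poss')"
    and IJ: "I \<in> set (concat poss)" "J \<in> set (concat poss)" "I \<noteq> J"
    and s: "set (concat poss') = set (concat poss) - {I, J}"
    and tr: "\<And>p :: nat \<Rightarrow> 'n \<times> 'n. (\<Sum>k\<in>UNIV. \<Sum>l\<in>UNIV. trace_weight (p(I := (k, l), J := (l, k))) poss)
      = (trace_weight p poss' :: 'k)"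
  shows "order_sign (\<lambda>k. spar V (x k)) (I # J # concat poss') * inv_form V (x I) (x J) * theta x poss' u
    = (\<Sum>p\<in>labels (set (concat poss)).
        trace_weight p poss * contraction W (labelled x p) (set (concat poss)) I J u)"
proof -
  let ?L = "concat poss'" and ?X = "set (concat poss)" and ?X' = "set (concat poss')"
  let ?o = "order_sign (\<lambda>k. spar V (x k)) (I # J # ?L) :: 'k"
  let ?h = "inv_form V (x I) (x J)"
  let ?S = "\<lambda>p :: nat \<Rightarrow> 'n \<times> 'n. symmetrize (spar W) (map (labelled x p) ?L) u :: 'k"
  have X: "?X = insert J (insert I ?X')" using IJ s by auto
  have notin: "I \<notin> ?X'" "J \<notin> insert I ?X'" using IJ s by auto
  have cong: "map (labelled x (p(I := a, J := b))) ?L = map (labelled x p) ?L" for p :: "nat \<Rightarrow> 'n \<times> 'n" and a b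
    using notin by (auto simp: labelled_def)
  \<comment> \<open>The sign and the symmetrized rest do not see the labels at \<open>I\<close> and
    \<open>J\<close>, since parities come from the letters of \<open>V\<close> and the rest avoids
    both positions.\<close>
  have contr: "contraction W (labelled x (p(I := (k, l), J := (l', k')))) ?X I J u
      = of_bool (l' = l \<and> k' = k) * (?o * ?h * ?S p)" for p k l l' k'
  proof -
    have "inv_form W (labelled x (p(I := (k, l), J := (l', k'))) I) (labelled x (p(I := (k, l), J := (l', k'))) J)
        = ?h * of_bool (l' = l \<and> k' = k)"
      using IJ(3) by (auto simp: labelled_def W_form)
    note form = this
    show ?thesis
      unfolding contraction_eq[OF finite_set d(2) s] form cong
      by (simp del: order_sign.simps)
  qed
  have pairs: "(\<Sum>a\<in>UNIV. F a) = (\<Sum>k\<in>UNIV. \<Sum>l\<in>UNIV. F (k, l))" for F :: "'n \<times> 'n \<Rightarrow> 'k"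
    by (simp add: sum.cartesian_product case_prod_unfold)
  have "(\<Sum>p\<in>labels ?X. trace_weight p poss * contraction W (labelled x p) ?X I J u)
    = (\<Sum>b\<in>UNIV. \<Sum>a\<in>UNIV. \<Sum>p\<in>labels ?X'. trace_weight (p(I := a, J := b)) poss
        * contraction W (labelled x (p(I := a, J := b))) ?X I J u)"
    by (subst X, subst sum_labels_insert[OF notin(2)], subst sum_labels_insert[OF notin(1)]) (rule refl)
  also have "\<dots> = (\<Sum>a\<in>UNIV. \<Sum>b\<in>UNIV. \<Sum>p\<in>labels ?X'. trace_weight (p(I := a, J := b)) poss
        * contraction W (labelled x (p(I := a, J := b))) ?X I J u)"
    by (rule sum.swap)
  also have "\<dots> = (\<Sum>k\<in>UNIV. \<Sum>l\<in>UNIV. \<Sum>l'\<in>UNIV. \<Sum>k'\<in>UNIV. of_bool (l' = l \<and> k' = k) *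
      (\<Sum>p\<in>labels ?X'. trace_weight (p(I := (k, l), J := (l', k'))) poss * (?o * ?h * ?S p)))"
    unfolding pairs contr sum_distrib_left by (intro sum.cong refl) (simp only: mult_ac)
  also have "\<dots> = (\<Sum>k\<in>UNIV. \<Sum>l\<in>UNIV.
      (\<Sum>p\<in>labels ?X'. trace_weight (p(I := (k, l), J := (l, k))) poss * (?o * ?h * ?S p)))"
    by (intro sum.cong refl) (simp add: of_bool_conj mult.assoc sum_distrib_left[symmetric])
  also have "\<dots> = (\<Sum>p\<in>labels ?X'. (\<Sum>k\<in>UNIV. \<Sum>l\<in>UNIV. trace_weight (p(I := (k, l), J := (l, k))) poss)
      * (?o * ?h * ?S p))"
    unfolding sum_distrib_right by (subst sum.swap, subst (2) sum.swap, subst sum.swap) (rule sum.cong[OF refl], rule sum.swap)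
  also have "\<dots> = ?o * ?h * theta x poss' u"
    unfolding tr theta_def sum_distrib_left by (intro sum.cong refl) (simp only: mult_ac)
  finally show ?thesis ..
qed

end

lemma fin_cols_lin_ext_right:
  assumes T: "fin_cols2 T"
  shows "fin_cols (\<lambda>w. lin_ext (T w) g)"
proof (rule fin_colsI)
  fix u
  show "finite (fst ` {z. (case z of (w, v) \<Rightarrow> T w v) u \<noteq> 0})"
    using fin_colsD[OF T] by simp
  fix w assume "lin_ext (T w) g u \<noteq> 0"
  then obtain v where "T w v u \<noteq> 0" by (auto dest: lin_ext_nz)
  then show "w \<in> fst ` {z. (case z of (w, v) \<Rightarrow> T w v) u \<noteq> 0}"
    by (intro image_eqI[of _ _ "(w, v)"]) simp_all
qed

text \<open>A bound for the sources of \<open>us\<close>: a contraction removes two letters, which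
  lie in the basis \<open>B\<close>, and a joining lowers the number of words by one.\<close>

definition nc_bound :: "'b set \<Rightarrow> 'b list list \<Rightarrow> 'b list list set"
  where "nc_bound B us = {zs. set zs \<subseteq> {w. set w \<subseteq> set (concat us) \<union> B \<and> length w \<le> length (concat us) + 2}
    \<and> length zs \<le> Suc (length us)}"

lemma finite_nc_bound: "finite B \<Longrightarrow> finite (nc_bound B us)"
  unfolding nc_bound_def by (intro finite_lists_length_le) simp_all

lemma length_in_concat: "w \<in> set us \<Longrightarrow> length w \<le> length (concat us)"
  unfolding length_concat by (intro member_le_sum_list) auto

lemma mset_nth_rotate: "i < length c \<Longrightarrow> mset c = add_mset (c ! i) (mset (drop (Suc i) c @ take i c))"
  by (subst id_take_nth_drop) (simp_all add: add.commute)

lemma mset_inner_outer_arc: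
  assumes "i < j" "j < length c"
  shows "mset c = add_mset (c ! i) (add_mset (c ! j) (mset (inner_arc c i j @ outer_arc c i j)))"
proof -
  have "drop (Suc i) c = drop (Suc i) (take j c @ c ! j # drop (Suc j) c)"
    using id_take_nth_drop[OF assms(2)] by simp
  also have "\<dots> = inner_arc c i j @ c ! j # drop (Suc j) c"
    using assms by (simp add: inner_arc_def)
  finally show ?thesis
    using mset_nth_rotate[of i c] assms by (simp add: outer_arc_def)
qed

lemma mset_concat_del:
  "r < length poss \<Longrightarrow> mset (concat poss) = mset (poss ! r) + mset (concat (del r poss))"
  by (subst id_take_nth_drop[of r poss]) (simp_all add: del_def)

lemma mset_joined:
  assumes rs: "r < s" "s < length poss" and ij: "i < length (poss ! r)" "j < length (poss ! s)"
  shows "mset (concat poss) = mset (poss ! r ! i # poss ! s ! j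
    # concat (joined (poss ! r) (poss ! s) i j # del r (del s poss)))"
proof -
  have "mset (concat poss) = mset (poss ! s) + (mset (poss ! r) + mset (concat (del r (del s poss))))"
    using mset_concat_del[of s poss] mset_concat_del[of r "del s poss"] rs
    by (simp add: length_del nth_del)
  then show ?thesis
    by (simp add: mset_nth_rotate[OF ij(1)] mset_nth_rotate[OF ij(2)] joined_def)
qed

lemma mset_split:
  assumes r: "r < length poss" and ij: "i < j" "j < length (poss ! r)"
  shows "mset (concat poss) = mset (poss ! r ! i # poss ! r ! j
    # concat (take r poss @ [inner_arc (poss ! r) i j, outer_arc (poss ! r) i j] @ drop (Suc r) poss))"
  using mset_concat_del[OF r] mset_inner_outer_arc[OF ij] by (simp add: del_def)

lemma mset_Cons2D:
  assumes "mset N = mset (a # b # L)" "distinct N"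
  shows "a \<in> set N" "b \<in> set N" "a \<noteq> b" "distinct L" "set L = set N - {a, b}"
proof -
  have d: "distinct (a # b # L)" using assms by (metis mset_eq_imp_distinct_iff)
  moreover have "set N = set (a # b # L)" by (rule mset_eq_setD[OF assms(1)])
  ultimately show "a \<in> set N" "b \<in> set N" "a \<noteq> b" "distinct L" "set L = set N - {a, b}" by auto
qed

context odd_pairing
begin

lemma join_bound:
  assumes rs: "r < s" "s < length zs" and ij: "i < length (zs ! r)" "j < length (zs ! s)"
    and nz: "join_coeff V zs r s i j \<noteq> 0"
  shows "zs \<in> nc_bound (sbasis V) (joined (zs ! r) (zs ! s) i j # del r (del s zs))" (is "_ \<in> nc_bound _ ?us")
proof -
  have h: "zs ! r ! i \<in> sbasis V" "zs ! s ! j \<in> sbasis V"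
    using nz support by (auto simp: join_coeff_def)
  have set: "set zs = insert (zs ! s) (insert (zs ! r) (set (del r (del s zs))))"
    using set_insert_del[OF rs(2)] set_insert_del[of r "del s zs"] rs
    by (simp add: length_del nth_del)
  have "set (zs ! r) \<subseteq> set (concat ?us) \<union> sbasis V" "set (zs ! s) \<subseteq> set (concat ?us) \<union> sbasis V"
    using mset_eq_setD[of "zs ! r" "zs ! r ! i # (drop (Suc i) (zs ! r) @ take i (zs ! r))"]
      mset_eq_setD[of "zs ! s" "zs ! s ! j # (drop (Suc j) (zs ! s) @ take j (zs ! s))"]
      mset_nth_rotate[OF ij(1)] mset_nth_rotate[OF ij(2)] h
    by (auto simp: joined_def)
  moreover have "length (zs ! r) \<le> length (concat ?us) + 2" "length (zs ! s) \<le> length (concat ?us) + 2"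
    using ij by (auto simp: joined_def)
  moreover have "set w \<subseteq> set (concat ?us)" "length w \<le> length (concat ?us) + 2"
    if "w \<in> set (del r (del s zs))" for w
    using that length_in_concat[of w ?us] by auto
  moreover have "length zs \<le> Suc (length ?us)" using rs by (simp add: length_del)
  ultimately show ?thesis unfolding nc_bound_def mem_Collect_eq set by blast
qed

lemma split_bound:
  assumes r: "r < length zs" and ij: "i < j" "j < length (zs ! r)"
    and nz: "split_coeff V zs r i j \<noteq> 0"
  shows "zs \<in> nc_bound (sbasis V) (take r zs @ [inner_arc (zs ! r) i j, outer_arc (zs ! r) i j] @ drop (Suc r) zs)"
    (is "_ \<in> nc_bound _ ?us")
proof -
  have h: "zs ! r ! i \<in> sbasis V" "zs ! r ! j \<in> sbasis V"
    using nz support by (auto simp: split_coeff_def)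
  have set: "set zs = insert (zs ! r) (set (del r zs))"
    by (rule set_insert_del[OF r])
  have "mset (zs ! r) = mset (zs ! r ! i # zs ! r ! j # inner_arc (zs ! r) i j @ outer_arc (zs ! r) i j)"
    using mset_inner_outer_arc[OF ij] by simp
  then have "set (zs ! r) = set (zs ! r ! i # zs ! r ! j # inner_arc (zs ! r) i j @ outer_arc (zs ! r) i j)"
    "length (zs ! r) = length (zs ! r ! i # zs ! r ! j # inner_arc (zs ! r) i j @ outer_arc (zs ! r) i j)"
    by (rule mset_eq_setD, rule mset_eq_length)
  then have "set (zs ! r) \<subseteq> set (concat ?us) \<union> sbasis V" "length (zs ! r) \<le> length (concat ?us) + 2"
    using h by auto
  moreover have "set w \<subseteq> set (concat ?us)" "length w \<le> length (concat ?us) + 2"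
    if "w \<in> set (del r zs)" for w
    using that length_in_concat[of w ?us] by (auto simp: del_def)
  moreover have "length zs \<le> Suc (length ?us)" using r by simp
  ultimately show ?thesis unfolding nc_bound_def mem_Collect_eq set by blast
qed

lemma fin_cols_gamma_delta: "fin_cols (gamma_delta_mon V)"
proof (rule fin_colsI[where X = "\<lambda>(d, us). {..d} \<times> nc_bound (sbasis V) us"])
  fix x :: "nat \<times> 'b list list"
  obtain d us where x: "x = (d, us)" by (cases x)
  show "finite (case x of (d, us) \<Rightarrow> {..d} \<times> nc_bound (sbasis V) us)"
    by (simp add: x finite_nc_bound finite_basis)
  fix z assume nz: "gamma_delta_mon V z x \<noteq> 0"
  obtain k ws where z: "z = (k, ws)" by (cases z)
  show "z \<in> (case x of (d, us) \<Rightarrow> {..d} \<times> nc_bound (sbasis V) us)"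
  proof (rule ccontr)
    assume *: "\<not> ?thesis"
    have "gamma_delta_mon V (k, ws) x = 0"
      unfolding gamma_delta_mon_eq
    proof (intro sum.neutral ballI)
      fix r s i j assume "r \<in> {..<length ws}" "s \<in> {r<..<length ws}"
        "i \<in> {..<length (ws ! r)}" "j \<in> {..<length (ws ! s)}"
      then show "join_coeff V ws r s i j
          * single (Suc k, joined (ws ! r) (ws ! s) i j # del r (del s ws)) x = 0"
        using * join_bound[of r s ws i j] by (auto simp: x z single_def)
    qed
    with nz z show False by simp
  qed
qed

lemma fin_cols_nabla: "fin_cols (nabla_mon V)"
proof (rule fin_colsI[where X = "\<lambda>(d, us). {..d} \<times> nc_bound (sbasis V) us"])
  fix x :: "nat \<times> 'b list list"
  obtain d us where x: "x = (d, us)" by (cases x)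
  show "finite (case x of (d, us) \<Rightarrow> {..d} \<times> nc_bound (sbasis V) us)"
    by (simp add: x finite_nc_bound finite_basis)
  fix z assume nz: "nabla_mon V z x \<noteq> 0"
  obtain k ws where z: "z = (k, ws)" by (cases z)
  show "z \<in> (case x of (d, us) \<Rightarrow> {..d} \<times> nc_bound (sbasis V) us)"
  proof (rule ccontr)
    assume *: "\<not> ?thesis"
    have "nabla_mon V (k, ws) x = 0"
      unfolding nabla_mon_eq
    proof (intro sum.neutral ballI)
      fix r i j assume "r \<in> {..<length ws}" "i \<in> {..<length (ws ! r)}" "j \<in> {i<..<length (ws ! r)}"
      then show "split_coeff V ws r i j
          * single (k, take r ws @ [inner_arc (ws ! r) i j, outer_arc (ws ! r) i j] @ drop (Suc r) ws) x = 0"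
        using * split_bound[of r ws i j] by (auto simp: x z single_def)
    qed
    with nz z show False by simp
  qed
qed

lemma fin_cols_nc_bracket: "fin_cols2 (nc_bracket_mon V)"
proof (rule fin_colsI[where X = "\<lambda>(d, us). ({..d} \<times> nc_bound (sbasis V) us) \<times> ({..d} \<times> nc_bound (sbasis V) us)"])
  fix x :: "nat \<times> 'b list list"
  obtain d us where x: "x = (d, us)" by (cases x)
  show "finite (case x of (d, us) \<Rightarrow> ({..d} \<times> nc_bound (sbasis V) us) \<times> ({..d} \<times> nc_bound (sbasis V) us))"
    by (simp add: x finite_nc_bound finite_basis)
  fix z assume nz: "(case z of (w, v) \<Rightarrow> nc_bracket_mon V w v) x \<noteq> 0"
  obtain k ws l vs where z: "z = ((k, ws), (l, vs))" by (metis surj_pair)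
  have app: "ws \<in> nc_bound (sbasis V) us \<and> vs \<in> nc_bound (sbasis V) us"
    if "ws @ vs \<in> nc_bound (sbasis V) us" using that by (auto simp: nc_bound_def)
  show "z \<in> (case x of (d, us) \<Rightarrow> ({..d} \<times> nc_bound (sbasis V) us) \<times> ({..d} \<times> nc_bound (sbasis V) us))"
  proof (rule ccontr)
    assume *: "\<not> ?thesis"
    have "nc_bracket_mon V (k, ws) (l, vs) x = 0"
      unfolding nc_bracket_mon_eq
    proof (intro sum.neutral ballI)
      fix r s i j assume rs: "r \<in> {..<length ws}" "s \<in> {..<length vs}"
        and ij: "i \<in> {..<length (ws ! r)}" "j \<in> {..<length (vs ! s)}"
      have nth: "(ws @ vs) ! r = ws ! r" "(ws @ vs) ! (length ws + s) = vs ! s"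
        "del r (del (length ws + s) (ws @ vs)) = del r ws @ del s vs"
        using rs by (simp_all add: nth_append del_append)
      have "join_coeff V (ws @ vs) r (length ws + s) i j = 0"
        if "d = k + l" "us = joined (ws ! r) (vs ! s) i j # del r ws @ del s vs"
        using * app that join_bound[of r "length ws + s" "ws @ vs" i j] rs ij
        unfolding nth by (auto simp: x z)
      then show "join_coeff V (ws @ vs) r (length ws + s) i j
        * single (k + l, joined (ws ! r) (vs ! s) i j # del r ws @ del s vs) x = 0"
        by (auto simp: x single_def)
    qed
    with nz z show False by simp
  qed
qed

end

context matrix_pairing
begin

lemma W_form_fst: "inv_form W y z = inv_form V (fst y) (fst z) * of_bool (fst (snd y) = snd (snd z) \<and> snd (snd y) = fst (snd z))"
  using W_form[of "fst y" "fst (snd y)" "snd (snd y)" "fst z" "fst (snd z)" "snd (snd z)"] by simp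

lemma theta_join:
  assumes d: "distinct (concat poss)" and one: "order_sign (\<lambda>k. spar V (x k)) (concat poss) = (1 :: 'k)"
    and rs: "r < s" "s < length poss" and ij: "i < length (poss ! r)" "j < length (poss ! s)"
  shows "join_coeff V (map (map x) poss) r s i j
      * theta x (joined (poss ! r) (poss ! s) i j # del r (del s poss)) u
    = (\<Sum>p\<in>labels (set (concat poss)). trace_weight p poss
        * contraction W (labelled x p) (set (concat poss)) (poss ! r ! i) (poss ! s ! j) u)"
proof -
  note D = mset_Cons2D[OF mset_joined[OF rs ij] d]
  have "join_coeff V (map (map x) poss) r s i j
    = order_sign (\<lambda>k. spar V (x k)) (poss ! r ! i # poss ! s ! j
        # concat (joined (poss ! r) (poss ! s) i j # del r (del s poss)))
      * inv_form V (x (poss ! r ! i)) (x (poss ! s ! j))"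
    using rs ij by (simp add: join_coeff_def join_sign[where p = "spar V" and x = x, OF d one rs ij] del: order_sign.simps concat.simps)
  then show ?thesis
    using theta_contraction[OF d D(4) D(1,2,3,5) trace_join[OF d rs ij], of x u] by simp
qed

lemma theta_split:
  assumes d: "distinct (concat poss)" and one: "order_sign (\<lambda>k. spar V (x k)) (concat poss) = (1 :: 'k)"
    and r: "r < length poss" and ij: "i < j" "j < length (poss ! r)"
  shows "split_coeff V (map (map x) poss) r i j
      * theta x (take r poss @ [inner_arc (poss ! r) i j, outer_arc (poss ! r) i j] @ drop (Suc r) poss) u
    = (\<Sum>p\<in>labels (set (concat poss)). trace_weight p poss
        * contraction W (labelled x p) (set (concat poss)) (poss ! r ! i) (poss ! r ! j) u)"
\<comment> \<open>\<open>split_sign\<close> asks for opposite parities, which are known only if the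
  two letters pair.\<close>
proof (cases "inv_form V (x (poss ! r ! i)) (x (poss ! r ! j)) = 0")
  case True
  then have "contraction W (labelled x p) (set (concat poss)) (poss ! r ! i) (poss ! r ! j) u = 0" for p
    unfolding contraction_def Let_def by (simp add: W_form_fst)
  then show ?thesis using True r ij by (simp add: split_coeff_def)
next
  case False
  then have odd: "spar V (x (poss ! r ! i)) \<noteq> spar V (x (poss ! r ! j))" by (rule form_odd)
  note D = mset_Cons2D[OF mset_split[OF r ij] d]
  have "split_coeff V (map (map x) poss) r i j
    = order_sign (\<lambda>k. spar V (x k)) (poss ! r ! i # poss ! r ! j
        # concat (take r poss @ [inner_arc (poss ! r) i j, outer_arc (poss ! r) i j] @ drop (Suc r) poss))
      * inv_form V (x (poss ! r ! i)) (x (poss ! r ! j))"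
    using r ij by (simp add: split_coeff_def split_sign[where p = "spar V" and x = x, OF d one r ij odd] del: order_sign.simps concat_append)
  then show ?thesis
    using theta_contraction[OF d D(4) D(1,2,3,5) trace_split[OF d r ij], of x u] by simp
qed

lemma lin_ext_hbar_Delta_phi:
  assumes d: "distinct (concat poss)" and one: "order_sign (\<lambda>k. spar V (x k)) (concat poss) = (1 :: 'k)"
  shows "lin_ext (com_sym (spar W)) (lin_ext (hbar_Delta_mon W) (phi (k, map (map x) poss))) (e, u)
    = of_bool (e = Suc (2 * k + length poss - 1))
      * (\<Sum>i<length (concat poss). \<Sum>j\<in>{i<..<length (concat poss)}.
          \<Sum>p\<in>labels (set (concat poss)). trace_weight p poss
            * contraction W (labelled x p) (set (concat poss)) (concat poss ! i) (concat poss ! j) u)"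
proof -
  have "lin_ext (com_sym (spar W)) (lin_ext (hbar_Delta_mon W) (phi (k, map (map x) poss))) (e, u)
    = (\<Sum>p\<in>labels (set (concat poss)). trace_weight p poss * (of_bool (e = Suc (2 * k + length poss - 1))
      * (\<Sum>i<length (concat poss). \<Sum>j\<in>{i<..<length (concat poss)}.
          contraction W (labelled x p) (set (concat poss)) (concat poss ! i) (concat poss ! j) u)))"
    unfolding lin_ext_lin_ext[OF W.fin_cols_hbar_Delta fin_cols_com_sym]
      lin_ext_phi[OF fin_cols_lin_ext[OF W.fin_cols_hbar_Delta fin_cols_com_sym] d]
      W.sym_hbar_Delta W.symmetrize_word_Delta[OF d]
    by (simp add: one)
  also have "\<dots> = of_bool (e = Suc (2 * k + length poss - 1))
      * (\<Sum>p\<in>labels (set (concat poss)). \<Sum>i<length (concat poss). \<Sum>j\<in>{i<..<length (concat poss)}.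
          trace_weight p poss
            * contraction W (labelled x p) (set (concat poss)) (concat poss ! i) (concat poss ! j) u)"
    by (simp only: sum_distrib_left mult.left_commute)
  also have "(\<Sum>p\<in>labels (set (concat poss)). \<Sum>i<length (concat poss). \<Sum>j\<in>{i<..<length (concat poss)}.
          trace_weight p poss
            * contraction W (labelled x p) (set (concat poss)) (concat poss ! i) (concat poss ! j) u)
    = (\<Sum>i<length (concat poss). \<Sum>j\<in>{i<..<length (concat poss)}. \<Sum>p\<in>labels (set (concat poss)).
          trace_weight p poss
            * contraction W (labelled x p) (set (concat poss)) (concat poss ! i) (concat poss ! j) u)"
    by (subst sum.swap) (intro sum.cong refl, rule sum.swap)
  finally show ?thesis .
qed

text \<open>Each contraction of two letters in the image is matched with one term on the
  noncommutative side: a splitting if the letters lie in one word, a joining if they lie in two.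
  \<open>sum_pairs_concat\<close> assembles all pairs.\<close>

lemma psi_nabla_gamma_delta:
  "lin_ext psi (\<lambda>y. nabla_mon V z y + gamma_delta_mon V z y)
    = lin_ext (com_sym (spar W)) (lin_ext (hbar_Delta_mon W) (phi z))"
proof
  fix v :: "nat \<times> ('b \<times> 'n \<times> 'n) list"
  obtain e u where v: "v = (e, u)" by (cases v)
  obtain k ws where z: "z = (k, ws)" by (cases z)
  obtain x :: "nat \<Rightarrow> 'b" and poss where ws: "ws = map (map x) poss"
      and c: "concat poss = [0..<length (concat ws)]"
    by (rule ex_blocks)
  have d: "distinct (concat poss)" and one: "order_sign (\<lambda>k. spar V (x k)) (concat poss) = (1 :: 'k)"
    by (simp_all add: c)
  let ?E = "of_bool (e = Suc (2 * k + length poss - 1)) :: 'k"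
  let ?C = "\<lambda>I J. \<Sum>p\<in>labels (set (concat poss)). trace_weight p poss
            * contraction W (labelled x p) (set (concat poss)) I J u"
  have "lin_ext psi (nabla_mon V z) v = (\<Sum>r<length poss. \<Sum>i<length (poss ! r). \<Sum>j\<in>{i<..<length (poss ! r)}.
      ?E * ?C (poss ! r ! i) (poss ! r ! j))"
    unfolding z nabla_mon_eq lin_ext_sum[OF fin_cols_psi] lin_ext_scale[OF fin_cols_psi] lin_ext_single ws length_map
  proof (intro sum.cong)
    fix r i j assume "r \<in> {..<length poss}" "i \<in> {..<length (poss ! r)}" "j \<in> {i<..<length (poss ! r)}"
    then have r: "r < length poss" and ij: "i < j" "j < length (poss ! r)" by auto
    let ?poss = "take r poss @ [inner_arc (poss ! r) i j, outer_arc (poss ! r) i j] @ drop (Suc r) poss"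
    have eq: "take r (map (map x) poss) @ [inner_arc (map (map x) poss ! r) i j, outer_arc (map (map x) poss ! r) i j]
        @ drop (Suc r) (map (map x) poss) = map (map x) ?poss"
      using r by (simp add: take_map drop_map map_inner_arc map_outer_arc)
    have d': "distinct (concat ?poss)" by (rule mset_Cons2D(4)[OF mset_split[OF r ij] d])
    \<comment> \<open>One more word at the same power of \<open>\<gamma>\<close> raises the exponent
      by one. The truncated subtraction is exact because there is at least one word.\<close>
    have E: "of_bool (e = 2 * k + length ?poss - 1) = ?E" using r by auto
    show "split_coeff V (map (map x) poss) r i j * psi (k, take r (map (map x) poss) @
          [inner_arc (map (map x) poss ! r) i j, outer_arc (map (map x) poss ! r) i j] @ drop (Suc r) (map (map x) poss)) v
      = ?E * ?C (poss ! r ! i) (poss ! r ! j)"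
      unfolding eq v psi_eq[OF d'] E theta_split[OF d one r ij, symmetric] by (rule mult.left_commute)
  qed simp_all
  moreover have "lin_ext psi (gamma_delta_mon V z) v = (\<Sum>r<length poss. \<Sum>s\<in>{r<..<length poss}.
      \<Sum>i<length (poss ! r). \<Sum>j<length (poss ! s). ?E * ?C (poss ! r ! i) (poss ! s ! j))"
    unfolding z gamma_delta_mon_eq lin_ext_sum[OF fin_cols_psi] lin_ext_scale[OF fin_cols_psi] lin_ext_single ws length_map
  proof (intro sum.cong)
    fix r s i j assume "r \<in> {..<length poss}" "s \<in> {r<..<length poss}"
      "i \<in> {..<length (poss ! r)}" "j \<in> {..<length (poss ! s)}"
    then have rs: "r < s" "s < length poss" and ij: "i < length (poss ! r)" "j < length (poss ! s)" by auto
    let ?poss = "joined (poss ! r) (poss ! s) i j # del r (del s poss)"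
    have eq: "joined (map (map x) poss ! r) (map (map x) poss ! s) i j # del r (del s (map (map x) poss))
      = map (map x) ?poss"
      using rs by (simp add: map_joined map_del)
    have d': "distinct (concat ?poss)" by (rule mset_Cons2D(4)[OF mset_joined[OF rs ij] d])
    \<comment> \<open>One word fewer, but the new \<open>\<gamma>\<close> counts twice, so the
      exponent again rises by one.\<close>
    have E: "of_bool (e = 2 * Suc k + length ?poss - 1) = ?E" using rs by (auto simp: length_del)
    show "join_coeff V (map (map x) poss) r s i j * psi (Suc k, joined (map (map x) poss ! r) (map (map x) poss ! s) i j
          # del r (del s (map (map x) poss))) v
      = ?E * ?C (poss ! r ! i) (poss ! s ! j)"
      unfolding eq v psi_eq[OF d'] E theta_join[OF d one rs ij, symmetric] by (rule mult.left_commute)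
  qed simp_all
  ultimately show "lin_ext psi (\<lambda>y. nabla_mon V z y + gamma_delta_mon V z y) v
    = lin_ext (com_sym (spar W)) (lin_ext (hbar_Delta_mon W) (phi z)) v"
    unfolding lin_ext_add[OF fin_cols_psi] z v ws lin_ext_hbar_Delta_phi[OF d one]
      sum_pairs_concat[where c = ?C] distrib_left sum_distrib_left
    by (simp only:)
qed

text \<open>Both arguments are numbered on one list of positions, so \<open>A\<close> and
  \<open>B\<close> carry independent labels. The commutative bracket contracts a letter of
  \<open>A\<close> with one of \<open>B\<close>, and these contractions are exactly the joinings in
  the noncommutative bracket.\<close>

lemma psi_nc_bracket:
  "lin_ext psi (nc_bracket_mon V z z')
    = lin_ext (com_sym (spar W)) (bilin_ext (com_bracket_mon W) (phi z) (phi z'))"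
proof
  fix v :: "nat \<times> ('b \<times> 'n \<times> 'n) list"
  obtain e u where v: "v = (e, u)" by (cases v)
  obtain k ws where z: "z = (k, ws)" by (cases z)
  obtain l vs where z': "z' = (l, vs)" by (cases z')
  obtain x :: "nat \<Rightarrow> 'b" and poss where wsvs: "ws @ vs = map (map x) poss"
      and c: "concat poss = [0..<length (concat (ws @ vs))]"
    by (rule ex_blocks)
  define A B where "A = take (length ws) poss" and "B = drop (length ws) poss"
  have poss: "poss = A @ B" by (simp add: A_def B_def)
  have ws: "ws = map (map x) A" and vs: "vs = map (map x) B"
    using arg_cong[OF wsvs, of "take (length ws)"] arg_cong[OF wsvs, of "drop (length ws)"]
    by (simp_all add: A_def B_def take_map drop_map)
  have d: "distinct (concat poss)" and one: "order_sign (\<lambda>k. spar V (x k)) (concat poss) = (1 :: 'k)"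
    by (simp_all add: c)
  have dAB: "distinct (concat A @ concat B)" and oneAB: "order_sign (\<lambda>k. spar V (x k)) (concat A @ concat B) = (1 :: 'k)"
    using d one by (simp_all add: poss)
  then have dA: "distinct (concat A)" and dB: "distinct (concat B)"
    and disj: "set (concat A) \<inter> set (concat B) = {}" by auto
  let ?E = "of_bool (e = (2 * k + length A - 1) + (2 * l + length B - 1)) :: 'k"
  let ?C = "\<lambda>I J. \<Sum>p\<in>labels (set (concat poss)). trace_weight p poss
            * contraction W (labelled x p) (set (concat poss)) I J u"
  define T where "T = (\<lambda>w v. lin_ext (com_sym (spar W)) (com_bracket_mon W w v))"
  have T: "fin_cols2 T"
    unfolding T_def by (rule fin_cols2_lin_ext[OF W.fin_cols_com_bracket fin_cols_com_sym])
  have Teq: "T (a, map (labelled x p) (concat A)) (b, map (labelled x p) (concat B)) (e, u)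
    = of_bool (e = a + b) * (\<Sum>I\<in>set (concat A). \<Sum>J\<in>set (concat B).
        contraction W (labelled x p) (set (concat poss)) I J u)" for a b p
    unfolding T_def W.sym_com_bracket symmetrize_word_bracket[OF dAB]
    using oneAB by (simp add: poss)
  have "lin_ext (com_sym (spar W)) (bilin_ext (com_bracket_mon W) (phi z) (phi z')) v
    = bilin_ext T (phi z) (phi z') v"
    unfolding lin_ext_bilin_ext[OF W.fin_cols_com_bracket fin_cols_com_sym] T_def ..
  also have "\<dots> = (\<Sum>p1\<in>labels (set (concat A)). trace_weight p1 A *
      (\<Sum>p2\<in>labels (set (concat B)). trace_weight p2 B *
        T (2 * k + length A - 1, map (labelled x p1) (concat A))
          (2 * l + length B - 1, map (labelled x p2) (concat B)) v))"
    unfolding z z' ws vs bilin_ext_right[OF T]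
    by (subst lin_ext_phi[OF fin_cols_lin_ext_right[OF T] dA])
      (simp only: lin_ext_phi[OF fin_cols_right[OF T] dB])
  \<comment> \<open>The sums over the labels of \<open>A\<close> and of \<open>B\<close> combine
    into one over the labellings of all positions.\<close>
  also have "\<dots> = (\<Sum>p\<in>labels (set (concat poss)). trace_weight p poss *
        T (2 * k + length A - 1, map (labelled x p) (concat A))
          (2 * l + length B - 1, map (labelled x p) (concat B)) v)"
  proof -
    have X: "set (concat poss) = set (concat A) \<union> set (concat B)" by (simp add: poss)
    have agree: "trace_weight (\<lambda>k. if k \<in> set (concat A) then p1 k else p2 k) A = (trace_weight p1 A :: 'k)"
      "trace_weight (\<lambda>k. if k \<in> set (concat A) then p1 k else p2 k) B = (trace_weight p2 B :: 'k)"
      "map (labelled x (\<lambda>k. if k \<in> set (concat A) then p1 k else p2 k)) (concat A) = map (labelled x p1) (concat A)"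
      "map (labelled x (\<lambda>k. if k \<in> set (concat A) then p1 k else p2 k)) (concat B) = map (labelled x p2) (concat B)"
      for p1 p2 :: "nat \<Rightarrow> 'n \<times> 'n"
    proof -
      have notin: "k \<notin> set (concat A)" if "k \<in> set (concat B)" for k
        using disj that by blast
      show "trace_weight (\<lambda>k. if k \<in> set (concat A) then p1 k else p2 k) A = (trace_weight p1 A :: 'k)"
        "trace_weight (\<lambda>k. if k \<in> set (concat A) then p1 k else p2 k) B = (trace_weight p2 B :: 'k)"
        by (rule trace_weight_cong, simp only: notin simp_thms if_True if_False)+
      show "map (labelled x (\<lambda>k. if k \<in> set (concat A) then p1 k else p2 k)) (concat A) = map (labelled x p1) (concat A)"
        "map (labelled x (\<lambda>k. if k \<in> set (concat A) then p1 k else p2 k)) (concat B) = map (labelled x p2) (concat B)"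
        by (rule map_cong[OF refl], simp only: labelled_def notin simp_thms if_True if_False)+
    qed
    show ?thesis
      unfolding X sum_labels_Un[OF finite_set disj] unfolding poss trace_weight_simps(3) agree sum_distrib_left
      by (simp only: mult.assoc)
  qed
  also have "\<dots> = (\<Sum>p\<in>labels (set (concat poss)). \<Sum>I\<in>set (concat A). \<Sum>J\<in>set (concat B).
      ?E * (trace_weight p poss * contraction W (labelled x p) (set (concat poss)) I J u))"
    unfolding v Teq sum_distrib_left by (simp only: mult.left_commute)
  also have "\<dots> = (\<Sum>I\<in>set (concat A). \<Sum>J\<in>set (concat B). ?E * ?C I J)"
    unfolding sum_distrib_left by (subst sum.swap) (intro sum.cong refl, rule sum.swap)
  also have "\<dots> = (\<Sum>r<length A. \<Sum>i<length (A ! r). \<Sum>s<length B. \<Sum>j<length (B ! s).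
      ?E * ?C (A ! r ! i) (B ! s ! j))"
    unfolding sum_set_nth[OF dA] sum_set_nth[OF dB] sum_nth_concat[where P = B and g = "\<lambda>J. ?E * ?C _ J"]
    by (rule sum_nth_concat[where g = "\<lambda>I. \<Sum>s<length B. \<Sum>j<length (B ! s). ?E * ?C I (B ! s ! j)"])
  also have "\<dots> = (\<Sum>r<length A. \<Sum>s<length B. \<Sum>i<length (A ! r). \<Sum>j<length (B ! s).
      ?E * ?C (A ! r ! i) (B ! s ! j))"
    by (rule sum.cong[OF refl], rule sum.swap)
  also have "\<dots> = lin_ext psi (nc_bracket_mon V z z') v"
  proof (rule sym)
    show "lin_ext psi (nc_bracket_mon V z z') v = (\<Sum>r<length A. \<Sum>s<length B. \<Sum>i<length (A ! r). \<Sum>j<length (B ! s).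
      ?E * ?C (A ! r ! i) (B ! s ! j))"
    unfolding z z' nc_bracket_mon_eq lin_ext_sum[OF fin_cols_psi] lin_ext_scale[OF fin_cols_psi] lin_ext_single
      wsvs unfolding ws vs length_map
  proof (intro sum.cong)
    fix r s i j assume "r \<in> {..<length A}" "s \<in> {..<length B}"
      "i \<in> {..<length (A ! r)}" "j \<in> {..<length (B ! s)}"
    then have r: "r < length A" and s: "s < length B" and i: "i < length (A ! r)" and j: "j < length (B ! s)"
      by auto
    let ?s = "length A + s"
    have nth: "poss ! r = A ! r" "poss ! ?s = B ! s" "del r (del ?s poss) = del r A @ del s B"
      using r by (simp_all add: poss nth_append del_append)
    have rs: "r < ?s" "?s < length poss" using r s by (simp_all add: poss)
    have ij: "i < length (poss ! r)" "j < length (poss ! ?s)" using i j by (simp_all add: nth)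
    let ?poss = "joined (A ! r) (B ! s) i j # del r A @ del s B"
    have eq: "joined (map (map x) A ! r) (map (map x) B ! s) i j # del r (map (map x) A) @ del s (map (map x) B)
      = map (map x) ?poss"
      using r s by (simp add: map_joined map_del)
    have d': "distinct (concat ?poss)"
      using mset_Cons2D(4)[OF mset_joined[OF rs ij] d] unfolding nth .
    \<comment> \<open>Two of the words merge into one, so the number of words minus one is the sum
      of these numbers for the two arguments.\<close>
    have E: "of_bool (e = 2 * (k + l) + length ?poss - 1) = ?E" using r s by (auto simp: length_del)
    show "join_coeff V (map (map x) poss) r ?s i j
        * psi (k + l, joined (map (map x) A ! r) (map (map x) B ! s) i j
            # del r (map (map x) A) @ del s (map (map x) B)) v = ?E * ?C (A ! r ! i) (B ! s ! j)"
      unfolding eq v psi_eq[OF d'] E theta_join[OF d one rs ij, of u, unfolded nth, symmetric]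
      by (rule mult.left_commute)
    qed simp_all
  qed
  finally show "lin_ext psi (nc_bracket_mon V z z') v
    = lin_ext (com_sym (spar W)) (bilin_ext (com_bracket_mon W) (phi z) (phi z')) v" ..
qed

end

section \<open>The maps on classes\<close>

lemma set_joined: "set (joined v w i j) \<subseteq> set v \<union> set w"
  unfolding joined_def by (auto dest: in_set_dropD in_set_takeD)

lemma set_inner_arc: "set (inner_arc w i j) \<subseteq> set w"
  unfolding inner_arc_def by (auto dest: in_set_dropD in_set_takeD)

lemma set_outer_arc: "set (outer_arc w i j) \<subseteq> set w"
  unfolding outer_arc_def by (auto dest: in_set_dropD in_set_takeD)

lemma set_nth_concat: "r < length ws \<Longrightarrow> set (ws ! r) \<subseteq> set (concat ws)"
  by (auto intro: bexI[OF _ nth_mem])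

lemma set_concat_del: "set (concat (del r ws)) \<subseteq> set (concat ws)"
  by (auto simp: del_def dest: in_set_dropD in_set_takeD)

context odd_pairing
begin

lemma nc_bracket_nz:
  assumes "nc_bracket_mon V (k, ws) (l, vs) (m, us) \<noteq> 0"
  shows "us \<noteq> [] \<and> set (concat us) \<subseteq> set (concat ws) \<union> set (concat vs)"
proof (rule ccontr)
  assume *: "\<not> ?thesis"
  have "nc_bracket_mon V (k, ws) (l, vs) (m, us) = 0"
    unfolding nc_bracket_mon_eq
  proof (intro sum.neutral ballI)
    fix r s i j assume rs: "r \<in> {..<length ws}" "s \<in> {..<length vs}"
    then have "set (joined (ws ! r) (vs ! s) i j) \<subseteq> set (concat ws) \<union> set (concat vs)"
      using set_joined[of "ws ! r" "vs ! s" i j] set_nth_concat[of r ws] set_nth_concat[of s vs] by auto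
    moreover have "set (concat (del r ws)) \<subseteq> set (concat ws)" "set (concat (del s vs)) \<subseteq> set (concat vs)"
      by (rule set_concat_del)+
    ultimately have "set (concat (joined (ws ! r) (vs ! s) i j # del r ws @ del s vs)) \<subseteq> set (concat ws) \<union> set (concat vs)"
      unfolding concat.simps concat_append set_append by blast
    then have "us \<noteq> joined (ws ! r) (vs ! s) i j # del r ws @ del s vs"
      using * by blast
    then show "join_coeff V (ws @ vs) r (length ws + s) i j
        * single (k + l, joined (ws ! r) (vs ! s) i j # del r ws @ del s vs) (m, us) = 0"
      by (simp add: single_def)
  qed
  with assms show False by simp
qed

lemma gamma_delta_nz:
  assumes "gamma_delta_mon V (k, ws) (m, us) \<noteq> 0"
  shows "us \<noteq> [] \<and> set (concat us) \<subseteq> set (concat ws)"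
proof (rule ccontr)
  assume *: "\<not> ?thesis"
  have "gamma_delta_mon V (k, ws) (m, us) = 0"
    unfolding gamma_delta_mon_eq
  proof (intro sum.neutral ballI)
    fix r s i j assume rs: "r \<in> {..<length ws}" "s \<in> {r<..<length ws}"
    then have "set (joined (ws ! r) (ws ! s) i j) \<subseteq> set (concat ws)"
      using set_joined[of "ws ! r" "ws ! s" i j] set_nth_concat[of r ws] set_nth_concat[of s ws] by auto
    moreover have "set (concat (del r (del s ws))) \<subseteq> set (concat ws)"
      using set_concat_del[of r "del s ws"] set_concat_del[of s ws] by (rule subset_trans)
    ultimately have "set (concat (joined (ws ! r) (ws ! s) i j # del r (del s ws))) \<subseteq> set (concat ws)"
      unfolding concat.simps set_append by blast
    then have "us \<noteq> joined (ws ! r) (ws ! s) i j # del r (del s ws)"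
      using * by blast
    then show "join_coeff V ws r s i j
        * single (Suc k, joined (ws ! r) (ws ! s) i j # del r (del s ws)) (m, us) = 0"
      by (simp add: single_def)
  qed
  with assms show False by simp
qed

lemma nabla_nz:
  assumes "nabla_mon V (k, ws) (m, us) \<noteq> 0"
  shows "us \<noteq> [] \<and> set (concat us) \<subseteq> set (concat ws)"
proof (rule ccontr)
  assume *: "\<not> ?thesis"
  have "nabla_mon V (k, ws) (m, us) = 0"
    unfolding nabla_mon_eq
  proof (intro sum.neutral ballI)
    fix r i j assume r: "r \<in> {..<length ws}"
    then have "set (inner_arc (ws ! r) i j) \<subseteq> set (concat ws)" "set (outer_arc (ws ! r) i j) \<subseteq> set (concat ws)"
      using set_inner_arc[of "ws ! r" i j] set_outer_arc[of "ws ! r" i j] set_nth_concat[of r ws] by auto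
    moreover have "set (concat (take r ws)) \<subseteq> set (concat ws)" "set (concat (drop (Suc r) ws)) \<subseteq> set (concat ws)"
      by (auto dest: in_set_dropD in_set_takeD)
    ultimately have "set (concat (take r ws @ [inner_arc (ws ! r) i j, outer_arc (ws ! r) i j] @ drop (Suc r) ws)) \<subseteq> set (concat ws)"
      unfolding concat.simps concat_append set_append list.set by blast
    then have "us \<noteq> take r ws @ [inner_arc (ws ! r) i j, outer_arc (ws ! r) i j] @ drop (Suc r) ws"
      using * by blast
    then show "split_coeff V ws r i j
        * single (k, take r ws @ [inner_arc (ws ! r) i j, outer_arc (ws ! r) i j] @ drop (Suc r) ws) (m, us) = 0"
      by (simp add: single_def)
  qed
  with assms show False by simp
qed

lemma nc_series_iff: "f \<in> nc_series V \<longleftrightarrow> (\<forall>i ws. f (i, ws) \<noteq> 0 \<longrightarrow> ws \<noteq> [] \<and> set (concat ws) \<subseteq> sbasis V)"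
  unfolding nc_series_def by (auto simp: lists_eq_set subset_iff)

lemma nc_bracket_series:
  assumes "f \<in> nc_series V" "g \<in> nc_series V"
  shows "bilin_ext (nc_bracket_mon V) f g \<in> nc_series V"
  unfolding nc_series_iff
proof (intro allI impI)
  fix m us assume "bilin_ext (nc_bracket_mon V) f g (m, us) \<noteq> 0"
  then obtain k ws l vs where nz: "f (k, ws) \<noteq> 0" "g (l, vs) \<noteq> 0" "nc_bracket_mon V (k, ws) (l, vs) (m, us) \<noteq> 0"
    by (metis bilin_ext_nz surj_pair)
  have "set (concat ws) \<subseteq> sbasis V" "set (concat vs) \<subseteq> sbasis V"
    using assms nz(1,2) unfolding nc_series_iff by blast+
  with nc_bracket_nz[OF nz(3)] show "us \<noteq> [] \<and> set (concat us) \<subseteq> sbasis V" by blast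
qed

lemma nc_differential_series:
  assumes "f \<in> nc_series V"
  shows "lin_ext (nabla_mon V) f + lin_ext (gamma_delta_mon V) f \<in> nc_series V"
  unfolding nc_series_iff
proof (intro allI impI)
  fix m us assume "(lin_ext (nabla_mon V) f + lin_ext (gamma_delta_mon V) f) (m, us) \<noteq> 0"
  then consider "lin_ext (nabla_mon V) f (m, us) \<noteq> 0" | "lin_ext (gamma_delta_mon V) f (m, us) \<noteq> 0"
    by fastforce
  then obtain k ws where nz: "f (k, ws) \<noteq> 0" "nabla_mon V (k, ws) (m, us) \<noteq> 0 \<or> gamma_delta_mon V (k, ws) (m, us) \<noteq> 0"
    by cases (metis lin_ext_nz surj_pair)+
  have "set (concat ws) \<subseteq> sbasis V"
    using assms nz(1) unfolding nc_series_iff by blast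
  with nz(2) show "us \<noteq> [] \<and> set (concat us) \<subseteq> sbasis V"
    using nabla_nz[of k ws m us] gamma_delta_nz[of k ws m us] by blast
qed

lemma nc_class_mem: "f \<in> nc_series V \<Longrightarrow> f \<in> nc_eq V `` {f}"
  unfolding nc_eq_def by (simp add: eq_mod_refl)

lemma nc_eq_series: "(f, g) \<in> nc_eq V \<Longrightarrow> f \<in> nc_series V \<and> g \<in> nc_series V"
  by (simp add: nc_eq_def eq_mod_def)

end

context matrix_pairing
begin

lemma morita_series:
  assumes "f \<in> nc_series V"
  shows "lin_ext morita_mon f \<in> nc_series W"
  unfolding W.nc_series_iff
proof (intro allI impI)
  fix k and us :: "('b \<times> 'n \<times> 'n) list list" assume "lin_ext morita_mon f (k, us) \<noteq> 0"
  then obtain i ws where nz: "f (i, ws) \<noteq> 0" "morita_mon (i, ws) (k, us) \<noteq> (0 :: 'k)"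
    by (metis lin_ext_nz surj_pair)
  then have us: "map (map fst) us = ws" by (auto simp: morita_mon_eq simp del: morita_mon.simps split: if_splits)
  have "ws \<noteq> []" "set (concat ws) \<subseteq> sbasis V"
    using assms nz(1) unfolding nc_series_iff by blast+
  moreover have "set (concat ws) = fst ` set (concat us)"
    unfolding us[symmetric] by auto
  ultimately have "fst y \<in> sbasis V" if "y \<in> set (concat us)" for y
    using that by blast
  then have "set (concat us) \<subseteq> sbasis W"
    unfolding sbasis_W by (intro subsetI) (simp only: mem_Times_iff UNIV_I simp_thms)
  then show "us \<noteq> [] \<and> set (concat us) \<subseteq> sbasis W"
    using us \<open>ws \<noteq> []\<close> by blast
qed

lemma sigma_series:
  assumes "g \<in> nc_series W"
  shows "lin_ext sigma_K_mon g \<in> com_series W"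
  unfolding com_series_def
proof (intro CollectI allI impI)
  fix d u assume "lin_ext sigma_K_mon g (d, u) \<noteq> 0"
  then obtain i ws where nz: "g (i, ws) \<noteq> 0" "sigma_K_mon (i, ws) (d, u) \<noteq> (0 :: 'k)"
    by (metis lin_ext_nz surj_pair)
  then have "u = concat ws" by (auto simp: single_def split: if_splits)
  moreover have "set (concat ws) \<subseteq> sbasis W"
    using assms nz(1) unfolding W.nc_series_iff by blast
  ultimately show "u \<in> lists (sbasis W)" by (simp add: lists_eq_set)
qed

lemma lin_ext_phi_eq: "lin_ext phi f = lin_ext sigma_K_mon (lin_ext morita_mon f)"
  unfolding lin_ext_lin_ext[OF fin_cols_morita fin_cols_sigma] phi_def ..

lemma phi_series: "f \<in> nc_series V \<Longrightarrow> lin_ext phi f \<in> com_series W"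
  unfolding lin_ext_phi_eq by (intro sigma_series morita_series)

lemma sym_phi: "lin_ext (com_sym (spar W)) (lin_ext phi f) = lin_ext psi f"
  unfolding lin_ext_lin_ext[OF fin_cols_phi fin_cols_com_sym] psi_def ..

text \<open>\<open>X\<close> may be any set of noncommutative series that contains \<open>f0\<close>
  and on which \<open>psi\<close> is constant. In particular it may be the set that a noncommutative
  operator attaches to classes, so control of \<open>psi\<close> suffices to evaluate the composite
  there.\<close>

lemma sigma_morita:
  assumes f0: "f0 \<in> X" and X: "X \<subseteq> nc_series V"
    and psi: "\<forall>f\<in>X. lin_ext psi f = lin_ext psi f0"
  shows "sigma_K W (morita V X) = com_eq W `` {lin_ext phi f0}"
proof -
  have cls: "com_eq W `` {lin_ext sigma_K_mon g} = com_eq W `` {lin_ext phi f0}"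
    if "g \<in> morita V X" for g
  proof -
    from that obtain f where f: "f \<in> X" and fg: "(lin_ext morita_mon f, g) \<in> nc_eq W"
      unfolding morita_def descend_def W_def[symmetric] by auto
    have g: "g \<in> nc_series W" using W.nc_eq_series[OF fg] by simp
    have "lin_ext (com_sym (spar W)) (lin_ext sigma_K_mon g) = lin_ext psi f"
      unfolding sigma_K_cong[OF fg, symmetric] lin_ext_phi_eq[symmetric] by (rule sym_phi)
    also have "\<dots> = lin_ext psi f0" using psi f by (rule bspec)
    finally have "lin_ext (com_sym (spar W)) (lin_ext sigma_K_mon g) = lin_ext psi f0" .
    then show ?thesis
      unfolding sym_phi[of f0, symmetric]
      by (rule W.com_class_eq[OF sigma_series[OF g] phi_series[OF subsetD[OF X f0]]])
  qed
  have "(lin_ext morita_mon f0 :: nat \<times> ('b \<times> 'n \<times> 'n) list list \<Rightarrow> 'k) \<in> morita V X"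
    unfolding morita_def descend_def W_def[symmetric]
    by (rule UN_I[OF f0]) (rule W.nc_class_mem[OF morita_series[OF subsetD[OF X f0]]])
  then have "(morita V X :: (nat \<times> ('b \<times> 'n \<times> 'n) list list \<Rightarrow> 'k) set) \<noteq> {}" by blast
  then show ?thesis
    unfolding sigma_K_def descend_def by (rule SUP_eq_const) (rule cls)
qed

lemma P_nc_cases:
  assumes "x \<in> P_nc V"
  obtains f where "f \<in> nc_series V" "f \<in> x" "x \<subseteq> nc_series V"
    "\<forall>g\<in>x. lin_ext psi g = lin_ext psi f"
proof -
  obtain f where f: "f \<in> nc_series V" and x: "x = nc_eq V `` {f}"
    using assms unfolding P_nc_def by (elim quotientE)
  show ?thesis
  proof (rule that[OF f])
    show "f \<in> x" unfolding x by (rule nc_class_mem[OF f])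
    show "x \<subseteq> nc_series V" unfolding x using nc_eq_series by blast
    show "\<forall>g\<in>x. lin_ext psi g = lin_ext psi f" unfolding x using psi_cong by simp
  qed
qed

lemma psi_bracket:
  "lin_ext psi (bilin_ext (nc_bracket_mon V) f g)
    = lin_ext (com_sym (spar W)) (bilin_ext (com_bracket_mon W) (lin_ext phi f) (lin_ext phi g))"
proof -
  have "lin_ext psi (bilin_ext (nc_bracket_mon V) f g)
      = bilin_ext (\<lambda>z z'. lin_ext psi (nc_bracket_mon V z z')) f g"
    by (rule lin_ext_bilin_ext[OF fin_cols_nc_bracket fin_cols_psi])
  also have "\<dots> = lin_ext (com_sym (spar W)) (bilin_ext (\<lambda>z z'. bilin_ext (com_bracket_mon W) (phi z) (phi z')) f g)"
    unfolding psi_nc_bracket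
    by (rule lin_ext_bilin_ext[OF bilin_ext_lin_ext(2)[OF W.fin_cols_com_bracket fin_cols_phi fin_cols_phi]
        fin_cols_com_sym, symmetric])
  also have "\<dots> = lin_ext (com_sym (spar W)) (bilin_ext (com_bracket_mon W) (lin_ext phi f) (lin_ext phi g))"
    unfolding bilin_ext_lin_ext(1)[OF W.fin_cols_com_bracket fin_cols_phi fin_cols_phi] ..
  finally show ?thesis .
qed

lemma psi_differential:
  "lin_ext psi (lin_ext (nabla_mon V) f + lin_ext (gamma_delta_mon V) f)
    = lin_ext (com_sym (spar W)) (lin_ext (hbar_Delta_mon W) (lin_ext phi f))"
proof -
  have eq: "lin_ext (nabla_mon V) f + lin_ext (gamma_delta_mon V) f
    = lin_ext (\<lambda>z x. nabla_mon V z x + gamma_delta_mon V z x) f"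
    by (rule ext) (simp add: lin_ext_matrix_add[OF fin_cols_nabla fin_cols_gamma_delta])
  show ?thesis
    unfolding eq lin_ext_lin_ext[OF fin_cols_add[OF fin_cols_nabla fin_cols_gamma_delta] fin_cols_psi]
      psi_nabla_gamma_delta
    unfolding lin_ext_lin_ext[OF fin_cols_phi W.fin_cols_hbar_Delta]
      lin_ext_lin_ext[OF fin_cols_lin_ext[OF fin_cols_phi W.fin_cols_hbar_Delta] fin_cols_com_sym] ..
qed

lemma phi_com_eq:
  assumes "f \<in> nc_series V" "g \<in> nc_series V" "lin_ext psi f = lin_ext psi g"
  shows "(lin_ext phi f, lin_ext phi g) \<in> com_eq W"
  using assms by (simp add: com_eq_iff[OF W.finite_basis] phi_series sym_phi del: sbasis_W spar_W)

text \<open>The set \<open>nc_bracket V x y\<close> arises from all pairs of representatives. By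
  \<open>psi_bracket\<close> the value of \<open>psi\<close> on each is a symmetrized commutative
  bracket, which depends only on the classes of the two images.\<close>

lemma sigma_morita_bracket:
  assumes x: "x \<in> P_nc V" and y: "y \<in> P_nc V"
  shows "sigma_K W (morita V (nc_bracket V x y))
    = com_bracket W (sigma_K W (morita V x)) (sigma_K W (morita V y))"
proof -
  obtain f where f: "f \<in> nc_series V" "f \<in> x" "x \<subseteq> nc_series V"
    "\<forall>g\<in>x. lin_ext psi g = lin_ext psi f" by (rule P_nc_cases[OF x])
  obtain g where g: "g \<in> nc_series V" "g \<in> y" "y \<subseteq> nc_series V"
    "\<forall>h\<in>y. lin_ext psi h = lin_ext psi g" by (rule P_nc_cases[OF y])
  let ?fg = "bilin_ext (nc_bracket_mon V) f g"
  have fg: "?fg \<in> nc_series V" by (rule nc_bracket_series[OF f(1) g(1)])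
  have "sigma_K W (morita V (nc_bracket V x y)) = com_eq W `` {lin_ext phi ?fg}"
  proof (rule sigma_morita[OF _ _ ballI])
    show "?fg \<in> nc_bracket V x y"
      unfolding nc_bracket_def descend2_def using f(2) g(2) nc_class_mem[OF fg] by blast
    show "nc_bracket V x y \<subseteq> nc_series V"
      unfolding nc_bracket_def descend2_def using nc_eq_series by blast
    fix h assume "h \<in> nc_bracket V x y"
    then obtain f' g' where f': "f' \<in> x" and g': "g' \<in> y"
      and h: "(bilin_ext (nc_bracket_mon V) f' g', h) \<in> nc_eq V"
      unfolding nc_bracket_def descend2_def by auto
    have "lin_ext psi h = lin_ext psi (bilin_ext (nc_bracket_mon V) f' g')"
      by (rule psi_cong[OF h, symmetric])
    also have "\<dots> = lin_ext psi ?fg"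
      unfolding psi_bracket
    proof (intro W.com_bracket_cong phi_com_eq)
      show "f' \<in> nc_series V" "g' \<in> nc_series V" using f(3) f' g(3) g' by blast+
      show "lin_ext psi f' = lin_ext psi f" using f(4) f' by (rule bspec)
      show "lin_ext psi g' = lin_ext psi g" using g(4) g' by (rule bspec)
    qed (rule f(1) g(1))+
    finally show "lin_ext psi h = lin_ext psi ?fg" .
  qed
  also have "\<dots> = com_eq W `` {bilin_ext (com_bracket_mon W) (lin_ext phi f) (lin_ext phi g)}"
    using psi_bracket[of f g]
    by (intro W.com_class_eq phi_series[OF fg] W.com_bracket_series phi_series f(1) g(1)) (simp only: sym_phi)
  also have "\<dots> = com_bracket W (com_eq W `` {lin_ext phi f}) (com_eq W `` {lin_ext phi g})"
    by (rule W.com_bracket_class[OF phi_series[OF f(1)] phi_series[OF g(1)], symmetric])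
  finally show ?thesis
    by (simp only: sigma_morita[OF f(2-4)] sigma_morita[OF g(2-4)])
qed

lemma sigma_morita_differential:
  assumes x: "x \<in> P_nc V"
  shows "sigma_K W (morita V (nabla_gamma_delta V x)) = hbar_Delta W (sigma_K W (morita V x))"
proof -
  obtain f where f: "f \<in> nc_series V" "f \<in> x" "x \<subseteq> nc_series V"
    "\<forall>g\<in>x. lin_ext psi g = lin_ext psi f" by (rule P_nc_cases[OF x])
  let ?D = "\<lambda>f. lin_ext (nabla_mon V) f + lin_ext (gamma_delta_mon V) f"
  have Df: "?D f \<in> nc_series V" by (rule nc_differential_series[OF f(1)])
  have "sigma_K W (morita V (nabla_gamma_delta V x)) = com_eq W `` {lin_ext phi (?D f)}"
  proof (rule sigma_morita[OF _ _ ballI])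
    show "?D f \<in> nabla_gamma_delta V x"
      unfolding nabla_gamma_delta_def descend_def using f(2) nc_class_mem[OF Df] by blast
    show "nabla_gamma_delta V x \<subseteq> nc_series V"
      unfolding nabla_gamma_delta_def descend_def using nc_eq_series by blast
    fix h assume "h \<in> nabla_gamma_delta V x"
    then obtain f' where f': "f' \<in> x" and h: "(?D f', h) \<in> nc_eq V"
      unfolding nabla_gamma_delta_def descend_def by auto
    have "lin_ext psi h = lin_ext psi (?D f')"
      by (rule psi_cong[OF h, symmetric])
    also have "\<dots> = lin_ext psi (?D f)"
      unfolding psi_differential
    proof (intro W.hbar_Delta_cong phi_com_eq)
      show "f' \<in> nc_series V" using f(3) f' by blast
      show "lin_ext psi f' = lin_ext psi f" using f(4) f' by (rule bspec)
    qed (rule f(1))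
    finally show "lin_ext psi h = lin_ext psi (?D f)" .
  qed
  also have "\<dots> = com_eq W `` {lin_ext (hbar_Delta_mon W) (lin_ext phi f)}"
    using psi_differential[of f]
    by (intro W.com_class_eq phi_series[OF Df] W.hbar_Delta_series phi_series f(1)) (simp only: sym_phi)
  also have "\<dots> = hbar_Delta W (com_eq W `` {lin_ext phi f})"
    by (rule W.hbar_Delta_class[OF phi_series[OF f(1)], symmetric])
  finally show ?thesis by (simp only: sigma_morita[OF f(2-4)])
qed

end

section \<open>Invariance under commutators\<close>

text \<open>The definition reads the new letter off \<open>u\<close>; written as a sum over replaced
  labels, the action can be fed into linear extensions.\<close>

lemma gl_action_mon_eq:
  fixes X :: "'k::field_char_0 ^ 'n::finite ^ 'n"
    and w :: "('b \<times> 'n \<times> 'n) list"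
  shows "gl_action_mon X (e, w) = (\<lambda>y. \<Sum>r<length w. \<Sum>ij\<in>UNIV.
    gl_dual X (w ! r) (fst (w ! r), ij) * single (e, w[r := (fst (w ! r), ij)]) y)"
proof
  fix y :: "nat \<times> ('b \<times> 'n \<times> 'n) list"
  obtain d u where y: "y = (d, u)" by (cases y)
  have trm: "gl_dual X (w ! r) (u ! r) * of_bool (u = w[r := u ! r])
    = (\<Sum>ij\<in>UNIV. gl_dual X (w ! r) (fst (w ! r), ij) * of_bool (u = w[r := (fst (w ! r), ij)]))"
    (is "?l = ?r") if r: "r < length w" for r
  proof (cases "u = w[r := u ! r] \<and> fst (u ! r) = fst (w ! r)")
    case True
    have "u = w[r := (fst (w ! r), ij)] \<longleftrightarrow> ij = snd (u ! r)" for ij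
    proof
      assume "u = w[r := (fst (w ! r), ij)]"
      then have "u ! r = (fst (w ! r), ij)" using r by simp
      then show "ij = snd (u ! r)" by simp
    next
      assume "ij = snd (u ! r)"
      then show "u = w[r := (fst (w ! r), ij)]" using True by (metis prod.collapse)
    qed
    then have "?r = gl_dual X (w ! r) (fst (w ! r), snd (u ! r))"
      by simp
    moreover have "u ! r = (fst (w ! r), snd (u ! r))" using True by (metis prod.collapse)
    ultimately show ?thesis using True by simp
  next
    case False
    then have "?l = 0" by (auto simp: gl_dual_def)
    moreover have "u \<noteq> w[r := (fst (w ! r), ij)]" for ij
      using False r by auto
    then have "?r = 0" by simp
    ultimately show ?thesis by simp
  qed
  show "gl_action_mon X (e, w) y = (\<Sum>r<length w. \<Sum>ij\<in>UNIV.
    gl_dual X (w ! r) (fst (w ! r), ij) * single (e, w[r := (fst (w ! r), ij)]) y)"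
    unfolding y gl_action_mon.simps sum_distrib_left
  proof (rule sum.cong[OF refl])
    fix r assume "r \<in> {..<length w}"
    then have "of_bool (d = e) * (gl_dual X (w ! r) (u ! r) * of_bool (u = w[r := u ! r]))
      = (\<Sum>ij\<in>UNIV. of_bool (d = e) * (gl_dual X (w ! r) (fst (w ! r), ij) * of_bool (u = w[r := (fst (w ! r), ij)])))"
      unfolding trm[of r, simplified] by (simp only: trm lessThan_iff sum_distrib_left)
    also have "\<dots> = (\<Sum>ij\<in>UNIV. gl_dual X (w ! r) (fst (w ! r), ij) * single (e, w[r := (fst (w ! r), ij)]) (d, u))"
      by (intro sum.cong refl) (simp add: single_def)
    finally show "of_bool (d = e) * (gl_dual X (w ! r) (u ! r) * of_bool (u = w[r := u ! r]))
      = (\<Sum>ij\<in>UNIV. gl_dual X (w ! r) (fst (w ! r), ij) * single (e, w[r := (fst (w ! r), ij)]) (d, u))" .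
  qed
qed

lemma gl_action_nz:
  fixes X :: "'k::field_char_0 ^ 'n::finite ^ 'n"
  assumes "gl_action_mon X (e, w) (d, u) \<noteq> 0"
  shows "d = e" "map fst u = map fst w"
proof -
  have "\<exists>r<length w. \<exists>ij. (d, u) = (e, w[r := (fst (w ! r), ij)])"
  proof (rule ccontr)
    assume *: "\<not> ?thesis"
    have "gl_action_mon X (e, w) (d, u) = 0"
      unfolding gl_action_mon_eq by (intro sum.neutral ballI) (use * in \<open>auto simp: single_def\<close>)
    with assms show False by simp
  qed
  then obtain r ij where r: "r < length w" and eq: "(d, u) = (e, w[r := (fst (w ! r), ij)])" by blast
  then show "d = e" "map fst u = map fst w"
    by (simp_all add: map_update) (metis length_map list_update_id nth_map)
qed

lemma fin_cols_gl_action: "fin_cols (gl_action_mon (X :: 'k::field_char_0 ^ 'n::finite ^ 'n))"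
proof (rule fin_colsI[where X = "\<lambda>(d, u). {d} \<times> {w. set w \<subseteq> (fst ` set u) \<times> UNIV \<and> length w = length u}"])
  fix y :: "nat \<times> ('b \<times> 'n \<times> 'n) list"
  show "finite (case y of (d, u) \<Rightarrow> {d} \<times> {w. set w \<subseteq> (fst ` set u) \<times> (UNIV :: ('n \<times> 'n) set) \<and> length w = length u})"
    by (cases y) (auto intro!: finite_cartesian_product finite_lists_length_eq)
  fix z assume nz: "gl_action_mon X z y \<noteq> 0"
  obtain d u e w where yz: "y = (d, u)" "z = (e, w)" by (metis surj_pair)
  note * = gl_action_nz[OF nz[unfolded yz]]
  have "fst ` set u = fst ` set w" using arg_cong[OF *(2), of set] by simp
  then have "set w \<subseteq> (fst ` set u) \<times> UNIV" by (auto intro: rev_image_eqI)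
  moreover have "length w = length u" using *(2) by (metis length_map)
  ultimately show "z \<in> (case y of (d, u) \<Rightarrow> {d} \<times> {w. set w \<subseteq> (fst ` set u) \<times> UNIV \<and> length w = length u})"
    using *(1) by (auto simp: yz mem_Times_iff)
qed

lemma matrix_mult_diff_left: "(A ** (B - C)) = A ** B - A ** (C :: 'k::field_char_0 ^ 'n ^ 'm::finite)"
  by (simp add: vec_eq_iff matrix_matrix_mult_def right_diff_distrib sum_subtractf)

lemma matrix_mult_diff_right: "((A - B) ** C) = A ** C - B ** (C :: 'k::field_char_0 ^ 'n ^ 'm::finite)"
  by (simp add: vec_eq_iff matrix_matrix_mult_def left_diff_distrib sum_subtractf)

text \<open>Summed against \<open>gl_dual\<close>, the matrix unit E at \<open>k\<close> is replaced
  by -[X, E] = [E, X]. By the Leibniz rule the product M is then replaced by [M, X].\<close>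

lemma matrix_commutator_derivation:
  fixes X :: "'k::field_char_0 ^ 'n::finite ^ 'n" and p :: "nat \<Rightarrow> 'n \<times> 'n"
  shows "distinct c \<Longrightarrow> (\<Sum>k\<in>set c. \<Sum>z\<in>UNIV. matrix_product (map (p(k := z)) c) $ i $ j
      * gl_dual X (b, z) (b, p k))
    = (matrix_product (map p c) ** X - X ** matrix_product (map p c)) $ i $ j"
proof (induction c arbitrary: i j)
  case Nil
  then show ?case by simp
next
  case (Cons a c)
  let ?M = "matrix_product (map p c) :: 'k ^ 'n ^ 'n" and ?U = "matrix_unit (p a) :: 'k ^ 'n ^ 'n"
  have a: "a \<notin> set c" using Cons.prems by simp
  have "map (p(a := z)) c = map p c" for z
    using a by (intro map_cong refl) auto
  then have "matrix_product (map (p(a := z)) (a # c)) = matrix_unit z ** ?M" for z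
    by (simp only: list.map fun_upd_same matrix_product_simps)
  then have "(\<Sum>z\<in>UNIV. matrix_product (map (p(a := z)) (a # c)) $ i $ j * gl_dual X (b, z) (b, p a))
    = (\<Sum>s\<in>UNIV. \<Sum>t\<in>UNIV. (matrix_unit (s, t) ** ?M) $ i $ j * gl_dual X (b, (s, t)) (b, p a))"
    by (simp add: sum.cartesian_product case_prod_unfold)
  also have "\<dots> = (\<Sum>s\<in>UNIV. of_bool (i = s) * (\<Sum>t\<in>UNIV. ?M $ t $ j * gl_dual X (b, (s, t)) (b, p a)))"
    by (simp only: matrix_unit_mult sum_distrib_left mult.assoc)
  also have "\<dots> = (\<Sum>t\<in>UNIV. ?M $ t $ j * gl_dual X (b, (i, t)) (b, p a))"
    by (simp add: of_bool_def if_distrib[where f = "\<lambda>x. x * _"] cong: if_cong)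
  also have "\<dots> = - (((X ** ?U - ?U ** X) ** ?M) $ i $ j)"
    unfolding matrix_matrix_mult_def[of "X ** ?U - ?U ** X"] vec_lambda_beta sum_negf[symmetric]
    by (intro sum.cong refl) (simp add: gl_dual_def algebra_simps)
  finally have 1: "(\<Sum>z\<in>UNIV. matrix_product (map (p(a := z)) (a # c)) $ i $ j * gl_dual X (b, z) (b, p a))
    = - (((X ** ?U - ?U ** X) ** ?M) $ i $ j)" .
  obtain s t where st: "p a = (s, t)" by (cases "p a")
  have "(\<Sum>k\<in>set c. \<Sum>z\<in>UNIV. matrix_product (map (p(k := z)) (a # c)) $ i $ j * gl_dual X (b, z) (b, p k))
    = (\<Sum>k\<in>set c. \<Sum>z\<in>UNIV. of_bool (i = s) * (matrix_product (map (p(k := z)) c) $ t $ j * gl_dual X (b, z) (b, p k)))"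
    using a by (intro sum.cong refl) (auto simp: matrix_unit_mult st mult.assoc)
  also have "\<dots> = of_bool (i = s) * ((?M ** X - X ** ?M) $ t $ j)"
    using Cons.prems by (simp only: sum_distrib_left[symmetric] Cons.IH distinct.simps)
  also have "\<dots> = (?U ** (?M ** X - X ** ?M)) $ i $ j"
    by (simp only: st matrix_unit_mult)
  finally have 2: "(\<Sum>k\<in>set c. \<Sum>z\<in>UNIV. matrix_product (map (p(k := z)) (a # c)) $ i $ j * gl_dual X (b, z) (b, p k))
    = (?U ** (?M ** X - X ** ?M)) $ i $ j" .
  \<comment> \<open>The Leibniz rule [U, X] M + U [M, X] = [U M, X].\<close>
  have "- ((X ** ?U - ?U ** X) ** ?M) + ?U ** (?M ** X - X ** ?M)
    = (?U ** ?M) ** X - X ** (?U ** ?M)"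
    by (simp add: matrix_mult_diff_left matrix_mult_diff_right matrix_mul_assoc)
  then have 3: "- (((X ** ?U - ?U ** X) ** ?M) $ i $ j) + (?U ** (?M ** X - X ** ?M)) $ i $ j
    = ((?U ** ?M) ** X - X ** (?U ** ?M)) $ i $ j"
    by (metis vector_add_component vector_uminus_component)
  show ?case
    unfolding list.set sum.insert[OF finite_set a] 1 2 3 by (simp only: list.map matrix_product_simps)
qed

lemma trace_commutator_derivation:
  fixes X :: "'k::field_char_0 ^ 'n::finite ^ 'n" and p :: "nat \<Rightarrow> 'n \<times> 'n"
  assumes "distinct c"
  shows "(\<Sum>k\<in>set c. \<Sum>z\<in>UNIV. trace (matrix_product (map (p(k := z)) c)) * gl_dual X (b, z) (b, p k)) = 0"
proof -
  have "(\<Sum>k\<in>set c. \<Sum>z\<in>UNIV. trace (matrix_product (map (p(k := z)) c)) * gl_dual X (b, z) (b, p k))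
    = (\<Sum>k\<in>set c. \<Sum>z\<in>UNIV. \<Sum>i\<in>UNIV. matrix_product (map (p(k := z)) c) $ i $ i * gl_dual X (b, z) (b, p k))"
    by (simp only: trace_def sum_distrib_right)
  also have "\<dots> = (\<Sum>i\<in>UNIV. \<Sum>k\<in>set c. \<Sum>z\<in>UNIV. matrix_product (map (p(k := z)) c) $ i $ i * gl_dual X (b, z) (b, p k))"
    by (subst (2) sum.swap, subst sum.swap) (rule refl)
  also have "\<dots> = trace (matrix_product (map p c) ** X) - trace (X ** matrix_product (map p c))"
    unfolding matrix_commutator_derivation[OF assms] by (simp add: trace_def sum_subtractf)
  also have "\<dots> = 0" by (subst trace_mul_sym) simp
  finally show ?thesis .
qed

lemma trace_weight_commutator_derivation:
  fixes X :: "'k::field_char_0 ^ 'n::finite ^ 'n" and p :: "nat \<Rightarrow> 'n \<times> 'n"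
  shows "distinct (concat poss) \<Longrightarrow>
    (\<Sum>k\<in>set (concat poss). \<Sum>z\<in>UNIV. trace_weight (p(k := z)) poss * gl_dual X (b, z) (b, p k)) = 0"
proof (induction poss)
  case (Cons c poss)
  let ?t = "trace (matrix_product (map p c)) :: 'k"
  let ?d = "\<lambda>k z. gl_dual X (b, z) (b, p k)"
  have disj: "set c \<inter> set (concat poss) = {}" and dc: "distinct c" and dp: "distinct (concat poss)"
    using Cons.prems by auto
  have 1: "trace_weight (p(k := z)) (c # poss) = trace_weight p poss * trace (matrix_product (map (p(k := z)) c) :: 'k ^ 'n ^ 'n)"
    if "k \<in> set c" for k z
  proof -
    have "trace_weight (p(k := z)) poss = (trace_weight p poss :: 'k)"
      by (rule trace_weight_cong) (use disj that in \<open>metis disjoint_iff fun_upd_other\<close>)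
    then show ?thesis by simp
  qed
  have 2: "trace_weight (p(k := z)) (c # poss) = ?t * trace_weight (p(k := z)) poss"
    if "k \<in> set (concat poss)" for k z
  proof -
    have "map (p(k := z)) c = map p c"
      using disj that by (intro map_cong refl) (metis disjoint_iff fun_upd_other)
    then show ?thesis by (simp only: trace_weight_simps)
  qed
  have "(\<Sum>k\<in>set (concat (c # poss)). \<Sum>z\<in>UNIV. trace_weight (p(k := z)) (c # poss) * ?d k z)
    = (\<Sum>k\<in>set c. \<Sum>z\<in>UNIV. trace_weight (p(k := z)) (c # poss) * ?d k z)
      + (\<Sum>k\<in>set (concat poss). \<Sum>z\<in>UNIV. trace_weight (p(k := z)) (c # poss) * ?d k z)"
    unfolding concat.simps set_append by (rule sum.union_disjoint[OF finite_set finite_set disj])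
  also have "(\<Sum>k\<in>set c. \<Sum>z\<in>UNIV. trace_weight (p(k := z)) (c # poss) * ?d k z)
    = trace_weight p poss * (\<Sum>k\<in>set c. \<Sum>z\<in>UNIV. trace (matrix_product (map (p(k := z)) c)) * ?d k z)"
    unfolding sum_distrib_left by (intro sum.cong refl) (simp only: 1 mult.assoc)
  also have "(\<Sum>k\<in>set (concat poss). \<Sum>z\<in>UNIV. trace_weight (p(k := z)) (c # poss) * ?d k z)
    = ?t * (\<Sum>k\<in>set (concat poss). \<Sum>z\<in>UNIV. trace_weight (p(k := z)) poss * ?d k z)"
    unfolding sum_distrib_left by (intro sum.cong refl) (simp only: 2 mult.assoc)
  finally show ?case
    unfolding trace_commutator_derivation[OF dc] Cons.IH[OF dp] by (simp only: mult_zero_right add_0_right)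
qed simp

lemma gl_dual_label: "gl_dual X (b, z) (b, z') = gl_dual X (c, z) (c, z')"
  by (simp add: gl_dual_def)

lemma list_update_distinct_map:
  assumes "distinct L" "r < length L"
  shows "(map y L)[r := b] = map (y(L ! r := b)) L"
  using assms by (intro nth_equalityI) (auto simp: nth_list_update nth_eq_iff_index_eq)

lemma gl_action_map:
  assumes "distinct L"
  shows "gl_action_mon X (e, map y L) = (\<lambda>v. \<Sum>k\<in>set L. \<Sum>z\<in>UNIV.
    gl_dual X (y k) (fst (y k), z) * single (e, map (y(k := (fst (y k), z))) L) v)"
  unfolding gl_action_mon_eq sum_set_nth[OF assms] length_map
  by (intro ext sum.cong refl) (simp add: list_update_distinct_map[OF assms])

section \<open>The commutator action on images of cyclic words\<close>

context matrix_pairing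
begin

text \<open>Summation by parts: exchanging the names of the old and the new label at each position
  moves the action from the letters to the trace weight, which it annihilates. Thus the
  representative itself is killed, before passing to classes.\<close>

lemma gl_action_phi:
  fixes X :: "'k ^ 'n ^ 'n"
  shows "lin_ext (gl_action_mon X) (phi z) = (\<lambda>_. 0)"
proof
  fix v :: "nat \<times> ('b \<times> 'n \<times> 'n) list"
  obtain k ws where z: "z = (k, ws)" by (cases z)
  obtain x :: "nat \<Rightarrow> 'b" and poss where ws: "ws = map (map x) poss"
      and c: "concat poss = [0..<length (concat ws)]"
    by (rule ex_blocks)
  have d: "distinct (concat poss)" by (simp add: c)
  let ?L = "concat poss" and ?e = "2 * k + length poss - 1"
  let ?S = "\<lambda>p. single (?e, map (labelled x p) ?L) v :: 'k"
  \<comment> \<open>\<open>gl_dual\<close> has the same value for every letter that stands on both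
    sides, so an arbitrary one serves for all positions.\<close>
  let ?g = "\<lambda>z z'. gl_dual X (undefined :: 'b, z) (undefined, z')"
  have upd: "(labelled x p)(i := (x i, z)) = labelled x (p(i := z))" for p :: "nat \<Rightarrow> 'n \<times> 'n" and i z
    by (auto simp: labelled_def)
  have g: "gl_dual X (labelled x p i) (x i, z) = ?g (p i) z" for p i z
    unfolding labelled_def by (rule gl_dual_label)
  have "lin_ext (gl_action_mon X) (phi z) v = (\<Sum>p\<in>labels (set ?L). trace_weight p poss *
      (\<Sum>i\<in>set ?L. \<Sum>z\<in>UNIV. ?g (p i) z * ?S (p(i := z))))"
    unfolding z ws lin_ext_phi[OF fin_cols_gl_action d] gl_action_map[OF d] labelled_simps g upd ..
  also have "\<dots> = (\<Sum>i\<in>set ?L. \<Sum>p\<in>labels (set ?L). \<Sum>z\<in>UNIV.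
      trace_weight p poss * (?g (p i) z * ?S (p(i := z))))"
    unfolding sum_distrib_left by (rule sum.swap)
  also have "\<dots> = (\<Sum>i\<in>set ?L. \<Sum>p\<in>labels (set ?L). \<Sum>z\<in>UNIV.
      trace_weight (p(i := z)) poss * (?g z (p i) * ?S p))"
  proof (rule sum.cong[OF refl])
    fix i assume "i \<in> set ?L"
    then have L: "set ?L = insert i (set ?L - {i})" by auto
    have i: "i \<notin> set ?L - {i}" by simp
    \<comment> \<open>With the label at \<open>i\<close> split off, the old label \<open>a\<close>
      and the new label \<open>z\<close> are independent summation variables and may exchange their
      roles.\<close>
    have "(\<Sum>p\<in>labels (set ?L). \<Sum>z\<in>UNIV. trace_weight p poss * (?g (p i) z * ?S (p(i := z))))
      = (\<Sum>a\<in>UNIV. \<Sum>p\<in>labels (set ?L - {i}). \<Sum>z\<in>UNIV.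
          trace_weight (p(i := a)) poss * (?g a z * ?S (p(i := z))))"
      by (subst L, subst sum_labels_insert[OF i]) simp
    also have "\<dots> = (\<Sum>p\<in>labels (set ?L - {i}). \<Sum>a\<in>UNIV. \<Sum>z\<in>UNIV.
          trace_weight (p(i := a)) poss * (?g a z * ?S (p(i := z))))"
      by (rule sum.swap)
    also have "\<dots> = (\<Sum>p\<in>labels (set ?L - {i}). \<Sum>z\<in>UNIV. \<Sum>a\<in>UNIV.
          trace_weight (p(i := a)) poss * (?g a z * ?S (p(i := z))))"
      by (rule sum.cong[OF refl], rule sum.swap)
    also have "\<dots> = (\<Sum>z\<in>UNIV. \<Sum>p\<in>labels (set ?L - {i}). \<Sum>a\<in>UNIV.
          trace_weight (p(i := a)) poss * (?g a z * ?S (p(i := z))))"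
      by (rule sum.swap)
    also have "\<dots> = (\<Sum>p\<in>labels (set ?L). \<Sum>z\<in>UNIV. trace_weight (p(i := z)) poss * (?g z (p i) * ?S p))"
      by (subst (2) L, subst sum_labels_insert[OF i]) simp
    finally show "(\<Sum>p\<in>labels (set ?L). \<Sum>z\<in>UNIV. trace_weight p poss * (?g (p i) z * ?S (p(i := z))))
      = (\<Sum>p\<in>labels (set ?L). \<Sum>z\<in>UNIV. trace_weight (p(i := z)) poss * (?g z (p i) * ?S p))" .
  qed
  also have "\<dots> = (\<Sum>p\<in>labels (set ?L). (\<Sum>i\<in>set ?L. \<Sum>z\<in>UNIV. trace_weight (p(i := z)) poss * ?g z (p i)) * ?S p)"
    by (subst sum.swap) (simp only: sum_distrib_right mult.assoc)
  also have "\<dots> = 0"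
    unfolding trace_weight_commutator_derivation[OF d] by simp
  finally show "lin_ext (gl_action_mon X) (phi z) v = 0" .
qed

text \<open>Replacing a matrix label keeps the parity of the letter, so every summand of the action
  remains skew in the order of the letters.\<close>

lemma sym_gl_action_perm:
  fixes X :: "'k ^ 'n ^ 'n"
  assumes js: "js \<in> permutations_of_set {..<length w}"
  shows "lin_ext (com_sym (spar W)) (gl_action_mon X (e, w)) v
    = koszul (spar W) w js * lin_ext (com_sym (spar W)) (gl_action_mon X (e, map ((!) w) js)) v"
proof -
  obtain d u where v: "v = (d, u)" by (cases v)
  have dj: "distinct js" and s: "set js = set [0..<length w]"
    using js by (simp_all add: permutations_of_set_def lessThan_atLeast0)
  define G where "G L = (\<Sum>k\<in>set js. \<Sum>z\<in>UNIV. gl_dual X (w ! k) (fst (w ! k), z) *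
    com_sym (spar W) (e, map (((!) w)(k := (fst (w ! k), z))) L) v)" for L
  have eq: "lin_ext (com_sym (spar W)) (gl_action_mon X (e, map ((!) w) L)) v = G L"
    if "distinct L" "set L = set js" for L
    unfolding gl_action_map[OF that(1)] lin_ext_sum[OF fin_cols_com_sym] lin_ext_scale[OF fin_cols_com_sym]
      lin_ext_single G_def that(2) ..
  have par: "spar W ((((!) w)(k := (fst (w ! k), z))) a) = spar W (w ! a)" for k z a by simp
  have "skew UNIV (\<lambda>k. spar W (w ! k)) G"
    unfolding skew_def
  proof (intro allI impI)
    fix P Q :: "nat list" and a b
    have "com_sym (spar W) (e, map (((!) w)(k := (fst (w ! k), z))) (P @ a # b # Q)) v
      = sg (spar W (w ! a) \<and> spar W (w ! b)) *
        (com_sym (spar W) (e, map (((!) w)(k := (fst (w ! k), z))) (P @ b # a # Q)) v :: 'k)" for k z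
      unfolding v com_sym.simps map_append list.map
      by (subst symmetrize_swap) (simp only: par mult.left_commute)
    then show "G (P @ a # b # Q) = sg (spar W (w ! a) \<and> spar W (w ! b)) * G (P @ b # a # Q)"
      unfolding G_def by (simp only: sum_distrib_left mult.left_commute)
  qed
  then have "G [0..<length w] = koszul (spar W) w js * G js"
    using s by (intro skew_koszul[OF skew_mono[OF _ subset_UNIV] dj]) (simp_all add: lessThan_atLeast0)
  then show ?thesis
    using eq[of "[0..<length w]"] eq[OF dj] s by (simp add: map_nth)
qed

lemma sym_gl_action_cong:
  fixes X :: "'k ^ 'n ^ 'n"
  assumes "(f, g) \<in> com_eq W"
  shows "lin_ext (com_sym (spar W)) (lin_ext (gl_action_mon X) f)
    = lin_ext (com_sym (spar W)) (lin_ext (gl_action_mon X) g)"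
  unfolding lin_ext_lin_ext[OF fin_cols_gl_action fin_cols_com_sym]
proof (rule lin_ext_eq_mod[OF fin_cols_lin_ext[OF fin_cols_gl_action fin_cols_com_sym]])
  show "(f, g) \<in> eq_mod (com_series W) (degreewise_span (\<lambda>(e, w). (e, length w)) (com_relations W))"
    using assms by (simp only: com_eq_def)
  fix r assume "r \<in> com_relations W"
  then show "lin_ext (\<lambda>w. lin_ext (com_sym (spar W)) (gl_action_mon X w)) r = (\<lambda>_. 0)"
  proof (cases rule: W.com_relations_cases)
    case (1 e w js)
    show ?thesis unfolding 1(1)
      by (rule lin_ext_relation[OF fin_cols_lin_ext[OF fin_cols_gl_action fin_cols_com_sym]])
        (rule sym_gl_action_perm[OF 1(2)])
  qed
qed

lemma gl_action_series:
  fixes X :: "'k ^ 'n ^ 'n"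
  assumes "f \<in> com_series W"
  shows "lin_ext (gl_action_mon X) f \<in> com_series W"
  unfolding com_series_def
proof (intro CollectI allI impI)
  fix d u assume "lin_ext (gl_action_mon X) f (d, u) \<noteq> 0"
  then obtain e w where nz: "f (e, w) \<noteq> 0" "gl_action_mon X (e, w) (d, u) \<noteq> 0"
    by (metis lin_ext_nz surj_pair)
  have "fst ` set u = fst ` set w" using arg_cong[OF gl_action_nz(2)[OF nz(2)], of set] by simp
  moreover have "w \<in> lists (sbasis V \<times> UNIV)"
    using assms nz(1) unfolding com_series_def sbasis_W by blast
  then have "fst ` set w \<subseteq> sbasis V" by auto
  ultimately have "fst ` set u \<subseteq> sbasis V" by simp
  then show "u \<in> lists (sbasis W)"
    unfolding sbasis_W by (auto simp: lists_eq_set image_subset_iff mem_Times_iff)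
qed

lemma sigma_morita_invariant:
  assumes x: "x \<in> P_nc V"
  shows "sigma_K W (morita V x) \<in> P_hbar_inv W"
proof -
  obtain f where f: "f \<in> nc_series V" "f \<in> x" "x \<subseteq> nc_series V"
    "\<forall>g\<in>x. lin_ext psi g = lin_ext psi f" by (rule P_nc_cases[OF x])
  let ?Z = "com_eq W `` {lin_ext phi f}"
  have phi: "lin_ext phi f \<in> com_series W" by (rule phi_series[OF f(1)])
  have zero: "0 \<in> com_series W" by (simp add: com_series_def)
  have "descend (com_eq W) (lin_ext (gl_action_mon X)) ?Z = com_eq W `` {0}" for X :: "'k ^ 'n ^ 'n"
  proof -
    have "com_eq W `` {lin_ext (gl_action_mon X) g} = com_eq W `` {0}" if "g \<in> ?Z" for g
    proof (rule W.com_class_eq[OF _ zero])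
      have g: "(lin_ext phi f, g) \<in> com_eq W" using that by simp
      then show "lin_ext (gl_action_mon X) g \<in> com_series W"
        by (intro gl_action_series) (simp add: com_eq_iff[OF W.finite_basis])
      have "lin_ext (gl_action_mon X) (lin_ext phi f) = 0"
        unfolding lin_ext_lin_ext[OF fin_cols_phi fin_cols_gl_action] gl_action_phi
        by (simp add: lin_ext_def fun_eq_iff)
      then show "lin_ext (com_sym (spar W)) (lin_ext (gl_action_mon X) g) = lin_ext (com_sym (spar W)) 0"
        using sym_gl_action_cong[OF g, of X] by simp
    qed
    then show ?thesis
      unfolding descend_def using W.com_class_mem[OF phi] by blast
  qed
  moreover have "?Z \<in> P_hbar W" unfolding P_hbar_def using phi by (rule quotientI)
  ultimately show ?thesis
    unfolding P_hbar_inv_def sigma_morita[OF f(2-4)] by simp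
qed

end

section \<open>The inverse form\<close>

text \<open>\<open>G\<close> is a two-sided inverse of the Gram matrix; the description of
  \<open>inv_form\<close> by \<open>THE\<close> is evaluated in terms of it.\<close>

context
  fixes V :: "('b, 'k::field_char_0) superspace" and G :: "'b \<Rightarrow> 'b \<Rightarrow> 'k"
  assumes fin: "finite (sbasis V)"
    and FG: "\<And>a b. a \<in> sbasis V \<Longrightarrow> b \<in> sbasis V \<Longrightarrow> (\<Sum>c\<in>sbasis V. sform V a c * G c b) = of_bool (a = b)"
    and GF: "\<And>a b. a \<in> sbasis V \<Longrightarrow> b \<in> sbasis V \<Longrightarrow> (\<Sum>c\<in>sbasis V. G a c * sform V c b) = of_bool (a = b)"
begin

lemma sum_delta_left: "a \<in> sbasis V \<Longrightarrow> (\<Sum>c\<in>sbasis V. of_bool (a = c) * X c) = (X a :: 'k)"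
  using fin by (simp add: of_bool_def if_distrib[where f = "\<lambda>x. x * _"] cong: if_cong)

lemma sum_delta_right: "a \<in> sbasis V \<Longrightarrow> (\<Sum>c\<in>sbasis V. X c * of_bool (c = a)) = (X a :: 'k)"
  using fin by (simp add: of_bool_def if_distrib[where f = "\<lambda>x. _ * x"] cong: if_cong)

lemma cancel_left:
  assumes "a \<in> sbasis V"
  shows "(\<Sum>c\<in>sbasis V. G a c * (\<Sum>d\<in>sbasis V. sform V c d * X d)) = X a"
proof -
  have "(\<Sum>c\<in>sbasis V. G a c * (\<Sum>d\<in>sbasis V. sform V c d * X d))
    = (\<Sum>d\<in>sbasis V. (\<Sum>c\<in>sbasis V. G a c * sform V c d) * X d)"
    unfolding sum_distrib_left sum_distrib_right by (subst sum.swap) (simp only: mult.assoc)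
  also have "\<dots> = (\<Sum>d\<in>sbasis V. of_bool (a = d) * X d)"
    using assms by (intro sum.cong refl) (simp add: GF)
  finally show ?thesis by (simp only: sum_delta_left[OF assms])
qed

lemma cancel_right:
  assumes "a \<in> sbasis V"
  shows "(\<Sum>c\<in>sbasis V. (\<Sum>d\<in>sbasis V. X d * sform V d c) * G c a) = X a"
proof -
  have "(\<Sum>c\<in>sbasis V. (\<Sum>d\<in>sbasis V. X d * sform V d c) * G c a)
    = (\<Sum>d\<in>sbasis V. X d * (\<Sum>c\<in>sbasis V. sform V d c * G c a))"
    unfolding sum_distrib_left sum_distrib_right by (subst sum.swap) (simp only: mult.assoc)
  also have "\<dots> = (\<Sum>d\<in>sbasis V. X d * of_bool (d = a))"
    using assms by (intro sum.cong refl) (simp add: FG)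
  finally show ?thesis by (simp only: sum_delta_right[OF assms])
qed

text \<open>With D the diagonal matrix of parity signs and F the Gram matrix, the defining equation
  reads D F h F = F. As D is its own inverse, F h F = D F, hence h = G D.\<close>

lemma inv_form_eq:
  "inv_form V = (\<lambda>c d. if c \<in> sbasis V \<and> d \<in> sbasis V then G c d * sg (spar V d) else 0)" (is "_ = ?h")
  unfolding inv_form_def
proof (rule the_equality)
  have h: "sg (spar V a) * (\<Sum>c\<in>sbasis V. \<Sum>d\<in>sbasis V. sform V a c * ?h c d * sform V d b) = sform V a b"
    if a: "a \<in> sbasis V" and b: "b \<in> sbasis V" for a b
  proof -
    have "(\<Sum>c\<in>sbasis V. \<Sum>d\<in>sbasis V. sform V a c * ?h c d * sform V d b)
      = (\<Sum>d\<in>sbasis V. (\<Sum>c\<in>sbasis V. sform V a c * G c d) * (sg (spar V d) * sform V d b))"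
      unfolding sum_distrib_right by (subst sum.swap, intro sum.cong refl) (simp add: mult.assoc)
    also have "\<dots> = (\<Sum>d\<in>sbasis V. of_bool (a = d) * (sg (spar V d) * sform V d b))"
      using a by (intro sum.cong refl) (simp add: FG)
    finally show ?thesis by (simp add: sum_delta_left[OF a])
  qed
  then show "(\<forall>a\<in>sbasis V. \<forall>b\<in>sbasis V.
       sg (spar V a) * (\<Sum>c\<in>sbasis V. \<Sum>d\<in>sbasis V. sform V a c * ?h c d * sform V d b) = sform V a b) \<and>
    (\<forall>c d. c \<notin> sbasis V \<or> d \<notin> sbasis V \<longrightarrow> ?h c d = 0)" by auto
  fix h' assume h': "(\<forall>a\<in>sbasis V. \<forall>b\<in>sbasis V.
       sg (spar V a) * (\<Sum>c\<in>sbasis V. \<Sum>d\<in>sbasis V. sform V a c * h' c d * sform V d b) = sform V a b) \<and>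
    (\<forall>c d. c \<notin> sbasis V \<or> d \<notin> sbasis V \<longrightarrow> h' c d = 0)"
  \<comment> \<open>Any solution is recovered from the equation by multiplying with \<open>G\<close>
    on both sides, which gives uniqueness.\<close>
  have rec: "g c d = (\<Sum>b\<in>sbasis V. (\<Sum>a\<in>sbasis V. G c a * (sg (spar V a) * sform V a b)) * G b d)"
    if c: "c \<in> sbasis V" and d: "d \<in> sbasis V"
      and g: "\<And>a b. a \<in> sbasis V \<Longrightarrow> b \<in> sbasis V \<Longrightarrow>
        sg (spar V a) * (\<Sum>c\<in>sbasis V. \<Sum>d\<in>sbasis V. sform V a c * g c d * sform V d b) = sform V a b"
    for g c d
  proof -
    have g': "sg (spar V a) * sform V a b = (\<Sum>c\<in>sbasis V. sform V a c * (\<Sum>d\<in>sbasis V. g c d * sform V d b))"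
      if "a \<in> sbasis V" "b \<in> sbasis V" for a b
      by (subst g[OF that, symmetric]) (simp add: sum_distrib_left mult.assoc)
    have "(\<Sum>b\<in>sbasis V. (\<Sum>a\<in>sbasis V. G c a * (sg (spar V a) * sform V a b)) * G b d)
      = (\<Sum>b\<in>sbasis V. (\<Sum>d'\<in>sbasis V. g c d' * sform V d' b) * G b d)"
    proof (rule sum.cong[OF refl], rule arg_cong2[where f = "(*)", OF _ refl])
      fix b assume b: "b \<in> sbasis V"
      have "(\<Sum>a\<in>sbasis V. G c a * (sg (spar V a) * sform V a b))
        = (\<Sum>a\<in>sbasis V. G c a * (\<Sum>c\<in>sbasis V. sform V a c * (\<Sum>d\<in>sbasis V. g c d * sform V d b)))"
        by (rule sum.cong[OF refl]) (simp only: g' b)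
      also have "\<dots> = (\<Sum>d\<in>sbasis V. g c d * sform V d b)"
        by (rule cancel_left[OF c, where X = "\<lambda>c. \<Sum>d\<in>sbasis V. g c d * sform V d b"])
      finally show "(\<Sum>a\<in>sbasis V. G c a * (sg (spar V a) * sform V a b)) = (\<Sum>d\<in>sbasis V. g c d * sform V d b)" .
    qed
    also have "\<dots> = g c d" by (rule cancel_right[OF d])
    finally show ?thesis ..
  qed
  show "h' = ?h"
  proof (intro ext)
    fix c d
    show "h' c d = ?h c d"
    proof (cases "c \<in> sbasis V \<and> d \<in> sbasis V")
      case True
      then have c: "c \<in> sbasis V" and d: "d \<in> sbasis V" by auto
      have "h' c d = (\<Sum>b\<in>sbasis V. (\<Sum>a\<in>sbasis V. G c a * (sg (spar V a) * sform V a b)) * G b d)"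
        using h' by (intro rec[OF c d]) blast
      also have "\<dots> = ?h c d" by (rule rec[OF c d h, symmetric])
      finally show ?thesis .
    next
      case False
      then show ?thesis using h' by auto
    qed
  qed
qed

lemma right_inverse_unique:
  assumes "\<And>a b. a \<in> sbasis V \<Longrightarrow> b \<in> sbasis V \<Longrightarrow> (\<Sum>c\<in>sbasis V. sform V a c * R c b) = of_bool (a = b)"
    and a: "a \<in> sbasis V" and b: "b \<in> sbasis V"
  shows "R a b = G a b"
proof -
  have "R a b = (\<Sum>c\<in>sbasis V. G a c * (\<Sum>d\<in>sbasis V. sform V c d * R d b))"
    by (rule cancel_left[OF a, symmetric])
  also have "\<dots> = (\<Sum>c\<in>sbasis V. G a c * of_bool (c = b))"
    using b by (intro sum.cong refl) (simp add: assms(1))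
  finally show ?thesis by (simp only: sum_delta_right[OF b])
qed

text \<open>Uniqueness of the inverse carries properties of the Gram matrix over to
  \<open>G\<close>: minus the transpose of \<open>G\<close>, and the part of \<open>G\<close>
  between opposite parities, are right inverses as well. The sign \<open>sg (spar V d)\<close> then
  makes the antisymmetric \<open>G\<close> a symmetric inverse form, since paired letters have
  opposite parities.\<close>

lemma odd_pairing_of_inverse:
  assumes anti: "\<And>a b. a \<in> sbasis V \<Longrightarrow> b \<in> sbasis V \<Longrightarrow> sform V a b = - sform V b a"
    and odd: "\<And>a b. a \<in> sbasis V \<Longrightarrow> b \<in> sbasis V \<Longrightarrow> sform V a b \<noteq> 0 \<Longrightarrow> spar V a \<noteq> spar V b"
  shows "odd_pairing V"
proof
  have Ganti: "G a b = - G b a" if a: "a \<in> sbasis V" and b: "b \<in> sbasis V" for a b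
  proof -
    have "- G b a = G a b"
    proof (rule right_inverse_unique[OF _ a b])
      fix a b assume ab: "a \<in> sbasis V" "b \<in> sbasis V"
      have "(\<Sum>c\<in>sbasis V. sform V a c * - G b c) = (\<Sum>c\<in>sbasis V. G b c * sform V c a)"
        using ab by (intro sum.cong refl) (subst anti, auto)
      then show "(\<Sum>c\<in>sbasis V. sform V a c * - G b c) = of_bool (a = b)"
        using GF[OF ab(2,1)] by (simp add: eq_commute)
    qed
    then show ?thesis ..
  qed
  have Godd: "spar V a \<noteq> spar V b" if a: "a \<in> sbasis V" and b: "b \<in> sbasis V" and nz: "G a b \<noteq> 0" for a b
  proof
    assume par: "spar V a = spar V b"
    have "(if spar V a \<noteq> spar V b then G a b else 0) = G a b"
    proof (rule right_inverse_unique[OF _ a b])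
      fix a b assume ab: "a \<in> sbasis V" "b \<in> sbasis V"
      show "(\<Sum>c\<in>sbasis V. sform V a c * (if spar V c \<noteq> spar V b then G c b else 0)) = of_bool (a = b)"
      proof (cases "spar V a = spar V b")
        case True
        have "(\<Sum>c\<in>sbasis V. sform V a c * (if spar V c \<noteq> spar V b then G c b else 0))
          = (\<Sum>c\<in>sbasis V. sform V a c * G c b)"
        proof (intro sum.cong refl)
          fix c assume "c \<in> sbasis V"
          then show "sform V a c * (if spar V c \<noteq> spar V b then G c b else 0) = sform V a c * G c b"
            using odd[OF ab(1)] True by (cases "sform V a c = 0") auto
        qed
        then show ?thesis by (simp only: FG[OF ab])
      next
        case False
        have "(\<Sum>c\<in>sbasis V. sform V a c * (if spar V c \<noteq> spar V b then G c b else 0)) = 0"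
        proof (intro sum.neutral ballI)
          fix c assume "c \<in> sbasis V"
          then show "sform V a c * (if spar V c \<noteq> spar V b then G c b else 0) = 0"
            using odd[OF ab(1)] False by (cases "sform V a c = 0") auto
        qed
        then show ?thesis using False by auto
      qed
    qed
    with nz par show False by simp
  qed
  show "finite (sbasis V)" by (rule fin)
  fix a b
  show "inv_form V a b \<noteq> 0 \<Longrightarrow> a \<in> sbasis V \<and> b \<in> sbasis V"
    by (simp add: inv_form_eq split: if_splits)
  show "inv_form V a b \<noteq> 0 \<Longrightarrow> spar V a \<noteq> spar V b"
    using Godd by (auto simp: inv_form_eq split: if_splits)
  show "inv_form V a b = inv_form V b a"
  proof (cases "a \<in> sbasis V \<and> b \<in> sbasis V \<and> G a b \<noteq> 0")
    case True
    then have "spar V a \<noteq> spar V b" "G b a = - G a b" using Godd Ganti by blast+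
    with True show ?thesis by (cases "spar V a") (auto simp: inv_form_eq)
  next
    case False
    then have "a \<in> sbasis V \<Longrightarrow> b \<in> sbasis V \<Longrightarrow> G a b = 0 \<and> G b a = 0"
      using Ganti[of b a] by auto
    then show ?thesis by (auto simp: inv_form_eq)
  qed
qed

end

section \<open>The inverse form on the matrix space\<close>

lemma trace_matrix_unit2: "trace (matrix_unit (i, j) ** matrix_unit (k, l) :: 'k::field_char_0 ^ 'n::finite ^ 'n)
    = of_bool (i = l \<and> j = k)"
  unfolding trace_matrix_unit by (auto simp: matrix_unit_def)

text \<open>The inverse Gram matrix is the tensor product of \<open>G\<close> with the permutation
  matrix that exchanges the labels \<open>(i, j)\<close> and \<open>(j, i)\<close>, an
  involution.\<close>

lemma inv_form_matrix_space:
  fixes V :: "('b, 'k::field_char_0) superspace" and G :: "'b \<Rightarrow> 'b \<Rightarrow> 'k"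
  assumes fin: "finite (sbasis V)"
    and FG: "\<And>a b. a \<in> sbasis V \<Longrightarrow> b \<in> sbasis V \<Longrightarrow> (\<Sum>c\<in>sbasis V. sform V a c * G c b) = of_bool (a = b)"
    and GF: "\<And>a b. a \<in> sbasis V \<Longrightarrow> b \<in> sbasis V \<Longrightarrow> (\<Sum>c\<in>sbasis V. G a c * sform V c b) = of_bool (a = b)"
  shows "inv_form (matrix_space V :: ('b \<times> 'n::finite \<times> 'n, 'k) superspace) (a, i, j) (b, k, l)
    = inv_form V a b * of_bool (i = l \<and> j = k)"
proof -
  let ?W = "matrix_space V :: ('b \<times> 'n \<times> 'n, 'k) superspace"
  define H where "H = (\<lambda>x y :: 'b \<times> 'n \<times> 'n. G (fst x) (fst y)
    * of_bool (fst (snd x) = snd (snd y) \<and> snd (snd x) = fst (snd y)))"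
  have W: "sbasis ?W = sbasis V \<times> UNIV" "spar ?W x = spar V (fst x)"
    "sform ?W x y = sform V (fst x) (fst y) * of_bool (fst (snd x) = snd (snd y) \<and> snd (snd x) = fst (snd y))" for x y
    using trace_matrix_unit2[of "fst (snd x)" "snd (snd x)" "fst (snd y)" "snd (snd y)", where 'k = 'k]
    by (simp_all add: matrix_space_def)
  have sums: "(\<Sum>z\<in>sbasis ?W. (f (fst x) (fst z) * of_bool (fst (snd x) = snd (snd z) \<and> snd (snd x) = fst (snd z)))
        * (g (fst z) (fst y) * of_bool (fst (snd z) = snd (snd y) \<and> snd (snd z) = fst (snd y))))
      = (\<Sum>c\<in>sbasis V. f (fst x) c * g c (fst y)) * of_bool (snd x = snd y)"
    for x y :: "'b \<times> 'n \<times> 'n" and f g :: "'b \<Rightarrow> 'b \<Rightarrow> 'k"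
  proof -
    have "(\<Sum>z\<in>sbasis ?W. (f (fst x) (fst z) * of_bool (fst (snd x) = snd (snd z) \<and> snd (snd x) = fst (snd z)))
        * (g (fst z) (fst y) * of_bool (fst (snd z) = snd (snd y) \<and> snd (snd z) = fst (snd y))))
      = (\<Sum>c\<in>sbasis V. \<Sum>z\<in>UNIV. (f (fst x) c * g c (fst y)) *
          of_bool (z = (snd (snd x), fst (snd x)) \<and> snd x = snd y))"
      unfolding W(1) sum.cartesian_product case_prod_unfold
      by (intro sum.cong refl) (auto simp: prod_eq_iff of_bool_def)
    also have "\<dots> = (\<Sum>c\<in>sbasis V. (f (fst x) c * g c (fst y)) * of_bool (snd x = snd y))"
      by (intro sum.cong refl) (simp add: of_bool_conj)
    finally show ?thesis by (simp only: sum_distrib_right)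
  qed
  have "inv_form ?W = (\<lambda>c d. if c \<in> sbasis ?W \<and> d \<in> sbasis ?W then H c d * sg (spar ?W d) else 0)"
  proof (rule inv_form_eq)
    show "finite (sbasis ?W)" using fin by (simp add: W)
    fix x y assume "x \<in> sbasis ?W" "y \<in> sbasis ?W"
    then have xy: "fst x \<in> sbasis V" "fst y \<in> sbasis V" by (auto simp: W(1))
    show "(\<Sum>z\<in>sbasis ?W. sform ?W x z * H z y) = of_bool (x = y)"
      unfolding W(3) H_def sums FG[OF xy] by (auto simp: prod_eq_iff)
    show "(\<Sum>z\<in>sbasis ?W. H x z * sform ?W z y) = of_bool (x = y)"
      unfolding W(3) H_def sums GF[OF xy] by (auto simp: prod_eq_iff)
  qed
  moreover have "inv_form V = (\<lambda>c d. if c \<in> sbasis V \<and> d \<in> sbasis V then G c d * sg (spar V d) else 0)"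
    by (intro inv_form_eq fin FG GF)
  ultimately show ?thesis by (auto simp: W(1,2) H_def)
qed

section \<open>Inverting the form of the algebra\<close>

lemma (in finite_super_space) basis_parity: "b \<in> B \<Longrightarrow> b \<in> A0 \<longleftrightarrow> b \<notin> A1"
proof -
  assume b: "b \<in> B"
  have "b \<noteq> 0" using b basis(2) dependent_zero by blast
  then have "\<not> (b \<in> A0 \<and> b \<in> A1)" using direct_sum(1) by blast
  then show ?thesis using b homogeneous by blast
qed

text \<open>Nondegeneracy makes the rows of the Gram matrix independent. Being as many as the unit
  vectors they span these, and the coefficients form a left inverse \<open>L\<close>. An odd form is
  plainly symmetric, so \<open>L\<close> is symmetric and a right inverse too.\<close>

lemma (in cyclic_ainf_algebra) form_inverse:
  assumes odd: "odd_form A0 A1 form"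
  obtains L where "\<forall>a\<in>B. \<forall>b\<in>B. (\<Sum>c\<in>B. form a c * L c b) = of_bool (a = b)"
    "\<forall>a\<in>B. \<forall>b\<in>B. (\<Sum>c\<in>B. L a c * form c b) = of_bool (a = b)"
proof -
  interpret series: vector_space "fscale :: 'k \<Rightarrow> ('v \<Rightarrow> 'k) \<Rightarrow> 'v \<Rightarrow> 'k"
    by (rule vector_space_fscale)
  \<comment> \<open>The rows of the Gram matrix, extended by 0 so that they lie in the span of the
    unit vectors \<open>single a\<close> with \<open>a\<close> in \<open>B\<close>.\<close>
  define q where "q c = (\<lambda>a. if a \<in> B then form c a else 0)" for c
  have lin: "form (\<Sum>c\<in>B. smul (r c) c) y = (\<Sum>c\<in>B. r c * form c y)" for r y
  proof -
    interpret l: Vector_Spaces.linear smul "(*)" "\<lambda>x. form x y" by (rule bilinear(2))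
    show ?thesis by (simp add: l.sum l.scale)
  qed
  have indep: "r c = 0" if zero: "\<And>a. a \<in> B \<Longrightarrow> (\<Sum>c\<in>B. r c * form c a) = 0" and c: "c \<in> B" for r c
  proof -
    let ?x = "\<Sum>c\<in>B. smul (r c) c"
    have "form ?x y = 0" for y
    proof -
      interpret l: Vector_Spaces.linear smul "(*)" "form ?x" by (rule bilinear(1))
      have "y \<in> span B" using basis(3) by simp
      then show ?thesis
      proof (induction rule: span_induct_alt)
        case base
        then show ?case by (rule l.zero)
      next
        case (step c a y)
        then show ?case using zero[of a] lin[of r a] by (simp add: l.add l.scale)
      qed
    qed
    then have "?x = 0" by (rule nondegenerate)
    then show ?thesis
      using independentD[OF basis(2) basis(1) subset_refl] c by blast
  qed
  have inj: "inj_on q B"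
  proof (rule inj_onI, rule ccontr)
    fix c d assume cd: "c \<in> B" "d \<in> B" "q c = q d" "c \<noteq> d"
    have "(\<Sum>e\<in>B. (of_bool (e = c) - of_bool (e = d)) * form e a) = 0" if "a \<in> B" for a
    proof -
      have "form c a = form d a" using fun_cong[OF cd(3), of a] that by (simp add: q_def)
      moreover have "(\<Sum>e\<in>B. of_bool (e = f) * form e a) = form f a" if "f \<in> B" for f
        using basis(1) that by (simp add: of_bool_def if_distrib[where f = "\<lambda>x. x * _"] cong: if_cong)
      ultimately show ?thesis using cd(1,2) by (simp only: left_diff_distrib sum_subtractf) simp
    qed
    from indep[OF this cd(1)] cd(4) show False by simp
  qed
  have "series.independent (q ` B)"
  proof (rule series.independent_if_scalars_zero)
    show "finite (q ` B)" using basis(1) by simp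
    fix r x assume sum: "(\<Sum>x\<in>q ` B. fscale (r x) x) = 0" and "x \<in> q ` B"
    then obtain c where c: "c \<in> B" "x = q c" by auto
    have "(\<Sum>c\<in>B. r (q c) * form c a) = 0" if "a \<in> B" for a
    proof -
      have "(\<Sum>c\<in>B. fscale (r (q c)) (q c)) = 0"
        using sum by (simp add: sum.reindex[OF inj])
      from fun_cong[OF this, of a] that show ?thesis
        by (simp add: sum_fun_apply fscale_def q_def)
    qed
    from indep[OF this c(1)] show "r x = 0" by (simp add: c)
  qed
  note ind = this
  have q_span: "q ` B \<subseteq> series.span (single ` B)"
  proof
    fix x assume "x \<in> q ` B"
    then obtain c where c: "c \<in> B" "x = q c" by auto
    have "q c = (\<Sum>a\<in>B. fscale (form c a) (single a))"
      using basis(1) by (auto simp: fun_eq_iff sum_fun_apply fscale_def q_def single_def of_bool_def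
          if_distrib[where f = "\<lambda>x. _ * x"] cong: if_cong)
    then show "x \<in> series.span (single ` B)"
      unfolding c(2) by (simp only:) (intro series.span_sum series.span_scale series.span_base imageI)
  qed
  \<comment> \<open>Otherwise the unit vector could be added to the independent rows, giving more
    independent vectors than the \<open>card B\<close> unit vectors that span them.\<close>
  have single_span: "single b \<in> series.span (q ` B)" if b: "b \<in> B" for b
  proof (rule ccontr)
    assume notin: "single b \<notin> series.span (q ` B)"
    then have "series.independent (insert (single b) (q ` B))"
      using ind by (rule series.independent_insertI)
    moreover have "insert (single b) (q ` B) \<subseteq> series.span (single ` B)"
      using q_span b by (auto intro: series.span_base)
    ultimately have "card (insert (single b) (q ` B)) \<le> card (single ` B :: ('v \<Rightarrow> 'k) set)"
      using series.independent_span_bound[of "single ` B"] basis(1) by simp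
    moreover have "single b \<notin> q ` B" using notin series.span_base by blast
    then have "card (insert (single b) (q ` B)) = Suc (card B)"
      using basis(1) by (simp add: card_image[OF inj])
    moreover have "card (single ` B :: ('v \<Rightarrow> 'k) set) \<le> card B" by (rule card_image_le[OF basis(1)])
    ultimately show False by simp
  qed
  have "\<exists>r. \<forall>a\<in>B. (\<Sum>c\<in>B. r c * form c a) = of_bool (b = a)" if b: "b \<in> B" for b
  proof -
    obtain r where r: "single b = (\<Sum>x\<in>q ` B. fscale (r x) x)"
      using single_span[OF b] basis(1) by (auto simp: series.span_finite)
    have r': "single b = (\<Sum>c\<in>B. fscale (r (q c)) (q c))"
      using r by (simp add: sum.reindex[OF inj])
    have "(\<Sum>c\<in>B. r (q c) * form c a) = of_bool (b = a)" if "a \<in> B" for a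
    proof -
      have "(\<Sum>c\<in>B. fscale (r (q c)) (q c)) a = (\<Sum>c\<in>B. r (q c) * form c a)"
        using that by (simp add: sum_fun_apply fscale_def q_def)
      then show ?thesis using fun_cong[OF r', of a] by (auto simp: single_def)
    qed
    then show ?thesis by (intro exI[of _ "\<lambda>c. r (q c)"] ballI)
  qed
  then obtain L where L: "\<And>a b. a \<in> B \<Longrightarrow> b \<in> B \<Longrightarrow> (\<Sum>c\<in>B. L b c * form c a) = of_bool (b = a)"
    by metis
  \<comment> \<open>Only two odd elements carry a sign in the graded symmetry, and on those an odd
    form vanishes.\<close>
  have sym: "form a b = form b a" if "a \<in> B" "b \<in> B" for a b
  proof (cases "a \<in> A1 \<and> b \<in> A1")
    case True
    then show ?thesis using odd by (simp add: odd_form_def)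
  next
    case False
    have "a \<in> A0 \<union> A1" "b \<in> A0 \<union> A1" using homogeneous that by blast+
    from symmetric[OF this] False show ?thesis by (cases "a \<in> A1") auto
  qed
  have R: "(\<Sum>c\<in>B. form a c * L b c) = of_bool (a = b)" if "a \<in> B" "b \<in> B" for a b
  proof -
    have "(\<Sum>c\<in>B. form a c * L b c) = (\<Sum>c\<in>B. L b c * form c a)"
      using that by (intro sum.cong refl) (simp add: sym mult.commute)
    then show ?thesis using L[OF that] by (simp add: eq_commute)
  qed
  have "L a b = L b a" if ab: "a \<in> B" "b \<in> B" for a b
  proof -
    have "L a b = (\<Sum>c\<in>B. L a c * of_bool (c = b))"
      using basis(1) ab by (simp add: of_bool_def if_distrib[where f = "\<lambda>x. _ * x"] cong: if_cong)
    also have "\<dots> = (\<Sum>c\<in>B. L a c * (\<Sum>d\<in>B. form c d * L b d))"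
      using ab by (intro sum.cong refl) (simp add: R)
    also have "\<dots> = (\<Sum>d\<in>B. (\<Sum>c\<in>B. L a c * form c d) * L b d)"
      unfolding sum_distrib_left sum_distrib_right by (subst sum.swap) (simp only: mult.assoc)
    also have "\<dots> = (\<Sum>d\<in>B. of_bool (a = d) * L b d)"
      using ab by (intro sum.cong refl) (simp add: L)
    also have "\<dots> = L b a"
      using basis(1) ab by (simp add: of_bool_def if_distrib[where f = "\<lambda>x. x * _"] cong: if_cong)
    finally show ?thesis .
  qed
  then have "(\<Sum>c\<in>B. form a c * L c b) = of_bool (a = b)" if "a \<in> B" "b \<in> B" for a b
    using R[OF that] that by simp
  moreover have "(\<Sum>c\<in>B. L a c * form c b) = of_bool (a = b)" if "a \<in> B" "b \<in> B" for a b
    using L[OF that(2,1)] .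
  ultimately show ?thesis by (intro that[of L] ballI)
qed

section \<open>The Maurer-Cartan elements\<close>

lemma order_sign_snoc: "(\<And>k. k \<in> set L \<Longrightarrow> k < m) \<Longrightarrow> order_sign q (L @ [m]) = order_sign q L"
proof (induction L)
  case (Cons a L)
  have "(\<Prod>b\<in>set (L @ [m]). if b < a then sg (q a \<and> q b) else 1)
      = (\<Prod>b\<in>set L. if b < a then sg (q a \<and> q b) else (1 :: 'a))"
    using Cons.prems[of a] by (intro prod.mono_neutral_right) auto
  then show ?case using Cons by simp
qed simp

lemma koszul_snoc:
  assumes "js \<in> permutations_of_set {..<length w}"
  shows "koszul p (w @ [x]) (js @ [length w]) = (koszul p w js :: 'k::field_char_0)"
proof -
  have d: "distinct js" and s: "set js = {..<length w}"
    using assms by (simp_all add: permutations_of_set_def)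
  have "(order_sign (\<lambda>k. p ((w @ [x]) ! k)) (js @ [length w]) :: 'k) = order_sign (\<lambda>k. p ((w @ [x]) ! k)) js"
    using s by (intro order_sign_snoc) auto
  also have "\<dots> = order_sign (\<lambda>k. p (w ! k)) js"
    using s by (intro order_sign_cong) (auto simp: nth_append)
  finally show ?thesis using d s by (simp add: koszul_order_sign)
qed

text \<open>With one more factor at the end, one more suspension passes each of the earlier
  elements.\<close>

lemma susp_sign_snoc:
  "susp_sign p (w @ [x]) = susp_sign p w * (\<Prod>y\<leftarrow>w. sg (p y) :: 'k::field_char_0)"
proof -
  have "susp_sign p (w @ [x]) = (\<Prod>i<length w. sg (p (w ! i)) ^ (length w - Suc i) * sg (p (w ! i)) :: 'k)"
    unfolding susp_sign_def
    by (simp add: nth_append, intro prod.cong refl) (simp add: Suc_diff_Suc flip: power_Suc2)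
  then show ?thesis
    by (simp add: prod.distrib susp_sign_def prod.list_conv_set_nth lessThan_atLeast0)
qed

lemma susp_sign_square: "susp_sign p w * susp_sign p w = (1 :: 'k::field_char_0)"
  unfolding susp_sign_def prod.distrib[symmetric] power_mult_distrib[symmetric] by simp

lemma mset_map_perm:
  assumes "js \<in> permutations_of_set {..<length w}"
  shows "mset (map ((!) w) js) = mset w"
proof -
  have "mset js = mset [0..<length w]"
    using assms by (intro iffD1[OF set_eq_iff_mset_eq_distinct])
      (simp_all add: permutations_of_set_def lessThan_atLeast0)
  then have "mset (map ((!) w) js) = mset (map ((!) w) [0..<length w])" by (simp only: mset_map)
  then show ?thesis by (simp add: map_nth)
qed

lemma ainf_derivation_single: "ainf_derivation C (single [b]) = susp_struct C b"
  unfolding ainf_derivation_def lin_ext_single by (rule ext) (simp add: derivation_word_def)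

text \<open>The commutator permutes the inputs of the structure map and leaves the last argument of
  the form in place. The suspension sign in \<open>commutator_struct\<close> cancels that of the
  inputs in \<open>form_tensor\<close>; the remaining sign \<open>?P\<close> is symmetric in the
  inputs.\<close>

lemma form_tensor_commutator:
  fixes C :: "('b, 'k::field_char_0) superalgebra"
  shows "form_tensor C (commutator_struct C) (w @ [x]) =
    (\<Sum>js\<in>permutations_of_set {..<length w}. koszul (spar (suspension C)) w js
      * form_tensor C (sstruct C) (map ((!) w) js @ [x]))"
proof (cases "w \<noteq> [] \<and> w \<in> lists (sbasis C) \<and> x \<in> sbasis C")
  case True
  let ?P = "\<Prod>y\<leftarrow>w. sg (spar C y) :: 'k"
  have trm: "form_tensor C (sstruct C) (map ((!) w) js @ [x])
    = ?P * (\<Sum>b\<in>sbasis C. susp_struct C b (map ((!) w) js) * sform C b x)"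
    if js: "js \<in> permutations_of_set {..<length w}" for js
  proof -
    let ?v = "map ((!) w) js"
    have m: "mset ?v = mset w" by (rule mset_map_perm[OF js])
    then have s: "set ?v = set w" and l: "length ?v = length w"
      by (rule mset_eq_setD, rule mset_eq_length)
    have P: "(\<Prod>y\<leftarrow>?v. sg (spar C y)) = ?P"
      unfolding prod_mset_prod_list[symmetric] mset_map[where f = "\<lambda>y. sg (spar C y)"] m ..
    have v: "?v \<noteq> []" "?v \<in> lists (sbasis C)" "?v @ [x] \<in> lists (sbasis C)" "2 \<le> length (?v @ [x])"
      using True l s by (auto simp only: lists_eq_set mem_Collect_eq set_append) (cases w; auto)+
    show ?thesis
      using v unfolding form_tensor_def susp_struct_def susp_sign_snoc P
      by (simp add: sum_distrib_left mult_ac)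
  qed
  have l: "2 \<le> length (w @ [x])" "w @ [x] \<in> lists (sbasis C)" using True by (cases w; auto)+
  have "form_tensor C (commutator_struct C) (w @ [x])
    = susp_sign (spar C) w * ?P * (\<Sum>b\<in>sbasis C. susp_sign (spar C) w *
        (\<Sum>js\<in>permutations_of_set {..<length w}. koszul (spar (suspension C)) w js * susp_struct C b (map ((!) w) js))
        * sform C b x)"
    using l unfolding form_tensor_def commutator_struct_def ainf_derivation_single susp_sign_snoc by simp
  also have "\<dots> = (susp_sign (spar C) w * susp_sign (spar C) w) * (?P * (\<Sum>b\<in>sbasis C.
        (\<Sum>js\<in>permutations_of_set {..<length w}. koszul (spar (suspension C)) w js * susp_struct C b (map ((!) w) js))
        * sform C b x))"
    by (simp add: sum_distrib_left mult_ac)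
  also have "\<dots> = (\<Sum>js\<in>permutations_of_set {..<length w}. koszul (spar (suspension C)) w js
      * (?P * (\<Sum>b\<in>sbasis C. susp_struct C b (map ((!) w) js) * sform C b x)))"
    unfolding susp_sign_square sum_distrib_right sum_distrib_left
    by (subst sum.swap) (simp add: sum_distrib_left mult_ac)
  also have "\<dots> = (\<Sum>js\<in>permutations_of_set {..<length w}. koszul (spar (suspension C)) w js
      * form_tensor C (sstruct C) (map ((!) w) js @ [x]))"
    by (intro sum.cong refl) (simp only: trm)
  finally show ?thesis .
next
  case False
  have zero: "form_tensor C c (v @ [x]) = 0" if "mset v = mset w" for c v
    using False mset_eq_setD[OF that] mset_eq_length[OF that]
    by (auto simp: form_tensor_def lists_eq_set)
  have "(\<Sum>js\<in>permutations_of_set {..<length w}. koszul (spar (suspension C)) w js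
      * form_tensor C (sstruct C) (map ((!) w) js @ [x])) = 0"
    by (intro sum.neutral ballI) (simp only: zero[OF mset_map_perm] mult_zero_right)
  then show ?thesis by (simp only: zero[OF refl])
qed

text \<open>A permutation acts bijectively on the words with given letters, and symmetrization
  absorbs its sign. So every \<open>js\<close> contributes the same, and there are
  \<open>fact (length v - 1)\<close> of them because the last letter stays in place.\<close>

lemma symmetrize_average:
  fixes \<alpha> :: "'a list \<Rightarrow> 'k::field_char_0"
  assumes "v \<noteq> []"
  shows "(\<Sum>w | mset w = mset v. (\<Sum>js\<in>permutations_of_set {..<length v - 1}.
      koszul p w (js @ [length v - 1]) * \<alpha> (map ((!) w) (js @ [length v - 1]))) * symmetrize p w v)
    = fact (length v - 1) * (\<Sum>w | mset w = mset v. \<alpha> w * symmetrize p w v)"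
proof -
  define m where "m = length v - 1"
  have len: "length v = Suc m" using assms by (simp add: m_def)
  let ?M = "{w. mset w = mset v}"
  have "(\<Sum>w\<in>?M. koszul p w (js @ [m]) * \<alpha> (map ((!) w) (js @ [m])) * symmetrize p w v)
      = (\<Sum>w\<in>?M. \<alpha> w * symmetrize p w v)"
    if js: "js \<in> permutations_of_set {..<m}" for js
  proof -
    let ?J = "js @ [m]"
    have J: "?J \<in> permutations_of_set {..<length w}" if "w \<in> ?M" for w
    proof -
      have "length w = Suc m" using that len mset_eq_length[of w v] by simp
      then show ?thesis using js by (auto simp: permutations_of_set_def lessThan_Suc)
    qed
    have inj: "inj_on (\<lambda>w. map ((!) w) ?J) ?M"
    proof (rule inj_onI)
      fix w w' assume w: "w \<in> ?M" "w' \<in> ?M" and eq: "map ((!) w) ?J = map ((!) w') ?J"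
      from w have "mset w = mset w'" by simp
      then have l: "length w = length w'" by (rule mset_eq_length)
      have "set ?J = {..<length w}" using J[OF w(1)] by (rule permutations_of_setD)
      moreover have "\<forall>k\<in>set ?J. w ! k = w' ! k" using eq by (simp only: map_eq_conv)
      ultimately have "w ! k = w' ! k" if "k < length w" for k
        using that by simp
      then show "w = w'" by (rule nth_equalityI[OF l])
    qed
    have sub: "(\<lambda>w. map ((!) w) ?J) ` ?M \<subseteq> ?M" using mset_map_perm[OF J] by auto
    have bij: "bij_betw (\<lambda>w. map ((!) w) ?J) ?M ?M"
      using inj endo_inj_surj[OF finite_mset_eq sub inj] by (simp add: bij_betw_def)
    have "koszul p w ?J * \<alpha> (map ((!) w) ?J) * symmetrize p w v
        = \<alpha> (map ((!) w) ?J) * symmetrize p (map ((!) w) ?J) v" if w: "w \<in> ?M" for w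
    proof -
      have "distinct ?J" using J[OF w] by (simp add: permutations_of_set_def)
      then have k: "koszul p w ?J * koszul p w ?J = (1 :: 'k)" by (simp only: koszul_order_sign order_sign_square)
      have "koszul p w ?J * \<alpha> (map ((!) w) ?J) * symmetrize p w v
        = (koszul p w ?J * koszul p w ?J) * (\<alpha> (map ((!) w) ?J) * symmetrize p (map ((!) w) ?J) v)"
        by (subst symmetrize_perm[OF J[OF w]]) (simp only: mult_ac)
      then show ?thesis unfolding k by simp
    qed
    then have "(\<Sum>w\<in>?M. koszul p w ?J * \<alpha> (map ((!) w) ?J) * symmetrize p w v)
      = (\<Sum>w\<in>?M. \<alpha> (map ((!) w) ?J) * symmetrize p (map ((!) w) ?J) v)"
      by (rule sum.cong[OF refl])
    also have "\<dots> = (\<Sum>w\<in>?M. \<alpha> w * symmetrize p w v)"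
      by (rule sum.reindex_bij_betw[OF bij])
    finally show ?thesis .
  qed
  then have "(\<Sum>js\<in>permutations_of_set {..<m}. \<Sum>w\<in>?M. koszul p w (js @ [m]) * \<alpha> (map ((!) w) (js @ [m])) * symmetrize p w v)
      = fact m * (\<Sum>w\<in>?M. \<alpha> w * symmetrize p w v)"
    by simp
  then show ?thesis
    unfolding m_def[symmetric] sum_distrib_right by (subst sum.swap)
qed

text \<open>Pairing with the last matrix closes the product M of the others to a trace, as the sum
  of M_ij Tr(E_ij E) is Tr(M E). This is the effect of the matrix map on a cyclic word.\<close>

lemma form_tensor_matrix_algebra:
  fixes A :: "('b, 'k::field_char_0) superalgebra"
  shows "form_tensor (matrix_algebra A :: ('b \<times> 'n::finite \<times> 'n, 'k) superalgebra)
      (sstruct (matrix_algebra A)) u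
    = form_tensor A (sstruct A) (map fst u) * trace (matrix_product (map snd u) :: 'k ^ 'n ^ 'n)"
proof (cases u rule: rev_cases)
  case Nil
  then show ?thesis by (simp add: form_tensor_def)
next
  case (snoc w x)
  let ?C = "matrix_algebra A :: ('b \<times> 'n \<times> 'n, 'k) superalgebra"
  have C: "sbasis ?C = sbasis A \<times> UNIV" "spar ?C = (\<lambda>x. spar A (fst x))"
    "sform ?C y z = sform A (fst y) (fst z) * trace (matrix_unit (snd y) ** matrix_unit (snd z) :: 'k ^ 'n ^ 'n)"
    "sstruct ?C y v = sstruct A (fst y) (map fst v) * (matrix_product (map snd v) :: 'k ^ 'n ^ 'n) $ fst (snd y) $ snd (snd y)"
    for y z v
    by (simp_all add: matrix_algebra_def matrix_space_def superspace.extend_def)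
  have sign: "susp_sign (spar ?C) u = (susp_sign (spar A) (map fst u) :: 'k)"
    unfolding susp_sign_def C by simp
  have lists: "u \<in> lists (sbasis ?C) \<longleftrightarrow> map fst u \<in> lists (sbasis A)"
    unfolding C lists_eq_set by (auto simp: image_subset_iff mem_Times_iff)
  let ?M = "matrix_product (map snd w) :: 'k ^ 'n ^ 'n" and ?E = "matrix_unit (snd x) :: 'k ^ 'n ^ 'n"
  have "(\<Sum>y\<in>sbasis ?C. sstruct ?C y w * sform ?C y x)
    = (\<Sum>b\<in>sbasis A. \<Sum>z\<in>UNIV. (sstruct A b (map fst w) * sform A b (fst x)) *
        (?M $ fst z $ snd z * trace (matrix_unit z ** ?E)))"
    unfolding C sum.cartesian_product case_prod_unfold by (intro sum.cong refl) (simp add: mult_ac)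
  also have "\<dots> = (\<Sum>b\<in>sbasis A. sstruct A b (map fst w) * sform A b (fst x)) *
      (\<Sum>z\<in>UNIV. ?M $ fst z $ snd z * trace (matrix_unit z ** ?E))"
    by (simp only: sum_product)
  also have "(\<Sum>z\<in>UNIV. ?M $ fst z $ snd z * trace (matrix_unit z ** ?E))
    = (\<Sum>i\<in>UNIV. \<Sum>j\<in>UNIV. ?M $ i $ j * trace (matrix_unit (i, j) ** ?E))"
    by (simp add: sum.cartesian_product case_prod_unfold)
  also have "\<dots> = trace (?M ** ?E)"
    unfolding trace_matrix_unit by (simp add: trace_def matrix_matrix_mult_def)
  also have "?M ** ?E = matrix_product (map snd u)"
    by (simp add: snoc matrix_product_append)
  finally show ?thesis
    unfolding form_tensor_def sign lists by (simp add: snoc last_map map_butlast)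
qed

context matrix_pairing
begin

text \<open>One word without \<open>\<gamma>\<close> receives the exponent 0 of
  \<open>\<hbar>\<close>, and among the products of words that concatenate to \<open>u\<close> only
  \<open>[u]\<close> has a coefficient that may be nonzero.\<close>

lemma phi_m_tilde:
  fixes A :: "('b, 'k) superalgebra"
  defines "\<mu> \<equiv> \<lambda>(i :: nat, ws). case ws of [w] \<Rightarrow> of_bool (i = 0) * form_tensor A (sstruct A) w / of_nat (length w) | _ \<Rightarrow> 0"
  shows "lin_ext phi \<mu> (e, u) = of_bool (e = 0) *
    (form_tensor (matrix_algebra A :: ('b \<times> 'n \<times> 'n, 'k) superalgebra) (sstruct (matrix_algebra A)) u
      / of_nat (length u))"
proof -
  have mu0: "\<mu> (i, ws) = 0" if "i \<noteq> 0 \<or> (\<forall>w. ws \<noteq> [w])" for i ws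
    using that by (auto simp: \<mu>_def split: list.splits)
  have mor: "lin_ext morita_mon \<mu> (i, us) = \<mu> (i, map (map fst) us)
      * (\<Prod>c\<leftarrow>us. trace (matrix_product (map snd c) :: 'k ^ 'n ^ 'n))" for i us
    by (subst lin_ext_eq[where X = "{(i, map (map fst) us)}"])
      (auto simp: morita_mon_eq simp del: morita_mon.simps)
  have "lin_ext phi \<mu> (e, u) = lin_ext sigma_K_mon (lin_ext morita_mon \<mu>) (e, u)"
    by (simp only: lin_ext_phi_eq)
  also have "\<dots> = (\<Sum>z\<in>{(0, [u])}. lin_ext morita_mon \<mu> z * sigma_K_mon z (e, u))"
  proof (rule lin_ext_eq)
    fix z :: "nat \<times> ('b \<times> 'n \<times> 'n) list list" assume z: "z \<notin> {(0, [u])}"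
    obtain i us where zz: "z = (i, us)" by (cases z)
    show "lin_ext morita_mon \<mu> z = 0 \<or> sigma_K_mon z (e, u) = (0 :: 'k)"
    proof (cases "i = 0 \<and> (\<exists>w. us = [w])")
      case True
      then show ?thesis using z by (auto simp: zz single_def)
    next
      case False
      then have "i \<noteq> 0 \<or> (\<forall>w. map (map fst) us \<noteq> [w])" by auto
      then show ?thesis using mu0 by (simp add: zz mor)
    qed
  qed simp
  also have "\<dots> = of_bool (e = 0) * (form_tensor A (sstruct A) (map fst u)
      * trace (matrix_product (map snd u) :: 'k ^ 'n ^ 'n) / of_nat (length u))"
  proof -
    have "lin_ext morita_mon \<mu> (0, [u]) = form_tensor A (sstruct A) (map fst u) / of_nat (length u)
        * trace (matrix_product (map snd u) :: 'k ^ 'n ^ 'n)"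
      unfolding mor by (simp add: \<mu>_def)
    then show ?thesis by (simp add: single_def)
  qed
  finally show ?thesis by (simp only: form_tensor_matrix_algebra)
qed

text \<open>For k + 1 letters the factor 1/(k + 1)! of l-tilde meets k! equal contributions of the
  permuted inputs; what is left is 1/(k + 1), the coefficient in m-tilde.\<close>

lemma sym_m_tilde:
  fixes A :: "('b, 'k) superalgebra"
  defines "\<mu> \<equiv> \<lambda>(i :: nat, ws). case ws of [w] \<Rightarrow> of_bool (i = 0) * form_tensor A (sstruct A) w / of_nat (length w) | _ \<Rightarrow> 0"
    and "C \<equiv> matrix_algebra A :: ('b \<times> 'n \<times> 'n, 'k) superalgebra"
  assumes W: "W = suspension C"
  shows "lin_ext (com_sym (spar W)) (lin_ext phi \<mu>)
    = lin_ext (com_sym (spar W)) (\<lambda>(e, w). of_bool (e = 0) * form_tensor C (commutator_struct C) w / fact (length w))"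
proof
  fix x :: "nat \<times> ('b \<times> 'n \<times> 'n) list"
  obtain e v where x: "x = (e, v)" by (cases x)
  let ?p = "spar W" and ?\<alpha> = "form_tensor C (sstruct C)" and ?M = "{w. mset w = mset v}"
  have sum: "lin_ext (com_sym ?p) g (e, v) = (\<Sum>w\<in>?M. g (e, w) * symmetrize ?p w v)"
    for g :: "nat \<times> ('b \<times> 'n \<times> 'n) list \<Rightarrow> 'k"
    unfolding lin_ext_com_sym by (rule lin_ext_eq[OF finite_mset_eq]) (auto dest: symmetrize_nz)
  have len: "length w = length v" if "w \<in> ?M" for w using that by (auto dest: mset_eq_length)
  have "lin_ext (com_sym ?p) (\<lambda>(e, w). of_bool (e = 0) * form_tensor C (commutator_struct C) w / fact (length w)) (e, v)
    = of_bool (e = 0) / fact (length v) * (\<Sum>w\<in>?M. form_tensor C (commutator_struct C) w * symmetrize ?p w v)"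
    unfolding sum sum_distrib_left by (rule sum.cong[OF refl], drule len) (simp del: spar_W)
  also have "(\<Sum>w\<in>?M. form_tensor C (commutator_struct C) w * symmetrize ?p w v)
    = fact (length v - 1) * (\<Sum>w\<in>?M. ?\<alpha> w * symmetrize ?p w v)"
  proof (cases "v = []")
    case True
    then show ?thesis by (simp add: form_tensor_def)
  next
    case False
    have "form_tensor C (commutator_struct C) w = (\<Sum>js\<in>permutations_of_set {..<length v - 1}.
        koszul ?p w (js @ [length v - 1]) * ?\<alpha> (map ((!) w) (js @ [length v - 1])))" if w: "w \<in> ?M" for w
    proof -
      obtain w' y where w': "w = w' @ [y]" using False w by (cases w rule: rev_cases) auto
      have l: "length v - 1 = length w'" using len[OF w] by (simp add: w')
      show ?thesis
        unfolding l w' form_tensor_commutator W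
      proof (rule sum.cong[OF refl])
        fix js assume js: "js \<in> permutations_of_set {..<length w'}"
        have "map ((!) (w' @ [y])) (js @ [length w']) = map ((!) w') js @ [y]"
          using js by (auto simp: permutations_of_set_def nth_append)
        then show "koszul (spar (suspension C)) w' js * ?\<alpha> (map ((!) w') js @ [y])
          = koszul (spar (suspension C)) (w' @ [y]) (js @ [length w']) * ?\<alpha> (map ((!) (w' @ [y])) (js @ [length w']))"
          by (simp only: koszul_snoc[OF js])
      qed
    qed
    then have "(\<Sum>w\<in>?M. form_tensor C (commutator_struct C) w * symmetrize ?p w v)
      = (\<Sum>w\<in>?M. (\<Sum>js\<in>permutations_of_set {..<length v - 1}.
        koszul ?p w (js @ [length v - 1]) * ?\<alpha> (map ((!) w) (js @ [length v - 1]))) * symmetrize ?p w v)"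
      by (intro sum.cong refl) simp
    then show ?thesis by (simp only: symmetrize_average[OF False])
  qed
  also have "of_bool (e = 0) / fact (length v) * (fact (length v - 1) * (\<Sum>w\<in>?M. ?\<alpha> w * symmetrize ?p w v))
    = of_bool (e = 0) * ((\<Sum>w\<in>?M. ?\<alpha> w * symmetrize ?p w v) / of_nat (length v))"
  \<comment> \<open>The empty word is treated apart, since \<open>of_nat (length v)\<close> is then
    zero; the tensor vanishes there.\<close>
  proof (cases "v = []")
    case True
    then show ?thesis by (simp add: form_tensor_def)
  next
    case False
    have "fact (length v) = of_nat (length v) * (fact (length v - 1) :: 'k)"
      using False by (intro fact_reduce) simp
    moreover have "fact (length v - 1) \<noteq> (0 :: 'k)" by simp
    ultimately show ?thesis by (simp del: spar_W)
  qed
  also have "\<dots> = lin_ext (com_sym ?p) (lin_ext phi \<mu>) (e, v)"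
    unfolding sum \<mu>_def phi_m_tilde C_def[symmetric] sum_divide_distrib sum_distrib_left
    by (rule sum.cong[OF refl], drule len) (simp del: spar_W)
  finally show "lin_ext (com_sym (spar W)) (lin_ext phi \<mu>) x
    = lin_ext (com_sym (spar W)) (\<lambda>(e, w). of_bool (e = 0) * form_tensor C (commutator_struct C) w / fact (length w)) x"
    unfolding x ..
qed

lemma sigma_morita_m_tilde:
  fixes A :: "('b, 'k) superalgebra"
  assumes V: "V = suspension A" and W: "W = suspension (matrix_algebra A)"
  shows "m_tilde A \<in> P_nc V" "sigma_K W (morita V (m_tilde A)) = l_tilde (matrix_algebra A :: ('b \<times> 'n \<times> 'n, 'k) superalgebra)"
proof -
  let ?C = "matrix_algebra A :: ('b \<times> 'n \<times> 'n, 'k) superalgebra"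
  define \<mu> where "\<mu> = (\<lambda>(i :: nat, ws). case ws of
    [w] \<Rightarrow> of_bool (i = 0) * form_tensor A (sstruct A) w / of_nat (length w) | _ \<Rightarrow> 0)"
  define l where "l = (\<lambda>(e :: nat, w). of_bool (e = 0) * form_tensor ?C (commutator_struct ?C) w / fact (length w))"
  have m: "m_tilde A = nc_eq V `` {\<mu>}" by (simp add: m_tilde_def \<mu>_def V)
  have "\<mu> \<in> nc_series V"
    unfolding nc_series_def
  proof (intro CollectI allI impI)
    fix i ws assume nz: "\<mu> (i, ws) \<noteq> 0"
    then obtain w where ws: "ws = [w]" by (auto simp: \<mu>_def split: list.splits)
    with nz have "form_tensor A (sstruct A) w \<noteq> 0" by (auto simp: \<mu>_def)
    then have "w \<in> lists (sbasis A)" by (auto simp: form_tensor_def split: if_splits)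
    then show "ws \<noteq> [] \<and> ws \<in> lists (lists (sbasis V))" by (simp add: ws V suspension_def)
  qed
  note mu = this
  show mP: "m_tilde A \<in> P_nc V" unfolding m P_nc_def using mu by (rule quotientI)
  have "sigma_K W (morita V (m_tilde A)) = com_eq W `` {lin_ext phi \<mu>}"
  proof (rule sigma_morita[OF _ _ ballI])
    show "\<mu> \<in> m_tilde A" unfolding m by (rule nc_class_mem[OF mu])
    show "m_tilde A \<subseteq> nc_series V" unfolding m using nc_eq_series by blast
    fix g assume "g \<in> m_tilde A"
    then show "lin_ext psi g = lin_ext psi \<mu>" unfolding m using psi_cong by simp
  qed
  also have "\<dots> = com_eq W `` {l}"
  proof (rule W.com_class_eq[OF phi_series[OF mu]])
    show "l \<in> com_series W"
      unfolding com_series_def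
    proof (intro CollectI allI impI)
      fix e w assume "l (e, w) \<noteq> 0"
      then have "w \<in> lists (sbasis ?C)" by (auto simp: l_def form_tensor_def split: if_splits)
      then show "w \<in> lists (sbasis W)" by (simp add: W suspension_def)
    qed
    show "lin_ext (com_sym (spar W)) (lin_ext phi \<mu>) = lin_ext (com_sym (spar W)) l"
      unfolding \<mu>_def l_def by (rule sym_m_tilde[OF W])
  qed
  also have "\<dots> = l_tilde ?C" by (simp only: l_tilde_def l_def W)
  finally show "sigma_K W (morita V (m_tilde A)) = l_tilde ?C" .
qed

end

text \<open>Matrices are even, so the parities and the signs of the suspension involve the factor in
  \<open>A\<close> only.\<close>

lemma suspension_matrix_algebra:
  "suspension (matrix_algebra A) = matrix_space (suspension A)"
  by (simp add: suspension_def matrix_algebra_def matrix_space_def superspace.extend_def mult.assoc fun_eq_iff)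

theorem theorem4p13:
  fixes smul :: "'k::field_char_0 \<Rightarrow> 'v::ab_group_add \<Rightarrow> 'v"
    and A0 A1 B :: "'v set"
    and m :: "'v list \<Rightarrow> 'v"
    and form :: "'v \<Rightarrow> 'v \<Rightarrow> 'k"
  assumes "cyclic_ainf_algebra smul A0 A1 B m form"
    and "odd_form A0 A1 form"
  shows "let A = coordinates smul A1 B m form;
             gl = (matrix_algebra A :: ('v \<times> 'n::finite \<times> 'n, 'k) superalgebra);
             V = suspension A;
             W = suspension gl;
             \<Phi> = sigma_K W \<circ> morita V
         in (\<forall>x\<in>P_nc V. \<Phi> x \<in> P_hbar_inv W) \<and>
            (\<forall>x\<in>P_nc V. \<forall>y\<in>P_nc V. \<Phi> (nc_bracket V x y) = com_bracket W (\<Phi> x) (\<Phi> y)) \<and>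
            (\<forall>x\<in>P_nc V. \<Phi> (nabla_gamma_delta V x) = hbar_Delta W (\<Phi> x)) \<and>
            (\<forall>x\<in>P_nc V. \<Phi> (nc_bracket V (m_tilde A) x) = com_bracket W (l_tilde gl) (\<Phi> x))"
proof -
  interpret cyclic_ainf_algebra smul A0 A1 B m form by (rule assms(1))
  define A where "A = coordinates smul A1 B m form"
  define gl where "gl = (matrix_algebra A :: ('v \<times> 'n \<times> 'n, 'k) superalgebra)"
  define V where "V = suspension A"
  define W where W_gl: "W = suspension gl"
  have V_simps: "sbasis V = B" "spar V b = (b \<notin> A1)" "sform V a b = sg (a \<in> A1) * form a b" for a b
    by (simp_all add: V_def A_def suspension_def coordinates_def)
  obtain L where L: "\<forall>a\<in>B. \<forall>b\<in>B. (\<Sum>c\<in>B. form a c * L c b) = of_bool (a = b)"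
    "\<forall>a\<in>B. \<forall>b\<in>B. (\<Sum>c\<in>B. L a c * form c b) = of_bool (a = b)"
    by (rule form_inverse[OF assms(2)])
  \<comment> \<open>The Gram matrix of the suspension is D F, with D the parity signs in the algebra
    and F its form; as D is its own inverse, the inverse is L D.\<close>
  define G where "G = (\<lambda>a b. L a b * sg (b \<in> A1))"
  have fin: "finite (sbasis V)" by (simp add: V_simps basis(1))
  have FG: "(\<Sum>c\<in>sbasis V. sform V a c * G c b) = of_bool (a = b)" if "a \<in> sbasis V" "b \<in> sbasis V" for a b
  proof -
    have "(\<Sum>c\<in>sbasis V. sform V a c * G c b) = sg (a \<in> A1) * (\<Sum>c\<in>B. form a c * L c b) * sg (b \<in> A1)"
      unfolding V_simps G_def sum_distrib_left sum_distrib_right by (simp only: mult.assoc)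
    then show ?thesis using that by (auto simp: V_simps L(1))
  qed
  have GF: "(\<Sum>c\<in>sbasis V. G a c * sform V c b) = of_bool (a = b)" if "a \<in> sbasis V" "b \<in> sbasis V" for a b
  proof -
    have "(\<Sum>c\<in>sbasis V. G a c * sform V c b) = (\<Sum>c\<in>B. L a c * form c b)"
      unfolding V_simps G_def by (intro sum.cong refl) simp
    then show ?thesis using that by (simp add: V_simps L(2))
  qed
  have odd: "a \<in> A1 \<longleftrightarrow> b \<notin> A1" if ab: "a \<in> B" "b \<in> B" and nz: "form a b \<noteq> 0" for a b
    using assms(2) basis_parity[OF ab(1)] basis_parity[OF ab(2)] nz unfolding odd_form_def by blast
  interpret odd_pairing V
  proof (rule odd_pairing_of_inverse[OF fin FG GF])
    fix a b assume "a \<in> sbasis V" "b \<in> sbasis V"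
    then have ab: "a \<in> B" "b \<in> B" by (simp_all add: V_simps)
    have s: "form a b = sg (a \<in> A1 \<and> b \<in> A1) * form b a"
      using ab homogeneous by (intro symmetric) auto
    \<comment> \<open>Elements that pair have opposite parities: the form of the algebra is
      symmetric on them, while the signs from the suspension are opposite.\<close>
    show "sform V a b = - sform V b a"
    proof (cases "form a b = 0")
      case True
      then have "form b a = 0" using s by simp
      with True show ?thesis by (simp add: V_simps)
    next
      case False
      then have "a \<in> A1 \<longleftrightarrow> b \<notin> A1" by (rule odd[OF ab])
      with s show ?thesis by (cases "a \<in> A1") (simp_all add: V_simps)
    qed
    show "sform V a b \<noteq> 0 \<Longrightarrow> spar V a \<noteq> spar V b"
      using odd[OF ab] by (auto simp: V_simps)
  qed
  interpret matrix_pairing V W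
  proof
    show W: "W = matrix_space V"
      by (simp only: W_gl V_def gl_def suspension_matrix_algebra)
    show "inv_form W (a, i, j) (b, k, l) = inv_form V a b * of_bool (i = l \<and> j = k)" for a i j b k l
      unfolding W by (rule inv_form_matrix_space[OF fin FG GF])
  qed
  note mt = sigma_morita_m_tilde[OF V_def W_gl[unfolded gl_def], folded gl_def]
  have "(\<forall>x\<in>P_nc V. sigma_K W (morita V x) \<in> P_hbar_inv W) \<and>
     (\<forall>x\<in>P_nc V. \<forall>y\<in>P_nc V. sigma_K W (morita V (nc_bracket V x y))
        = com_bracket W (sigma_K W (morita V x)) (sigma_K W (morita V y))) \<and>
     (\<forall>x\<in>P_nc V. sigma_K W (morita V (nabla_gamma_delta V x)) = hbar_Delta W (sigma_K W (morita V x))) \<and>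
     (\<forall>x\<in>P_nc V. sigma_K W (morita V (nc_bracket V (m_tilde A) x))
        = com_bracket W (l_tilde gl) (sigma_K W (morita V x)))"
    \<comment> \<open>The last claim is the compatibility with brackets for the first argument
      m-tilde, whose image is l-tilde.\<close>
    using sigma_morita_bracket[OF mt(1)] mt(2)
    by (simp add: sigma_morita_invariant sigma_morita_bracket sigma_morita_differential)
  then show ?thesis
    unfolding Let_def comp_def A_def[symmetric] gl_def[symmetric] V_def[symmetric] W_gl[symmetric] .
qed

end
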